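(* Let $n\ge2$ and let $\Omega$ be a bounded convex domain of $\mathbb R^n$ with smooth boundary, containing the origin $O$, endowed with the Gaussian densities $\sigma_j(x)=e^{-j|x|^2}$, $j$ a positive integer. There exist a constant $K_{n,R}$ depending only on $n$ and $R=\mathrm{dist}(O,\partial\Omega)$, and a constant $B_n$ depending only on $n$, such that for all $j\ge K_{n,R}$, $$\frac{\Vert\sigma_j\Vert_{\frac n{n-2}}}{\Vert\sigma_j\Vert_1}\le\lambda_2(L_{\sigma_j})\le B_n\,\frac{\Vert\sigma_j\Vert_{\frac n{n-2}}}{\Vert\sigma_j\Vert_1}.$$ Moreover, $\lambda_2(L_{\sigma_j})$ tends to infinity with a linear growth as $j\to\infty$.
   Context: For a positive density $\sigma=e^{-f}$ on $\overline\Omega$, $L_\sigma u=\Delta u+\nabla f\cdot\nabla u$ with $\Delta=-\sum_i\partial_i^2$, considered on $\Omega$ with Neumann boundary conditions; it is self-adjoint on $L^2(\Omega,\sigma\,dx)$ with eigenvalues $0=\lambda_1(L_\sigma)<\lambda_2(L_\sigma)\le\cdots$. $\Vert\cdot\Vert_p$ is the $L^p(\Omega,dx)$ norm, with the convention $\Vert\sigma\Vert_{\frac n{n-2}}=\Vert\sigma\Vert_\infty$ when $n=2$. "Linear growth" means that $\lambda_2(L_{\sigma_j})$ is bounded between two positive constant multiples of $j$ (constants independent of $j$) for all large $j$. *)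

theory Defs
  imports "HOL-Probability.Essential_Supremum"
begin

definition grad :: "('a::euclidean_space \<Rightarrow> real) \<Rightarrow> 'a \<Rightarrow> 'a" where
  "grad f x = (\<Sum>i\<in>Basis. frechet_derivative f (at x) i *\<^sub>R i)"

primrec Ck_on :: "nat \<Rightarrow> 'a::euclidean_space set \<Rightarrow> ('a \<Rightarrow> real) \<Rightarrow> bool" where
  "Ck_on 0 U f \<longleftrightarrow> continuous_on U f"
| "Ck_on (Suc k) U f \<longleftrightarrow>
     f differentiable_on U \<and> (\<forall>i\<in>Basis. Ck_on k U (\<lambda>x. frechet_derivative f (at x) i))"

text \<open>The next notion is meant for open sets only.\<close>

definition smooth_on :: "'a::euclidean_space set \<Rightarrow> ('a \<Rightarrow> real) \<Rightarrow> bool" where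
  "smooth_on U f \<longleftrightarrow> (\<forall>k. Ck_on k U f)"

definition smooth_boundary :: "'a::euclidean_space set \<Rightarrow> bool" where
  "smooth_boundary \<Omega> \<longleftrightarrow>
     (\<forall>p\<in>frontier \<Omega>. \<exists>U \<rho>. open U \<and> p \<in> U \<and> smooth_on U \<rho> \<and>
        (\<forall>x\<in>U. grad \<rho> x \<noteq> 0) \<and> \<Omega> \<inter> U = {x\<in>U. \<rho> x < 0})"


section \<open>Lebesgue and Sobolev spaces on a bounded open set\<close>

text \<open>Membership in \<open>L\<^sup>2(\<Omega>, \<sigma> dx)\<close>, for scalar functions and for vector fields.\<close>

definition L2_on :: "'a::euclidean_space set \<Rightarrow> ('a \<Rightarrow> real) \<Rightarrow> ('a \<Rightarrow> 'b::euclidean_space) \<Rightarrow> bool" where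
  "L2_on \<Omega> \<sigma> u \<longleftrightarrow>
     u \<in> borel_measurable (lebesgue_on \<Omega>) \<and>
     integrable (lebesgue_on \<Omega>) (\<lambda>x. (norm (u x))\<^sup>2 * \<sigma> x)"

definition test_function :: "'a::euclidean_space set \<Rightarrow> ('a \<Rightarrow> real) \<Rightarrow> bool" where
  "test_function \<Omega> \<phi> \<longleftrightarrow>
     smooth_on UNIV \<phi> \<and> compact (closure {x. \<phi> x \<noteq> 0}) \<and> closure {x. \<phi> x \<noteq> 0} \<subseteq> \<Omega>"

definition weak_grad :: "'a::euclidean_space set \<Rightarrow> ('a \<Rightarrow> real) \<Rightarrow> ('a \<Rightarrow> 'a) \<Rightarrow> bool" where
  "weak_grad \<Omega> u G \<longleftrightarrow>
     (\<forall>\<phi>. test_function \<Omega> \<phi> \<longrightarrow>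
        (LINT x|lebesgue_on \<Omega>. u x *\<^sub>R grad \<phi> x) = - (LINT x|lebesgue_on \<Omega>. \<phi> x *\<^sub>R G x))"

definition weak_div :: "'a::euclidean_space set \<Rightarrow> ('a \<Rightarrow> 'a) \<Rightarrow> ('a \<Rightarrow> real) \<Rightarrow> bool" where
  "weak_div \<Omega> G D \<longleftrightarrow>
     (\<forall>\<phi>. test_function \<Omega> \<phi> \<longrightarrow>
        (LINT x|lebesgue_on \<Omega>. G x \<bullet> grad \<phi> x) = - (LINT x|lebesgue_on \<Omega>. \<phi> x * D x))"

text \<open>\<open>u \<in> H\<^sup>1(\<Omega>)\<close> with weak gradient \<open>G\<close>.\<close>

definition H1_on :: "'a::euclidean_space set \<Rightarrow> ('a \<Rightarrow> real) \<Rightarrow> ('a \<Rightarrow> 'a) \<Rightarrow> bool" where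
  "H1_on \<Omega> u G \<longleftrightarrow> L2_on \<Omega> (\<lambda>_. 1) u \<and> L2_on \<Omega> (\<lambda>_. 1) G \<and> weak_grad \<Omega> u G"

text \<open>
  For a square integrable field \<open>G\<close> with square integrable weak divergence \<open>D\<close>, the normal
  trace \<open>G \<cdot> \<nu>\<close> on the boundary is the functional
  \<open>v \<mapsto> \<integral>\<^sub>\<Omega> (G \<cdot> \<nabla>v + D v) dx\<close> on \<open>H\<^sup>1(\<Omega>)\<close>; by the divergence theorem it is
  \<open>\<integral>\<^sub>\<partial>\<^sub>\<Omega> (G \<cdot> \<nu>) v\<close> when \<open>G\<close> and \<open>v\<close> are smooth up to the boundary.
\<close>

definition zero_normal_trace :: "'a::euclidean_space set \<Rightarrow> ('a \<Rightarrow> 'a) \<Rightarrow> ('a \<Rightarrow> real) \<Rightarrow> bool" where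
  "zero_normal_trace \<Omega> G D \<longleftrightarrow>
     (\<forall>v V. H1_on \<Omega> v V \<longrightarrow> (LINT x|lebesgue_on \<Omega>. G x \<bullet> V x + D x * v x) = 0)"


section \<open>The Neumann operator of a density\<close>

text \<open>
  \<open>neumann_L \<Omega> \<sigma> u g\<close>: \<open>u\<close> lies in the domain of the self-adjoint realization in
  \<open>L\<^sup>2(\<Omega>, \<sigma> dx)\<close> of \<open>L\<^sub>\<sigma> = \<Delta> + \<nabla>f \<cdot> \<nabla>\<close>, where \<open>\<sigma> = e\<^sup>-\<^sup>f\<close> and \<open>\<Delta> = - div \<nabla>\<close>, with
  Neumann boundary condition, and \<open>L\<^sub>\<sigma> u = g\<close>.  Here \<open>G = \<nabla>u\<close> and \<open>D = div \<nabla>u\<close> in the weak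
  sense, so the domain is
  \<open>{u \<in> H\<^sup>1(\<Omega>). \<Delta>u \<in> L\<^sup>2(\<Omega>) \<and> \<partial>u/\<partial>\<nu> = 0}\<close>.  The density is assumed positive and
  smooth on the compact closure of \<open>\<Omega>\<close>, so that the weighted and unweighted spaces have the
  same elements.
\<close>

definition neumann_L :: "'a::euclidean_space set \<Rightarrow> ('a \<Rightarrow> real) \<Rightarrow> ('a \<Rightarrow> real) \<Rightarrow> ('a \<Rightarrow> real) \<Rightarrow> bool" where
  "neumann_L \<Omega> \<sigma> u g \<longleftrightarrow>
     L2_on \<Omega> \<sigma> u \<and> L2_on \<Omega> \<sigma> g \<and>
     (\<exists>G D. H1_on \<Omega> u G \<and> L2_on \<Omega> (\<lambda>_. 1) D \<and> weak_div \<Omega> G D \<and> zero_normal_trace \<Omega> G D \<and>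
        (AE x in lebesgue_on \<Omega>. g x = - D x + grad (\<lambda>y. - ln (\<sigma> y)) x \<bullet> G x))"

definition neumann_eigenfunction :: "'a::euclidean_space set \<Rightarrow> ('a \<Rightarrow> real) \<Rightarrow> real \<Rightarrow> ('a \<Rightarrow> real) \<Rightarrow> bool" where
  "neumann_eigenfunction \<Omega> \<sigma> \<mu> u \<longleftrightarrow>
     neumann_L \<Omega> \<sigma> u (\<lambda>x. \<mu> * u x) \<and> \<not> (AE x in lebesgue_on \<Omega>. u x = 0)"

definition lin_indep_ae :: "'a::euclidean_space set \<Rightarrow> nat \<Rightarrow> (nat \<Rightarrow> 'a \<Rightarrow> real) \<Rightarrow> bool" where
  "lin_indep_ae \<Omega> k u \<longleftrightarrow>
     (\<forall>c. (AE x in lebesgue_on \<Omega>. (\<Sum>i<k. c i * u i x) = 0) \<longrightarrow> (\<forall>i<k. c i = 0))"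

text \<open>
  The \<open>k\<close>-th eigenvalue (\<open>k \<ge> 1\<close>) in increasing order, repeated according to multiplicity:
  the least \<open>t\<close> such that the eigenvalues \<open>\<le> t\<close> have total multiplicity at least \<open>k\<close>.
\<close>

definition neumann_eigenvalue :: "nat \<Rightarrow> 'a::euclidean_space set \<Rightarrow> ('a \<Rightarrow> real) \<Rightarrow> real" where
  "neumann_eigenvalue k \<Omega> \<sigma> =
     Inf {t. \<exists>\<mu> u. (\<forall>i<k. \<mu> i \<le> t \<and> neumann_eigenfunction \<Omega> \<sigma> (\<mu> i) (u i)) \<and> lin_indep_ae \<Omega> k u}"


section \<open>Gaussian densities and norms\<close>

definition gauss_density :: "nat \<Rightarrow> 'a::euclidean_space \<Rightarrow> real" where
  "gauss_density j x = exp (- (real j * (norm x)\<^sup>2))"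

definition Lp_norm :: "'a::euclidean_space set \<Rightarrow> real \<Rightarrow> ('a \<Rightarrow> real) \<Rightarrow> real" where
  "Lp_norm \<Omega> p g = (LINT x|lebesgue_on \<Omega>. \<bar>g x\<bar> powr p) powr (1 / p)"

definition Linf_norm :: "'a::euclidean_space set \<Rightarrow> ('a \<Rightarrow> real) \<Rightarrow> real" where
  "Linf_norm \<Omega> g = real_of_ereal (esssup (lebesgue_on \<Omega>) (\<lambda>x. ereal \<bar>g x\<bar>))"

text \<open>The norm with exponent \<open>n / (n - 2)\<close>, read as \<open>\<infinity>\<close> when \<open>n = 2\<close>.\<close>

definition critical_norm :: "'a::euclidean_space set \<Rightarrow> ('a \<Rightarrow> real) \<Rightarrow> real" where
  "critical_norm \<Omega> g =
     (if DIM('a) = 2 then Linf_norm \<Omega> g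
      else Lp_norm \<Omega> (real DIM('a) / (real DIM('a) - 2)) g)"

end

theory Submission
  imports Defs "HOL-Complex_Analysis.Great_Picard" "HOL-Probability.Distributions" "HOL-Real_Asymp.Real_Asymp"
begin

text \<open>
  The core is the Poincare inequality with constant \<open>2\<kappa>\<close> for the weight \<open>exp (- \<kappa> |x - p|\<^sup>2)\<close> on a
  convex set. It is the second order term, as \<open>\<epsilon> \<rightarrow> 0\<close>, of the Prekopa-Leindler inequality
  applied to \<open>exp (\<epsilon> u - \<epsilon>\<^sup>2 \<theta> |\<nabla>u|\<^sup>2)\<close> and \<open>exp (- \<epsilon> u)\<close>, and it passes to \<open>H\<^sup>1\<close> by mollifying
  contracted copies of a function. Applied with \<open>\<kappa> = j\<close> it bounds every nonzero eigenvalue below by \<open>2j\<close>.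
  Applied to the cells of a fine grid it yields the compactness of \<open>H\<^sup>1\<close> in \<open>L\<^sup>2\<close>; hence the
  Rayleigh quotient has a minimiser orthogonal to the constants, which is an eigenfunction, and the
  quotient of a coordinate function shows that its eigenvalue is \<open>O(j)\<close>. Finally, the quotient
  of norms is at most \<open>2j/\<pi>\<close> once the ball of radius \<open>R\<close> carries half of the Gaussian mass, and
  it is bounded below by a multiple of \<open>j\<close> by restricting to the ball of radius \<open>j\<close> to the power \<open>-1/2\<close>.
\<close>

section \<open>The Prekopa-Leindler inequality\<close>

text \<open>\<open>neumann_eigenvalue\<close> is an infimum over a set of reals and says nothing
  when that set is empty. So no bound, not even the lower one, can be derived before a second
  eigenfunction is known to exist; this is what forces the compactness argument. A spectral gap of
  this kind is often obtained from the Bochner formula, which calls for functions regular up to the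
  boundary and for the sign of a curvature term there. Prekopa-Leindler involves neither derivatives
  nor boundary integrals: convexity enters through midpoints only, and the constant 2 \<kappa> comes
  from the parallelogram identity for the square of |x - p|. The Neumann condition accordingly
  appears only in its weak form. In the end two quantities of order j are compared: the eigenvalue
  lies between 2j and b j, the quotient of norms between a j and 2j / pi, with a and b depending on
  the dimension alone. The first inequality of the theorem holds because 2j / pi is below 2j, the
  second with the constant b / a.\<close>

lemma emeasure_compact_midpoints:
  fixes A B C :: "real set"
  assumes A: "compact A" "A \<noteq> {}" and B: "compact B" "B \<noteq> {}" and C: "C \<in> sets borel"
    and mid: "\<And>a b. a \<in> A \<Longrightarrow> b \<in> B \<Longrightarrow> (a + b) / 2 \<in> C"
  shows "emeasure lborel A + emeasure lborel B \<le> 2 * emeasure lborel C"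
proof -
  obtain s where s: "s \<in> A" "\<And>a. a \<in> A \<Longrightarrow> a \<le> s" using compact_attains_sup[OF A] by auto
  obtain m where m: "m \<in> B" "\<And>b. b \<in> B \<Longrightarrow> m \<le> b" using compact_attains_inf[OF B] by auto
  \<comment> \<open>Brunn-Minkowski on the line: each point of \<open>A\<close> is averaged with the
    least point of \<open>B\<close>, each point of \<open>B\<close> with the greatest point of
    \<open>A\<close>. The first averages lie to the left of \<open>(s + m) / 2\<close>, the second
    to its right, so their measures add up.\<close>
  define S where "S = (\<lambda>a. (1/2) *\<^sub>R a + m/2) ` A"
  define T where "T = (\<lambda>b. (1/2) *\<^sub>R b + s/2) ` B"
  have cpt: "compact S" "compact T"
    unfolding S_def T_def by (auto intro!: compact_continuous_image continuous_intros A B)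
  then have [measurable]: "S \<in> sets borel" "T \<in> sets borel"
    by (auto intro: borel_compact)
  have [measurable]: "A \<in> sets borel" "B \<in> sets borel" using A B by (auto intro: borel_compact)
  have half: "ennreal (1/2) * x * 2 = x" for x
  proof -
    have "ennreal (1/2) * 2 = ennreal (1/2) * ennreal 2" by simp
    also have "\<dots> = 1" by (subst ennreal_mult[symmetric]) auto
    finally show ?thesis by (simp add: mult.commute mult.left_commute)
  qed
  have "emeasure lborel S = ennreal (1/2) * emeasure lborel A"
    using emeasure_lebesgue_affine[of "1/2" "m/2" A] unfolding S_def[symmetric] by simp
  then have eS: "emeasure lborel S * 2 = emeasure lborel A" by (simp only: half)
  have "emeasure lborel T = ennreal (1/2) * emeasure lborel B"
    using emeasure_lebesgue_affine[of "1/2" "s/2" B] unfolding T_def[symmetric] by simp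
  then have eT: "emeasure lborel T * 2 = emeasure lborel B" by (simp only: half)
  \<comment> \<open>\<open>S\<close> and \<open>T\<close> are halved translates of \<open>A\<close> and \<open>B\<close> that meet in one point only.\<close>
  have sub: "S \<union> T \<subseteq> C"
    using mid[OF _ m(1)] mid[OF s(1)] by (auto simp: S_def T_def field_simps)
  have int: "S \<inter> T \<subseteq> {(s + m) / 2}"
  proof
    fix x assume "x \<in> S \<inter> T"
    then obtain a b where ab: "a \<in> A" "b \<in> B" "x = (1/2) *\<^sub>R a + m/2" "x = (1/2) *\<^sub>R b + s/2"
      unfolding S_def T_def by auto
    have "a \<le> s" "m \<le> b" using s m ab by auto
    then have "x = (s + m) / 2" using ab(3,4) by (simp add: field_simps)
    then show "x \<in> {(s + m) / 2}" by simp
  qed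
  have "emeasure lborel (S \<inter> T) \<le> emeasure lborel {(s + m) / 2}"
    by (intro emeasure_mono int) auto
  then have "emeasure lborel S + emeasure lborel T = emeasure lborel (S \<union> T)"
    using emeasure_Un_Int[of S lborel T] by simp
  also have "\<dots> \<le> emeasure lborel C"
    using C by (intro emeasure_mono sub) auto
  finally have "(emeasure lborel S + emeasure lborel T) * 2 \<le> emeasure lborel C * 2"
    by (intro mult_right_mono) auto
  then show ?thesis unfolding distrib_right eS eT by (simp add: mult.commute)
qed

text \<open>Inner regularity reduces the claim to compact sets. \<open>C\<close> is a Borel set
  containing the midpoints instead of the set of midpoints itself, because the latter need not be
  Borel.\<close>

lemma emeasure_bounded_midpoints:
  fixes A B C :: "real set"
  assumes A: "A \<in> sets borel" "bounded A" "A \<noteq> {}" and B: "B \<in> sets borel" "bounded B" "B \<noteq> {}"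
    and C: "C \<in> sets borel"
    and mid: "\<And>a b. a \<in> A \<Longrightarrow> b \<in> B \<Longrightarrow> (a + b) / 2 \<in> C"
  shows "emeasure lborel A + emeasure lborel B \<le> 2 * emeasure lborel C"
proof (rule ennreal_le_epsilon)
  fix e :: real assume e: "0 < e"
  have approx: "\<exists>K. compact K \<and> K \<noteq> {} \<and> K \<subseteq> X \<and> emeasure lborel X \<le> emeasure lborel K + ennreal (e/2)"
    if X: "X \<in> sets borel" "bounded X" "X \<noteq> {}" for X :: "real set"
  proof -
    obtain a where a: "a \<in> X" using X by auto
    obtain T where T: "closed T" "T \<subseteq> X" "emeasure lebesgue (X - T) < ennreal (e/2)"
      using sets_lebesgue_inner_closed[of X "e/2"] X(1) e by (metis half_gt_zero sets_completionI_sets sets_lborel)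
    have [measurable]: "T \<in> sets borel" using T by auto
    have [measurable]: "X \<in> sets borel" by fact
    \<comment> \<open>The closed set given by inner regularity may be empty; one added point of
      \<open>X\<close> makes it nonempty, as the compact case requires.\<close>
    have "X = insert a T \<union> (X - T)" using T a by auto
    moreover have "insert a T \<in> sets lborel" "X - T \<in> sets lborel" by auto
    ultimately have "emeasure lborel X \<le> emeasure lborel (insert a T) + emeasure lborel (X - T)"
      using emeasure_subadditive[of "insert a T" lborel "X - T"] by simp
    also have "\<dots> \<le> emeasure lborel (insert a T) + ennreal (e/2)"
      using T(3) by (intro add_left_mono) auto
    finally have "emeasure lborel X \<le> emeasure lborel (insert a T) + ennreal (e/2)" .
    moreover have "compact (insert a T)"
      using T X by (intro compact_insert) (meson bounded_subset compact_eq_bounded_closed)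
    ultimately show ?thesis using T a by (intro exI[of _ "insert a T"]) auto
  qed
  obtain K L where K: "compact K" "K \<noteq> {}" "K \<subseteq> A" "emeasure lborel A \<le> emeasure lborel K + ennreal (e/2)"
    and L: "compact L" "L \<noteq> {}" "L \<subseteq> B" "emeasure lborel B \<le> emeasure lborel L + ennreal (e/2)"
    using approx[OF A] approx[OF B] by blast
  have "emeasure lborel A + emeasure lborel B
      \<le> (emeasure lborel K + emeasure lborel L) + (ennreal (e/2) + ennreal (e/2))"
    using add_mono[OF K(4) L(4)] by (simp add: ac_simps)
  also have "ennreal (e/2) + ennreal (e/2) = ennreal e"
    using e by (simp flip: ennreal_plus)
  also have "emeasure lborel K + emeasure lborel L \<le> 2 * emeasure lborel C"
    using K L C mid by (intro emeasure_compact_midpoints) auto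
  finally show "emeasure lborel A + emeasure lborel B \<le> 2 * emeasure lborel C + ennreal e"
    by (simp add: add_right_mono)
qed

lemma emeasure_midpoints:
  fixes A B C :: "real set"
  assumes A: "A \<in> sets borel" "A \<noteq> {}" and B: "B \<in> sets borel" "B \<noteq> {}" and C: "C \<in> sets borel"
    and mid: "\<And>a b. a \<in> A \<Longrightarrow> b \<in> B \<Longrightarrow> (a + b) / 2 \<in> C"
  shows "emeasure lborel A + emeasure lborel B \<le> 2 * emeasure lborel C"
proof -
  have lim: "(\<lambda>n. emeasure lborel (X \<inter> {- real n..real n})) \<longlonglongrightarrow> emeasure lborel X"
    if "X \<in> sets borel" for X
  proof -
    have "(\<Union>n. X \<inter> {- real n..real n}) = X"
    proof safe
      fix x assume "x \<in> X"
      moreover obtain n where "\<bar>x\<bar> \<le> real n" using real_arch_simple by blast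
      ultimately show "x \<in> (\<Union>n. X \<inter> {- real n..real n})" by (auto simp: abs_le_iff intro!: exI[of _ n])
    qed
    moreover have "(\<lambda>n. emeasure lborel (X \<inter> {- real n..real n})) \<longlonglongrightarrow> emeasure lborel (\<Union>n. X \<inter> {- real n..real n})"
      using that by (intro Lim_emeasure_incseq) (auto simp: incseq_def)
    ultimately show ?thesis by simp
  qed
  obtain a b where ab: "a \<in> A" "b \<in> B" using A B by auto
  \<comment> \<open>From this index on both truncated sets contain a point, as the bounded case
    requires.\<close>
  obtain N where N: "max \<bar>a\<bar> \<bar>b\<bar> \<le> real N" using real_arch_simple by blast
  show ?thesis
  proof (rule LIMSEQ_le_const2[OF tendsto_add[OF lim[OF A(1)] lim[OF B(1)]]])
    have "emeasure lborel (A \<inter> {- real n..real n}) + emeasure lborel (B \<inter> {- real n..real n})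
        \<le> 2 * emeasure lborel C" if n: "N \<le> n" for n
    proof (rule emeasure_bounded_midpoints)
      show "bounded (A \<inter> {- real n..real n})" "bounded (B \<inter> {- real n..real n})"
        by (auto intro: bounded_subset[OF bounded_closed_interval])
      have "real N \<le> real n" using n by simp
      then show "A \<inter> {- real n..real n} \<noteq> {}" "B \<inter> {- real n..real n} \<noteq> {}"
        using ab N by (auto simp: abs_le_iff intro!: exI[of _ a] exI[of _ b])
    qed (use A B C mid in auto)
    then show "\<exists>N. \<forall>n\<ge>N. emeasure lborel (A \<inter> {- real n..real n}) + emeasure lborel (B \<inter> {- real n..real n})
        \<le> 2 * emeasure lborel C" by blast
  qed
qed

text \<open>Fubini for the region under the graph. Since \<open>f\<close> is at most 1, the levels
  can be confined to the open unit interval, which also excludes negative \<open>s\<close>, where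
  \<open>ennreal s\<close> collapses to 0.\<close>

lemma nn_integral_layer_cake_unit:
  fixes f :: "'a \<Rightarrow> ennreal"
  assumes "sigma_finite_measure M" and [measurable]: "f \<in> borel_measurable M" and le: "\<And>x. f x \<le> 1"
  shows "(\<integral>\<^sup>+x. f x \<partial>M) = (\<integral>\<^sup>+s. indicator {0<..<1::real} s * emeasure M {x\<in>space M. ennreal s < f x} \<partial>lborel)"
proof -
  interpret sigma_finite_measure M by fact
  interpret pair_sigma_finite M lborel ..
  have "f x = (\<integral>\<^sup>+s. indicator {0<..<1::real} s * indicator {s. ennreal s < f x} s \<partial>lborel)" for x
  proof -
    have fin: "f x \<noteq> top" using le[of x] by (auto simp: top_unique)
    have r: "f x = ennreal (enn2real (f x))" using fin by (simp add: top.not_eq_extremum)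
    have r1: "enn2real (f x) \<le> 1" using le[of x] by (metis enn2real_1 enn2real_mono ennreal_one_less_top)
    have "{0<..<1} \<inter> {s. ennreal s < f x} = {0<..<enn2real (f x)}"
      using r1 by (subst r) (auto simp: ennreal_less_iff)
    then have "(\<integral>\<^sup>+s. indicator {0<..<1::real} s * indicator {s. ennreal s < f x} s \<partial>lborel)
      = (\<integral>\<^sup>+s. indicator {0<..<enn2real (f x)} s \<partial>lborel)"
      by (metis (no_types, lifting) indicator_inter_arith)
    also have "\<dots> = f x" using r by simp
    finally show ?thesis by simp
  qed
  then have "(\<integral>\<^sup>+x. f x \<partial>M) = (\<integral>\<^sup>+x. \<integral>\<^sup>+s. indicator {0<..<1::real} s * indicator {s. ennreal s < f x} s \<partial>lborel \<partial>M)"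
    by (intro nn_integral_cong)
  also have "\<dots> = (\<integral>\<^sup>+s. \<integral>\<^sup>+x. indicator {0<..<1::real} s * indicator {s. ennreal s < f x} s \<partial>M \<partial>lborel)"
    by (rule Fubini'[symmetric]) measurable
  also have "\<dots> = (\<integral>\<^sup>+s. indicator {0<..<1::real} s * emeasure M {x\<in>space M. ennreal s < f x} \<partial>lborel)"
  proof (rule nn_integral_cong)
    fix s :: real
    have "(\<integral>\<^sup>+x. indicator {0<..<1::real} s * indicator {s. ennreal s < f x} s \<partial>M)
      = indicator {0<..<1::real} s * (\<integral>\<^sup>+x. indicator {s. ennreal s < f x} s \<partial>M)"
      by (intro nn_integral_cmult) measurable
    also have "(\<integral>\<^sup>+x. indicator {s. ennreal s < f x} s \<partial>M) = (\<integral>\<^sup>+x. indicator {x\<in>space M. ennreal s < f x} x \<partial>M)"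
      by (intro nn_integral_cong) (auto simp: indicator_def)
    also have "\<dots> = emeasure M {x\<in>space M. ennreal s < f x}" by (intro nn_integral_indicator) measurable
    finally show "(\<integral>\<^sup>+x. indicator {0<..<1::real} s * indicator {s. ennreal s < f x} s \<partial>M)
      = indicator {0<..<1::real} s * emeasure M {x\<in>space M. ennreal s < f x}" .
  qed
  finally show ?thesis .
qed

text \<open>Both suprema equal 1, so at every level below 1 both superlevel sets are nonempty and
  \<open>emeasure_midpoints\<close> applies to them. Integrating over the levels bounds the sum of
  the integrals, which is stronger than a bound on their product.\<close>

lemma prekopa_leindler_real_normalized:
  fixes f g h :: "real \<Rightarrow> ennreal"
  assumes [measurable]: "f \<in> borel_measurable borel" "g \<in> borel_measurable borel" "h \<in> borel_measurable borel"
    and f1: "\<And>x. f x \<le> 1" and g1: "\<And>x. g x \<le> 1"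
    and fs: "\<And>s. s < 1 \<Longrightarrow> \<exists>x. s < f x" and gs: "\<And>s. s < 1 \<Longrightarrow> \<exists>x. s < g x"
    and h: "\<And>x y. f x * g y \<le> (h ((x + y) / 2))\<^sup>2"
  shows "(\<integral>\<^sup>+x. f x \<partial>lborel) + (\<integral>\<^sup>+x. g x \<partial>lborel) \<le> 2 * (\<integral>\<^sup>+x. h x \<partial>lborel)"
proof -
  \<comment> \<open>The layer cake formula is stated for functions below 1; levels under 1 do not
    notice the cut.\<close>
  let ?k = "\<lambda>x. min (h x) 1"
  let ?I = "\<lambda>f s. indicator {0<..<1::real} s * emeasure lborel {x\<in>space lborel. ennreal s < f x}"
  have lc: "(\<integral>\<^sup>+x. f x \<partial>lborel) = (\<integral>\<^sup>+s. ?I f s \<partial>lborel)"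
    if "f \<in> borel_measurable borel" "\<And>x. f x \<le> 1" for f :: "real \<Rightarrow> ennreal"
    using that by (intro nn_integral_layer_cake_unit) (auto intro: lborel.sigma_finite_measure_axioms)
  have strict: "ennreal s * ennreal s < x * y" if "0 < s" "ennreal s < x" "ennreal s < y" for s x y
  proof -
    have "ennreal s * ennreal s < ennreal s * y"
      using that by (intro ennreal_mult_strict_left_mono) auto
    also have "\<dots> \<le> x * y" using that by (intro mult_right_mono) auto
    finally show ?thesis .
  qed
  have m: "?I f \<in> borel_measurable lborel" if [measurable]: "f \<in> borel_measurable borel" for f :: "real \<Rightarrow> ennreal"
  proof -
    have "(\<lambda>s. emeasure lborel {x\<in>space lborel. ennreal s < f x}) \<in> borel_measurable lborel"
      by measurable
    then show ?thesis by measurable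
  qed
  have "(\<integral>\<^sup>+x. f x \<partial>lborel) + (\<integral>\<^sup>+x. g x \<partial>lborel) = (\<integral>\<^sup>+s. ?I f s + ?I g s \<partial>lborel)"
    using f1 g1 m by (simp add: lc nn_integral_add)
  also have "\<dots> \<le> (\<integral>\<^sup>+s. 2 * ?I ?k s \<partial>lborel)"
  proof (intro nn_integral_mono)
    fix s :: real
    show "?I f s + ?I g s \<le> 2 * ?I ?k s"
    proof (cases "0 < s \<and> s < 1")
      case True
      have "emeasure lborel {x. ennreal s < f x} + emeasure lborel {x. ennreal s < g x}
        \<le> 2 * emeasure lborel {x. ennreal s < ?k x}"
      proof (rule emeasure_midpoints)
        show "{x. ennreal s < f x} \<noteq> {}" "{x. ennreal s < g x} \<noteq> {}"
          using fs[of "ennreal s"] gs[of "ennreal s"] True by (auto simp: ennreal_less_one_iff)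
        fix a b assume "a \<in> {x. ennreal s < f x}" "b \<in> {x. ennreal s < g x}"
        then have "ennreal s * ennreal s < f a * g b"
          using True by (intro strict) auto
        also have "\<dots> \<le> (h ((a + b) / 2))\<^sup>2" by (rule h)
        finally have "\<not> h ((a + b) / 2) \<le> ennreal s"
          using mult_mono[of "h ((a + b) / 2)" "ennreal s" "h ((a + b) / 2)" "ennreal s"]
          by (auto simp: power2_eq_square)
        then show "(a + b) / 2 \<in> {x. ennreal s < ?k x}" using True by (simp add: ennreal_less_one_iff not_le)
      qed measurable
      then show ?thesis using True by simp
    qed auto
  qed
  also have "\<dots> = 2 * (\<integral>\<^sup>+x. ?k x \<partial>lborel)"
    using m[of ?k] lc[of ?k] by (subst nn_integral_cmult) auto
  also have "\<dots> \<le> 2 * (\<integral>\<^sup>+x. h x \<partial>lborel)"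
    by (intro mult_left_mono nn_integral_mono) auto
  finally show ?thesis .
qed

text \<open>Boundedness makes the suprema finite, so the functions can be normalised. The hypothesis
  is homogeneous: dividing \<open>f\<close> and \<open>g\<close> by \<open>a\<close> and
  \<open>b\<close> divides \<open>h\<close> by the geometric mean \<open>c\<close>. The inequality
  of means then turns the bound on the sum into one on the product.\<close>

lemma prekopa_leindler_real_bounded:
  fixes f g h :: "real \<Rightarrow> ennreal"
  assumes [measurable]: "f \<in> borel_measurable borel" "g \<in> borel_measurable borel" "h \<in> borel_measurable borel"
    and fN: "\<And>x. f x \<le> of_nat N" and gN: "\<And>x. g x \<le> of_nat N"
    and h: "\<And>x y. f x * g y \<le> (h ((x + y) / 2))\<^sup>2"
  shows "(\<integral>\<^sup>+x. f x \<partial>lborel) * (\<integral>\<^sup>+x. g x \<partial>lborel) \<le> (\<integral>\<^sup>+x. h x \<partial>lborel)\<^sup>2"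
proof (cases "(SUP x. f x) = 0 \<or> (SUP x. g x) = 0")
  case True
  then have "(\<forall>x. f x = 0) \<or> (\<forall>x. g x = 0)"
    by (metis SUP_upper UNIV_I le_zero_eq)
  then show ?thesis by auto
next
  case False
  have norm: "\<exists>a>0. (\<forall>x. ennreal (1/a) * u x \<le> 1) \<and> (\<forall>s<1. \<exists>x. s < ennreal (1/a) * u x)"
    if u: "\<And>x. u x \<le> of_nat N" and nz: "(SUP x. u x) \<noteq> 0" for u :: "real \<Rightarrow> ennreal"
  proof -
    have "(SUP x. u x) \<le> of_nat N" by (rule SUP_least) (rule u)
    then have "(SUP x. u x) < top" by (metis ennreal_of_nat_eq_real_of_nat ennreal_less_top le_less_trans)
    then obtain a where a: "(SUP x. u x) = ennreal a" "0 \<le> a" by (cases "SUP x. u x") auto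
    with nz have a0: "0 < a" by (cases "a = 0") auto
    have inv: "ennreal (1/a) * ennreal a = 1" using a0 by (subst ennreal_mult[symmetric]) auto
    show ?thesis
    proof (rule exI[of _ a], intro conjI allI impI)
      fix x
      have "u x \<le> ennreal a" using a(1) by (metis SUP_upper UNIV_I)
      then have "ennreal (1/a) * u x \<le> ennreal (1/a) * ennreal a" by (intro mult_left_mono) auto
      then show "ennreal (1/a) * u x \<le> 1" by (simp only: inv)
    next
      fix s :: ennreal assume "s < 1"
      then have "s * ennreal a < 1 * ennreal a" using a0 by (intro ennreal_mult_strict_right_mono) auto
      then obtain x where "s * ennreal a < u x" using a(1) less_SUP_iff[of "s * ennreal a" u UNIV] by auto
      then have lt: "ennreal (1/a) * (s * ennreal a) < ennreal (1/a) * u x"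
        using a0 by (intro ennreal_mult_strict_left_mono) auto
      moreover have "ennreal (1/a) * (s * ennreal a) = s"
        by (simp only: mult.left_commute[of _ s] inv mult_1_right)
      ultimately show "\<exists>x. s < ennreal (1/a) * u x" by metis
    qed (fact a0)
  qed
  obtain a where a: "0 < a" "\<And>x. ennreal (1/a) * f x \<le> 1" "\<And>s. s < 1 \<Longrightarrow> \<exists>x. s < ennreal (1/a) * f x"
    using norm[of f] fN False by blast
  obtain b where b: "0 < b" "\<And>x. ennreal (1/b) * g x \<le> 1" "\<And>s. s < 1 \<Longrightarrow> \<exists>x. s < ennreal (1/b) * g x"
    using norm[of g] gN False by blast
  define c where "c = sqrt (a * b)"
  have c: "0 < c" "c * c = a * b" using a b by (auto simp: c_def)
  have cc: "ennreal (1/a) * ennreal (1/b) = ennreal (1/c) * ennreal (1/c)"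
    using a b c by (simp flip: ennreal_mult)
  let ?F = "\<integral>\<^sup>+x. f x \<partial>lborel" and ?G = "\<integral>\<^sup>+x. g x \<partial>lborel" and ?H = "\<integral>\<^sup>+x. h x \<partial>lborel"
  have sum: "ennreal (1/a) * ?F + ennreal (1/b) * ?G \<le> 2 * (ennreal (1/c) * ?H)"
  proof -
    have "(\<integral>\<^sup>+x. ennreal (1/a) * f x \<partial>lborel) + (\<integral>\<^sup>+x. ennreal (1/b) * g x \<partial>lborel)
      \<le> 2 * (\<integral>\<^sup>+x. ennreal (1/c) * h x \<partial>lborel)"
    proof (rule prekopa_leindler_real_normalized)
      fix x y
      have "ennreal (1/a) * f x * (ennreal (1/b) * g y) = ennreal (1/c) * ennreal (1/c) * (f x * g y)"
        unfolding cc[symmetric] by (simp only: ac_simps)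
      also have "\<dots> \<le> ennreal (1/c) * ennreal (1/c) * (h ((x + y) / 2))\<^sup>2"
        by (intro mult_left_mono h) auto
      also have "\<dots> = (ennreal (1/c) * h ((x + y) / 2))\<^sup>2"
        by (simp only: power2_eq_square ac_simps)
      finally show "ennreal (1/a) * f x * (ennreal (1/b) * g y) \<le> (ennreal (1/c) * h ((x + y) / 2))\<^sup>2" .
    qed (use a b in auto)
    then show ?thesis by (simp add: nn_integral_cmult)
  qed
  have amgm: "X * Y \<le> W * W" if "X + Y \<le> 2 * W" for X Y W :: ennreal
  proof (cases "W = top")
    case True then show ?thesis by (simp add: ennreal_mult_top)
  next
    case False
    then obtain w where w: "W = ennreal w" "0 \<le> w" by (cases W) auto
    have "2 * W < top" using False by (simp add: ennreal_mult_less_top top.not_eq_extremum)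
    then have "X + Y < top" using that by order
    then obtain x y where xy: "X = ennreal x" "Y = ennreal y" "0 \<le> x" "0 \<le> y"
      by (cases X; cases Y) auto
    have "x + y \<le> 2 * w"
      using that w xy by (simp flip: ennreal_plus ennreal_numeral ennreal_mult)
    then have "(x + y) * (x + y) \<le> (2 * w) * (2 * w)" using w xy by (intro mult_mono) auto
    moreover have "4 * (x * y) \<le> (x + y) * (x + y)"
      using zero_le_power2[of "x - y"] by (simp add: power2_eq_square algebra_simps)
    ultimately have "x * y \<le> w * w" by simp
    then show ?thesis using w xy by (simp flip: ennreal_mult)
  qed
  have inv: "ennreal (c * c) * (ennreal (1/c) * ennreal (1/c)) = 1"
    using c(1) by (simp flip: ennreal_mult)
  have "?F * ?G = ennreal (c * c) * ((ennreal (1/a) * ?F) * (ennreal (1/b) * ?G))"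
  proof -
    have "(ennreal (1/a) * ?F) * (ennreal (1/b) * ?G) = (ennreal (1/c) * ennreal (1/c)) * (?F * ?G)"
      unfolding cc[symmetric] by (simp only: ac_simps)
    then show ?thesis using inv by (simp flip: mult.assoc)
  qed
  also have "\<dots> \<le> ennreal (c * c) * ((ennreal (1/c) * ?H) * (ennreal (1/c) * ?H))"
    by (intro mult_left_mono amgm sum) auto
  also have "\<dots> = (ennreal (c * c) * (ennreal (1/c) * ennreal (1/c))) * (?H * ?H)"
    by (simp only: ac_simps)
  also have "\<dots> = ?H\<^sup>2" using inv by (simp add: power2_eq_square)
  finally show ?thesis .
qed

lemma prekopa_leindler_real:
  fixes f g h :: "real \<Rightarrow> ennreal"
  assumes [measurable]: "f \<in> borel_measurable borel" "g \<in> borel_measurable borel" "h \<in> borel_measurable borel"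
    and h: "\<And>x y. f x * g y \<le> (h ((x + y) / 2))\<^sup>2"
  shows "(\<integral>\<^sup>+x. f x \<partial>lborel) * (\<integral>\<^sup>+x. g x \<partial>lborel) \<le> (\<integral>\<^sup>+x. h x \<partial>lborel)\<^sup>2"
proof -
  have trunc: "(\<integral>\<^sup>+x. u x \<partial>lborel) = (SUP N. \<integral>\<^sup>+x. min (u x) (of_nat N) \<partial>lborel)"
    if [measurable]: "u \<in> borel_measurable borel" for u :: "real \<Rightarrow> ennreal"
  proof -
    have "(\<integral>\<^sup>+x. u x \<partial>lborel) = (\<integral>\<^sup>+x. (SUP N. min (u x) (of_nat N)) \<partial>lborel)"
    proof (rule nn_integral_cong)
      fix x
      have "(SUP N. min (u x) (of_nat N)) = inf (u x) (SUP N. of_nat N)"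
        unfolding inf_min[symmetric] by (rule inf_SUP[symmetric])
      then show "u x = (SUP N. min (u x) (of_nat N))" by (simp add: ennreal_SUP_of_nat_eq_top)
    qed
    also have "\<dots> = (SUP N. \<integral>\<^sup>+x. min (u x) (of_nat N) \<partial>lborel)"
      by (rule nn_integral_monotone_convergence_SUP)
         (auto simp: incseq_def le_fun_def intro: min.coboundedI2)
    finally show ?thesis .
  qed
  \<comment> \<open>The two truncation levels are independent, because the product of the two
    suprema is resolved one factor at a time.\<close>
  have le: "(\<integral>\<^sup>+x. min (f x) (of_nat M) \<partial>lborel) * (\<integral>\<^sup>+x. min (g x) (of_nat N) \<partial>lborel) \<le> (\<integral>\<^sup>+x. h x \<partial>lborel)\<^sup>2"
    for M N :: nat
  proof (rule prekopa_leindler_real_bounded[where N="max M N"])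
    show "min (f x) (of_nat M) \<le> of_nat (max M N)" for x by (simp add: min.coboundedI2)
    show "min (g x) (of_nat N) \<le> of_nat (max M N)" for x by (simp add: min.coboundedI2)
    show "min (f x) (of_nat M) * min (g y) (of_nat N) \<le> (h ((x + y) / 2))\<^sup>2" for x y
      by (rule order_trans[OF mult_mono h]) auto
  qed auto
  show ?thesis
    by (subst (1 2) trunc)
       (auto simp: SUP_mult_left_ennreal SUP_mult_right_ennreal intro!: SUP_least le)
qed

text \<open>Induction on the set of coordinates: with the other coordinates fixed, the inequality on
  the line says that the partial integrals satisfy the midpoint hypothesis again. Only extensional
  functions are points of the product space, which is why points and midpoints are restricted to
  \<open>I\<close>.\<close>

lemma prekopa_leindler_PiM:
  fixes f g h :: "('i \<Rightarrow> real) \<Rightarrow> ennreal"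
  assumes "finite I"
    and "f \<in> borel_measurable (PiM I (\<lambda>_. lborel))" "g \<in> borel_measurable (PiM I (\<lambda>_. lborel))"
      "h \<in> borel_measurable (PiM I (\<lambda>_. lborel))"
    and "\<And>x y. x \<in> extensional I \<Longrightarrow> y \<in> extensional I \<Longrightarrow> f x * g y \<le> (h (\<lambda>i\<in>I. (x i + y i) / 2))\<^sup>2"
  shows "(\<integral>\<^sup>+x. f x \<partial>PiM I (\<lambda>_. lborel)) * (\<integral>\<^sup>+x. g x \<partial>PiM I (\<lambda>_. lborel))
    \<le> (\<integral>\<^sup>+x. h x \<partial>PiM I (\<lambda>_. lborel))\<^sup>2"
  using assms
proof (induction I arbitrary: f g h rule: finite_induct)
  case empty
  then show ?case by (simp add: PiM_empty nn_integral_count_space_finite restrict_def)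
next
  case (insert i I)
  interpret product_sigma_finite "\<lambda>_::'i. lborel :: real measure" ..
  note [measurable] = insert.prems(1-3)
  have upd: "(\<lambda>y. u (x(i := y))) \<in> borel_measurable borel"
    if "u \<in> borel_measurable (PiM (insert i I) (\<lambda>_. lborel))" "x \<in> extensional I" for u :: "('i \<Rightarrow> real) \<Rightarrow> ennreal" and x
  proof -
    have "x \<in> space (PiM I (\<lambda>_. lborel))" using that by (auto simp: space_PiM PiE_def)
    then have "(\<lambda>y. x(i := y)) \<in> measurable lborel (PiM (insert i I) (\<lambda>_. lborel))"
      by (intro measurable_fun_upd[where J=I]) auto
    from measurable_compose[OF this that(1)] show ?thesis by simp
  qed
  show ?case
  proof (simp only: product_nn_integral_insert[OF insert.hyps insert.prems(1)]
      product_nn_integral_insert[OF insert.hyps insert.prems(2)]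
      product_nn_integral_insert[OF insert.hyps insert.prems(3)], rule insert.IH)
    fix x y :: "'i \<Rightarrow> real" assume xy: "x \<in> extensional I" "y \<in> extensional I"
    let ?m = "\<lambda>i\<in>I. (x i + y i) / 2"
    show "(\<integral>\<^sup>+a. f (x(i := a)) \<partial>lborel) * (\<integral>\<^sup>+a. g (y(i := a)) \<partial>lborel)
        \<le> (\<integral>\<^sup>+a. h (?m(i := a)) \<partial>lborel)\<^sup>2"
    proof (rule prekopa_leindler_real)
      fix a b
      have "f (x(i := a)) * g (y(i := b)) \<le> (h (\<lambda>k\<in>insert i I. ((x(i := a)) k + (y(i := b)) k) / 2))\<^sup>2"
        using xy by (intro insert.prems(4)) (auto simp: extensional_def)
      also have "(\<lambda>k\<in>insert i I. ((x(i := a)) k + (y(i := b)) k) / 2) = ?m(i := (a + b) / 2)"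
        using insert.hyps(2) by (auto simp: fun_eq_iff)
      finally show "f (x(i := a)) * g (y(i := b)) \<le> (h (?m(i := (a + b) / 2)))\<^sup>2" .
    qed (use xy in \<open>auto intro!: upd insert.prems\<close>)
  qed measurable
qed

theorem prekopa_leindler:
  fixes f g h :: "'a::euclidean_space \<Rightarrow> ennreal"
  assumes [measurable]: "f \<in> borel_measurable borel" "g \<in> borel_measurable borel" "h \<in> borel_measurable borel"
    and h: "\<And>x y. f x * g y \<le> (h ((1/2) *\<^sub>R (x + y)))\<^sup>2"
  shows "(\<integral>\<^sup>+x. f x \<partial>lborel) * (\<integral>\<^sup>+x. g x \<partial>lborel) \<le> (\<integral>\<^sup>+x. h x \<partial>lborel)\<^sup>2"
proof -
  let ?P = "PiM (Basis :: 'a set) (\<lambda>_. lborel :: real measure)"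
  let ?s = "\<lambda>x::'a \<Rightarrow> real. \<Sum>b\<in>Basis. x b *\<^sub>R b"
  have s[measurable]: "?s \<in> measurable ?P borel" by measurable
  have eq: "(\<integral>\<^sup>+x. u x \<partial>lborel) = (\<integral>\<^sup>+x. u (?s x) \<partial>?P)" if "u \<in> borel_measurable borel" for u :: "'a \<Rightarrow> ennreal"
    using that s by (simp add: lborel_eq[where 'a='a] nn_integral_distr)
  have "(\<integral>\<^sup>+x. f (?s x) \<partial>?P) * (\<integral>\<^sup>+x. g (?s x) \<partial>?P) \<le> (\<integral>\<^sup>+x. h (?s x) \<partial>?P)\<^sup>2"
  proof (rule prekopa_leindler_PiM)
    fix x y :: "'a \<Rightarrow> real"
    have "?s (\<lambda>i\<in>Basis. (x i + y i) / 2) = (1/2) *\<^sub>R (?s x + ?s y)"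
      by (simp add: scaleR_sum_right sum.distrib[symmetric] scaleR_add_left[symmetric] add_divide_distrib)
    then show "f (?s x) * g (?s y) \<le> (h (?s (\<lambda>i\<in>Basis. (x i + y i) / 2)))\<^sup>2"
      using h by simp
  qed auto
  then show ?thesis by (simp only: eq assms)
qed

section \<open>The Poincare inequality for semiconvex functions\<close>

text \<open>The Taylor remainder of order four is nonnegative for either sign of \<open>x\<close>;
  stopping after the quadratic term would give a bound that fails for negative
  \<open>x\<close>.\<close>

lemma exp_lower_cubic: "1 + x + x\<^sup>2 / 2 + x ^ 3 / 6 \<le> exp (x::real)"
proof -
  obtain t where "exp x = (\<Sum>m<4. x ^ m / fact m) + exp t / fact 4 * x ^ 4"
    using Maclaurin_exp_le[of x 4] by auto
  moreover have "(\<Sum>m<4. x ^ m / fact m) = 1 + x + x\<^sup>2 / 2 + x ^ 3 / 6"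
    by (simp add: eval_nat_numeral fact_numeral)
  ultimately show ?thesis by simp
qed

lemma integrable_mult_gaussian_weight:
  fixes C :: "'a::euclidean_space set"
  assumes C: "bounded C" "C \<in> sets borel" and \<kappa>: "0 < \<kappa>"
    and [measurable]: "f \<in> borel_measurable borel" and K: "\<And>x. x \<in> C \<Longrightarrow> \<bar>f x\<bar> \<le> (K::real)"
  shows "integrable lborel (\<lambda>x. f x * (indicator C x * exp (- (\<kappa> * (norm (x - p))\<^sup>2))))"
proof (rule Bochner_Integration.integrable_bound)
  have "integrable lborel (indicator C :: 'a \<Rightarrow> real)"
    using emeasure_bounded_finite[OF C(1)] C(2) by (intro integrable_real_indicator) auto
  then show "integrable lborel (\<lambda>x. \<bar>K\<bar> * indicator C x :: real)" by simp
  show "AE x in lborel. norm (f x * (indicator C x * exp (- (\<kappa> * (norm (x - p))\<^sup>2)))) \<le> norm (\<bar>K\<bar> * indicator C x)"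
  proof (intro AE_I2)
    fix x
    have "\<bar>f x\<bar> * exp (- (\<kappa> * (norm (x - p))\<^sup>2)) \<le> \<bar>K\<bar> * 1" if "x \<in> C"
      using K[OF that] \<kappa> by (intro mult_mono) auto
    then show "norm (f x * (indicator C x * exp (- (\<kappa> * (norm (x - p))\<^sup>2)))) \<le> norm (\<bar>K\<bar> * indicator C x)"
      by (auto simp: abs_mult indicator_def)
  qed
qed (use C in measurable)

text \<open>
  The infimal convolution of \<open>\<epsilon> u\<close> with \<open>\<kappa> |x|\<^sup>2 / 2\<close> is bounded below by
  \<open>\<epsilon> u - \<epsilon>\<^sup>2 \<theta> |g|\<^sup>2\<close>, which gives the hypothesis of Prekopa-Leindler. Of \<open>g = \<nabla>u\<close> only a
  one-sided second order Taylor bound is used.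
\<close>

lemma poincare_semiconvex_aux:
  fixes C :: "'a::euclidean_space set" and u :: "'a \<Rightarrow> real" and g :: "'a \<Rightarrow> 'a"
  defines "w \<equiv> \<lambda>p \<kappa> x. indicator C x * exp (- (\<kappa> * (norm (x - p))\<^sup>2))"
  assumes C: "convex C" "bounded C" and [measurable]: "C \<in> sets borel"
    and [measurable]: "u \<in> borel_measurable borel" "g \<in> borel_measurable borel"
    and A: "\<And>x. x \<in> C \<Longrightarrow> \<bar>u x\<bar> \<le> A" "\<And>x. x \<in> C \<Longrightarrow> norm (g x) \<le> A"
    and semi: "\<And>x y. x \<in> C \<Longrightarrow> y \<in> C \<Longrightarrow> u x + g x \<bullet> (y - x) - M * (norm (y - x))\<^sup>2 \<le> u y"
    and \<kappa>: "0 < \<kappa>" and \<epsilon>: "0 < \<epsilon>" and \<theta>: "1 \<le> 4 * \<theta> * (\<kappa> / 2 - \<epsilon> * M)" "0 < \<theta>"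
  shows "(LINT x|lborel. exp (\<epsilon> * u x - \<epsilon>\<^sup>2 * \<theta> * (norm (g x))\<^sup>2) * w p \<kappa> x) * (LINT x|lborel. exp (- (\<epsilon> * u x)) * w p \<kappa> x)
     \<le> (LINT x|lborel. w p \<kappa> x)\<^sup>2"
proof -
  have wm[measurable]: "w p \<kappa> \<in> borel_measurable borel" unfolding w_def by measurable
  have w0: "0 \<le> w p \<kappa> x" for x by (simp add: w_def)
  have int: "integrable lborel (\<lambda>x. f x * w p \<kappa> x)"
    if "f \<in> borel_measurable borel" "\<And>x. x \<in> C \<Longrightarrow> \<bar>f x\<bar> \<le> K" for f K
    unfolding w_def using that \<kappa> C by (intro integrable_mult_gaussian_weight[of C]) auto
  let ?q = "\<lambda>x. \<epsilon> * u x - \<epsilon>\<^sup>2 * \<theta> * (norm (g x))\<^sup>2"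
  have "(\<integral>\<^sup>+x. ennreal (exp (?q x) * w p \<kappa> x) \<partial>lborel) * (\<integral>\<^sup>+x. ennreal (exp (- (\<epsilon> * u x)) * w p \<kappa> x) \<partial>lborel)
    \<le> (\<integral>\<^sup>+x. ennreal (w p \<kappa> x) \<partial>lborel)\<^sup>2"
  proof (rule prekopa_leindler)
    fix x y :: 'a
    let ?m = "(1/2) *\<^sub>R (x + y)"
    have "exp (?q x) * w p \<kappa> x * (exp (- (\<epsilon> * u y)) * w p \<kappa> y) \<le> (w p \<kappa> ?m)\<^sup>2"
    proof (cases "x \<in> C \<and> y \<in> C")
      case True
      then have m: "?m \<in> C"
        using convexD[OF C(1), of x y "1/2" "1/2"] by (simp add: scaleR_add_right)
      \<comment> \<open>The hypothesis on \<theta> reads \<open>1 \<le> 4 * \<theta> * s\<close>,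
        which makes the quadratic form \<open>\<theta> * e\<^sup>2 - e * t + s * t\<^sup>2\<close>
        nonnegative by completing the square. The term \<open>\<epsilon> * M\<close> in
        \<open>s\<close> pays for the quadratic error of the Taylor bound.\<close>
      define e t s where "e = \<epsilon> * norm (g x)" and "t = norm (y - x)" and "s = \<kappa> / 2 - \<epsilon> * M"
      have "0 \<le> (2 * \<theta> * e - t)\<^sup>2 + (4 * \<theta> * s - 1) * t\<^sup>2" using \<theta> by (auto simp: s_def)
      also have "\<dots> = 4 * \<theta> * (\<theta> * e\<^sup>2 - e * t + s * t\<^sup>2)" by (simp add: power2_eq_square algebra_simps)
      finally have 1: "0 \<le> \<theta> * e\<^sup>2 - e * t + s * t\<^sup>2" using \<theta>(2) by (simp add: zero_le_mult_iff)
      have "- (g x \<bullet> (y - x)) \<le> norm (g x) * t"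
        unfolding t_def using Cauchy_Schwarz_ineq2[of "g x" "y - x"] by linarith
      then have "\<epsilon> * - (g x \<bullet> (y - x)) \<le> \<epsilon> * (norm (g x) * t)" using \<epsilon> by (intro mult_left_mono) auto
      then have 2: "- (\<epsilon> * (g x \<bullet> (y - x))) \<le> e * t" by (simp add: e_def)
      have "\<epsilon> * (u x + g x \<bullet> (y - x) - M * t\<^sup>2) \<le> \<epsilon> * u y"
        using semi True \<epsilon> unfolding t_def by (intro mult_left_mono) auto
      then have 3: "?q x - \<epsilon> * u y \<le> \<kappa> / 2 * t\<^sup>2"
        using 1 2 by (simp add: e_def s_def power_mult_distrib algebra_simps)
      \<comment> \<open>Parallelogram identity: the exponent at the midpoint gains
        \<open>\<kappa> / 2 * t\<^sup>2\<close> over the exponents at the end points together,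
        exactly the amount spent in fact \<open>3\<close>.\<close>
      have 4: "(norm (x - p))\<^sup>2 + (norm (y - p))\<^sup>2 - 2 * (norm (?m - p))\<^sup>2 = t\<^sup>2 / 2"
      proof -
        have "?m - p = (1/2) *\<^sub>R ((x - p) + (y - p))"
          by (simp add: algebra_simps flip: scaleR_add_left)
        moreover have "y - x = (y - p) - (x - p)" by simp
        ultimately show ?thesis unfolding t_def
          by (simp only: power2_norm_eq_inner inner_add_left inner_add_right inner_diff_left inner_diff_right inner_commute[of "y - p" "x - p"]
            inner_scaleR_left inner_scaleR_right) (simp add: algebra_simps inner_commute)
      qed
      have "?q x + - (\<kappa> * (norm (x - p))\<^sup>2) + (- (\<epsilon> * u y) + - (\<kappa> * (norm (y - p))\<^sup>2))
         \<le> \<kappa> * (t\<^sup>2 / 2) - \<kappa> * ((norm (x - p))\<^sup>2 + (norm (y - p))\<^sup>2)"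
        using 3 by (simp add: algebra_simps)
      also have "\<dots> = 2 * - (\<kappa> * (norm (?m - p))\<^sup>2)"
        unfolding 4[symmetric] by (simp add: algebra_simps)
      finally have "exp (?q x + - (\<kappa> * (norm (x - p))\<^sup>2) + (- (\<epsilon> * u y) + - (\<kappa> * (norm (y - p))\<^sup>2)))
        \<le> exp (2 * - (\<kappa> * (norm (?m - p))\<^sup>2))" by simp
      then have "(exp (?q x) * exp (- (\<kappa> * (norm (x - p))\<^sup>2))) * (exp (- (\<epsilon> * u y)) * exp (- (\<kappa> * (norm (y - p))\<^sup>2)))
        \<le> exp (- (\<kappa> * (norm (?m - p))\<^sup>2)) ^ 2"
        by (simp only: exp_add[symmetric] exp_double[symmetric])
      then show ?thesis using True m by (simp only: w_def indicator_simps mult_1_left)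
    qed (auto simp: w_def)
    then show "ennreal (exp (?q x) * w p \<kappa> x) * ennreal (exp (- (\<epsilon> * u y)) * w p \<kappa> y) \<le> (ennreal (w p \<kappa> ?m))\<^sup>2"
      using w0 by (simp add: ennreal_mult[symmetric] ennreal_power)
  qed measurable
  moreover have "integrable lborel (w p \<kappa>)"
    using int[of "\<lambda>_. 1" 1] by simp
  moreover have "integrable lborel (\<lambda>x. exp (- (\<epsilon> * u x)) * w p \<kappa> x)"
  proof (rule int[of _ "exp (\<epsilon> * A)"])
    fix x assume "x \<in> C"
    then have "\<epsilon> * - u x \<le> \<epsilon> * A" using A(1)[of x] \<epsilon> by (intro mult_left_mono) auto
    then show "\<bar>exp (- (\<epsilon> * u x))\<bar> \<le> exp (\<epsilon> * A)" by simp
  qed measurable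
  moreover have "integrable lborel (\<lambda>x. exp (?q x) * w p \<kappa> x)"
  proof (rule int[of _ "exp (\<epsilon> * A)"])
    fix x assume "x \<in> C"
    then have "\<epsilon> * u x \<le> \<epsilon> * A" using A(1)[of x] \<epsilon> by (intro mult_left_mono) auto
    moreover have "0 \<le> \<epsilon>\<^sup>2 * \<theta> * (norm (g x))\<^sup>2" using \<theta> by auto
    ultimately have "?q x \<le> \<epsilon> * A" by linarith
    then show "\<bar>exp (?q x)\<bar> \<le> exp (\<epsilon> * A)" by simp
  qed measurable
  moreover have "0 \<le> (LINT x|lborel. w p \<kappa> x)" "0 \<le> (LINT x|lborel. exp (- (\<epsilon> * u x)) * w p \<kappa> x)"
    "0 \<le> (LINT x|lborel. exp (?q x) * w p \<kappa> x)"
    using w0 by (auto intro!: integral_nonneg_AE)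
  ultimately show ?thesis
    using w0 by (simp add: nn_integral_eq_integral ennreal_mult[symmetric] ennreal_power)
qed

text \<open>In the product of the two expansions the constant terms give \<open>Z\<^sup>2\<close>,
  the linear terms cancel, and the claim is the sign of the quadratic coefficient. Lower bounds with
  a cubic error suffice, so nothing has to be differentiated under the integral.\<close>

lemma nonpos_of_perturbation:
  fixes Z m S E :: real
  assumes Z: "0 < Z"
    and le: "\<And>\<epsilon>. 0 < \<epsilon> \<Longrightarrow> \<epsilon> < \<epsilon>0 \<Longrightarrow> X \<epsilon> * Y \<epsilon> \<le> Z\<^sup>2" and e0: "0 < \<epsilon>0"
    and X: "\<And>\<epsilon>. 0 < \<epsilon> \<Longrightarrow> \<epsilon> < \<epsilon>0 \<Longrightarrow> Z + \<epsilon> * m + \<epsilon>\<^sup>2 * a - \<epsilon> ^ 3 * c \<le> X \<epsilon>"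
    and Y: "\<And>\<epsilon>. 0 < \<epsilon> \<Longrightarrow> \<epsilon> < \<epsilon>0 \<Longrightarrow> Z - \<epsilon> * m + \<epsilon>\<^sup>2 * b - \<epsilon> ^ 3 * d \<le> Y \<epsilon>"
  shows "Z * (a + b) - m\<^sup>2 \<le> 0"
proof -
  let ?x = "\<lambda>\<epsilon>. Z + \<epsilon> * m + \<epsilon>\<^sup>2 * a - \<epsilon> ^ 3 * c"
  let ?y = "\<lambda>\<epsilon>. Z - \<epsilon> * m + \<epsilon>\<^sup>2 * b - \<epsilon> ^ 3 * d"
  \<comment> \<open>The difference of \<open>?x * ?y\<close> and \<open>Z\<^sup>2\<close>, divided
    by \<open>\<epsilon>\<^sup>2\<close>.\<close>
  let ?r = "\<lambda>\<epsilon>. Z * (a + b) - m\<^sup>2 + \<epsilon> * (m * b - m * a - Z * d - Z * c) + \<epsilon>\<^sup>2 * (a * b - m * d + m * c)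
    + \<epsilon> ^ 3 * (- a * d - c * b) + \<epsilon> ^ 4 * (c * d)"
  have lim: "(?x \<longlongrightarrow> Z + 0 * m + 0\<^sup>2 * a - 0 ^ 3 * c) (at_right 0)" "(?y \<longlongrightarrow> Z - 0 * m + 0\<^sup>2 * b - 0 ^ 3 * d) (at_right 0)"
    by (intro tendsto_intros)+
  have "(?r \<longlongrightarrow> Z * (a + b) - m\<^sup>2 + 0 * (m * b - m * a - Z * d - Z * c) + 0\<^sup>2 * (a * b - m * d + m * c)
    + 0 ^ 3 * (- a * d - c * b) + 0 ^ 4 * (c * d)) (at_right 0)"
    by (intro tendsto_intros)
  then have "(?r \<longlongrightarrow> Z * (a + b) - m\<^sup>2) (at_right 0)" by simp
  moreover have "\<forall>\<^sub>F \<epsilon> in at_right 0. ?r \<epsilon> \<le> 0"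
  proof -
    have "\<forall>\<^sub>F \<epsilon> in at_right 0. 0 < ?x \<epsilon>" "\<forall>\<^sub>F \<epsilon> in at_right 0. 0 < ?y \<epsilon>"
      using order_tendstoD(1)[OF lim(1), of 0] order_tendstoD(1)[OF lim(2), of 0] Z by simp_all
    moreover have "\<forall>\<^sub>F \<epsilon> in at_right 0. 0 < \<epsilon> \<and> \<epsilon> < \<epsilon>0"
      using e0 by (auto simp: eventually_at_right_field intro: exI[of _ \<epsilon>0])
    ultimately show ?thesis
    proof eventually_elim
      case (elim \<epsilon>)
      have "?x \<epsilon> \<le> X \<epsilon>" "?y \<epsilon> \<le> Y \<epsilon>" using X Y elim by blast+
      moreover from this have "0 \<le> X \<epsilon>" using elim by linarith
      ultimately have "?x \<epsilon> * ?y \<epsilon> \<le> X \<epsilon> * Y \<epsilon>" using elim by (intro mult_mono) auto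
      also have "\<dots> \<le> Z\<^sup>2" using le elim by blast
      finally have "?x \<epsilon> * ?y \<epsilon> - Z\<^sup>2 \<le> 0" by simp
      also have "?x \<epsilon> * ?y \<epsilon> - Z\<^sup>2 = \<epsilon>\<^sup>2 * ?r \<epsilon>"
        by (simp add: algebra_simps eval_nat_numeral)
      finally show ?case using elim by (simp add: mult_le_0_iff)
    qed
  qed
  ultimately show ?thesis
    by (intro tendsto_upperbound[where F="at_right 0"]) auto
qed

lemma exp_ge_of_square_cube_bounds:
  fixes q X Y :: real
  assumes "X \<le> q\<^sup>2" "- Y \<le> q ^ 3"
  shows "1 + q + X / 2 - Y / 6 \<le> exp q"
  using exp_lower_cubic[of q] assms by linarith

text \<open>Second order expansion in \<epsilon> gives the inequality with factor \<theta> in place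
  of \<open>1 / (2 * \<kappa>)\<close>, for every larger \<theta>; then \<theta> decreases to that
  value. \<open>M\<close> only limits the size of \<epsilon> and is absent from the conclusion, so
  the lemma can be applied to mollifications whose semiconvexity constants depend on the
  scale.\<close>

lemma poincare_semiconvex:
  fixes C :: "'a::euclidean_space set" and u :: "'a \<Rightarrow> real" and g :: "'a \<Rightarrow> 'a"
  defines "w \<equiv> \<lambda>p \<kappa> x. indicator C x * exp (- (\<kappa> * (norm (x - p))\<^sup>2))"
  assumes C: "convex C" "bounded C" and [measurable]: "C \<in> sets borel"
    and [measurable]: "u \<in> borel_measurable borel" "g \<in> borel_measurable borel"
    and A: "\<And>x. x \<in> C \<Longrightarrow> \<bar>u x\<bar> \<le> A" "\<And>x. x \<in> C \<Longrightarrow> norm (g x) \<le> A"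
    and semi: "\<And>x y. x \<in> C \<Longrightarrow> y \<in> C \<Longrightarrow> u x + g x \<bullet> (y - x) - M * (norm (y - x))\<^sup>2 \<le> u y"
    and \<kappa>: "0 < \<kappa>" and Z: "0 < (LINT x|lborel. w p \<kappa> x)"
  shows "2 * \<kappa> * ((LINT x|lborel. w p \<kappa> x) * (LINT x|lborel. (u x)\<^sup>2 * w p \<kappa> x) - (LINT x|lborel. u x * w p \<kappa> x)\<^sup>2)
     \<le> (LINT x|lborel. w p \<kappa> x) * (LINT x|lborel. (norm (g x))\<^sup>2 * w p \<kappa> x)"
proof -
  have wm[measurable]: "w p \<kappa> \<in> borel_measurable borel" unfolding w_def by measurable
  have w0: "0 \<le> w p \<kappa> x" for x by (simp add: w_def)
  have int: "integrable lborel (\<lambda>x. f x * w p \<kappa> x)"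
    if "f \<in> borel_measurable borel" "\<And>x. x \<in> C \<Longrightarrow> \<bar>f x\<bar> \<le> K" for f K
    unfolding w_def using that \<kappa> C by (intro integrable_mult_gaussian_weight[of C]) auto
  obtain p0 where "p0 \<in> C"
  proof (cases "C = {}")
    case True then show ?thesis using Z by (simp add: w_def)
  qed (use that in auto)
  with A have A0: "0 \<le> A" by force
  let ?Z = "LINT x|lborel. w p \<kappa> x" and ?m = "LINT x|lborel. u x * w p \<kappa> x"
  let ?S = "LINT x|lborel. (u x)\<^sup>2 * w p \<kappa> x" and ?E = "LINT x|lborel. (norm (g x))\<^sup>2 * w p \<kappa> x"
  have ints: "integrable lborel (w p \<kappa>)" "integrable lborel (\<lambda>x. u x * w p \<kappa> x)"
    "integrable lborel (\<lambda>x. (u x)\<^sup>2 * w p \<kappa> x)" "integrable lborel (\<lambda>x. (norm (g x))\<^sup>2 * w p \<kappa> x)"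
    using int[of "\<lambda>_. 1" 1] int[of u A] int[of "\<lambda>x. (u x)\<^sup>2" "A\<^sup>2"] int[of "\<lambda>x. (norm (g x))\<^sup>2" "A\<^sup>2"] A A0
    by (auto intro!: power_mono simp: abs_le_square_iff[symmetric])
  have *: "?Z * ((?S / 2 - \<theta> * ?E) + ?S / 2) - ?m\<^sup>2 \<le> 0" if \<theta>: "1 / (2 * \<kappa>) < \<theta>" for \<theta>
  proof -
    have \<theta>0: "0 < \<theta>" using \<theta> \<kappa> by (meson divide_pos_pos less_trans mult_pos_pos zero_less_numeral zero_less_one)
    define M1 where "M1 = max M 1"
    have M1: "M \<le> M1" "0 < M1" by (auto simp: M1_def)
    \<comment> \<open>Below this value \<open>4 * \<theta> * (\<epsilon> * M)\<close> is at most
      \<open>2 * \<theta> * \<kappa> - 1\<close>, which is the condition on \<theta> in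
      \<open>poincare_semiconvex_aux\<close>. \<open>M1\<close> replaces \<open>M\<close> so that
      the divisor is positive.\<close>
    define \<epsilon>0 where "\<epsilon>0 = min 1 ((2 * \<theta> * \<kappa> - 1) / (4 * \<theta> * M1))"
    have "1 < 2 * \<theta> * \<kappa>" using \<theta> \<kappa> by (simp add: field_simps)
    then have e0: "0 < \<epsilon>0" using M1 \<theta>0 by (auto simp: \<epsilon>0_def)
    \<comment> \<open>For \<epsilon> at most 1, \<open>- B\<close> bounds the exponent divided by
      \<epsilon> from below. In \<open>c\<close>, the term \<open>\<theta> * A ^ 3\<close> stems
      from the cross term of the squared exponent and \<open>B ^ 3 / 6\<close> from its
      cube.\<close>
    define B where "B = A + \<theta> * A\<^sup>2"
    define c where "c = (\<theta> * A ^ 3 + B ^ 3 / 6) * ?Z"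
    define d where "d = (A ^ 3 / 6) * ?Z"
    let ?X = "\<lambda>\<epsilon>. LINT x|lborel. exp (\<epsilon> * u x - \<epsilon>\<^sup>2 * \<theta> * (norm (g x))\<^sup>2) * w p \<kappa> x"
    let ?Y = "\<lambda>\<epsilon>. LINT x|lborel. exp (- (\<epsilon> * u x)) * w p \<kappa> x"
    have sm: "4 * \<theta> * (\<epsilon> * M) \<le> 2 * \<theta> * \<kappa> - 1" if "0 < \<epsilon>" "\<epsilon> < \<epsilon>0" for \<epsilon>
    proof -
      have "\<epsilon> * M \<le> \<epsilon> * M1" using that M1 by (intro mult_left_mono) auto
      from mult_left_mono[OF this, of "4 * \<theta>"]
      have "4 * \<theta> * (\<epsilon> * M) \<le> 4 * \<theta> * (\<epsilon> * M1)" using \<theta>0 by simp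
      also have "\<dots> = \<epsilon> * (4 * \<theta> * M1)" by simp
      also have "\<dots> \<le> ((2 * \<theta> * \<kappa> - 1) / (4 * \<theta> * M1)) * (4 * \<theta> * M1)"
        using that M1 \<theta>0 by (intro mult_right_mono) (auto simp: \<epsilon>0_def)
      also have "\<dots> = 2 * \<theta> * \<kappa> - 1" using M1 \<theta>0 by simp
      finally show ?thesis .
    qed
    show ?thesis
    proof (rule nonpos_of_perturbation[where X="?X" and Y="?Y" and c=c and d=d, OF Z _ e0])
      fix \<epsilon> assume \<epsilon>: "0 < \<epsilon>" "\<epsilon> < \<epsilon>0"
      have \<epsilon>1: "\<epsilon> \<le> 1" using \<epsilon> by (simp add: \<epsilon>0_def)
      show "?X \<epsilon> * ?Y \<epsilon> \<le> ?Z\<^sup>2"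
        unfolding w_def
        by (rule poincare_semiconvex_aux[OF C _ _ _ A semi \<kappa>])
           (use \<epsilon> \<theta>0 sm[OF \<epsilon>] in \<open>auto simp: algebra_simps\<close>)
      have "?Z - \<epsilon> * ?m + \<epsilon>\<^sup>2 * (?S / 2) - \<epsilon> ^ 3 * d
        = (LINT x|lborel. w p \<kappa> x - \<epsilon> * (u x * w p \<kappa> x) + \<epsilon>\<^sup>2 / 2 * ((u x)\<^sup>2 * w p \<kappa> x) - \<epsilon> ^ 3 * A ^ 3 / 6 * w p \<kappa> x)"
        using ints by (simp add: d_def)
      also have "\<dots> \<le> ?Y \<epsilon>"
      proof (rule integral_mono)
        fix x
        show "w p \<kappa> x - \<epsilon> * (u x * w p \<kappa> x) + \<epsilon>\<^sup>2 / 2 * ((u x)\<^sup>2 * w p \<kappa> x) - \<epsilon> ^ 3 * A ^ 3 / 6 * w p \<kappa> x \<le> exp (- (\<epsilon> * u x)) * w p \<kappa> x"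
        proof (cases "x \<in> C")
          case True
          have "(\<epsilon> * u x) ^ 3 \<le> (\<epsilon> * A) ^ 3"
            using A(1)[OF True] \<epsilon> by (intro power_mono_odd mult_left_mono) auto
          then have "1 - \<epsilon> * u x + \<epsilon>\<^sup>2 / 2 * (u x)\<^sup>2 - \<epsilon> ^ 3 * A ^ 3 / 6 \<le> exp (- (\<epsilon> * u x))"
            using exp_lower_cubic[of "- (\<epsilon> * u x)"] by (simp add: power_mult_distrib)
          from mult_right_mono[OF this w0[of x]] show ?thesis by (simp add: algebra_simps)
        qed (simp add: w_def)
      next
        show "integrable lborel (\<lambda>x. exp (- (\<epsilon> * u x)) * w p \<kappa> x)"
        proof (rule int[of _ "exp (\<epsilon> * A)"])
          fix x assume "x \<in> C"
          then have "\<epsilon> * - u x \<le> \<epsilon> * A" using A(1)[of x] \<epsilon> by (intro mult_left_mono) auto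
          then show "\<bar>exp (- (\<epsilon> * u x))\<bar> \<le> exp (\<epsilon> * A)" by simp
        qed measurable
      qed (use ints in auto)
      finally show "?Z - \<epsilon> * ?m + \<epsilon>\<^sup>2 * (?S / 2) - \<epsilon> ^ 3 * d \<le> ?Y \<epsilon>" .
      have "?Z + \<epsilon> * ?m + \<epsilon>\<^sup>2 * (?S / 2 - \<theta> * ?E) - \<epsilon> ^ 3 * c
        = ?Z + \<epsilon> * ?m + (\<epsilon>\<^sup>2 / 2 * ?S - \<epsilon>\<^sup>2 * \<theta> * ?E) - \<epsilon> ^ 3 * (\<theta> * A ^ 3 + B ^ 3 / 6) * ?Z"
        by (simp add: c_def algebra_simps)
      also have "\<dots> = (LINT x|lborel. w p \<kappa> x + \<epsilon> * (u x * w p \<kappa> x) + (\<epsilon>\<^sup>2 / 2 * ((u x)\<^sup>2 * w p \<kappa> x) - \<epsilon>\<^sup>2 * \<theta> * ((norm (g x))\<^sup>2 * w p \<kappa> x))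
            - \<epsilon> ^ 3 * (\<theta> * A ^ 3 + B ^ 3 / 6) * w p \<kappa> x)"
        using ints by simp
      also have "\<dots> \<le> ?X \<epsilon>"
      proof (rule integral_mono)
        fix x
        show "w p \<kappa> x + \<epsilon> * (u x * w p \<kappa> x) + (\<epsilon>\<^sup>2 / 2 * ((u x)\<^sup>2 * w p \<kappa> x) - \<epsilon>\<^sup>2 * \<theta> * ((norm (g x))\<^sup>2 * w p \<kappa> x))
            - \<epsilon> ^ 3 * (\<theta> * A ^ 3 + B ^ 3 / 6) * w p \<kappa> x \<le> exp (\<epsilon> * u x - \<epsilon>\<^sup>2 * \<theta> * (norm (g x))\<^sup>2) * w p \<kappa> x"
        proof (cases "x \<in> C")
          case True
          define G where "G = \<theta> * (norm (g x))\<^sup>2"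
          have G: "0 \<le> G" "G \<le> \<theta> * A\<^sup>2" using A(2)[OF True] \<theta>0 unfolding G_def
            by (auto intro!: mult_left_mono power_mono)
          have eG: "\<epsilon> * G \<le> 1 * (\<theta> * A\<^sup>2)" using G \<epsilon> \<epsilon>1 by (intro mult_mono) auto
          let ?q = "\<epsilon> * (u x - \<epsilon> * G)"
          have "- B \<le> u x - \<epsilon> * G" using eG A(1)[OF True] by (auto simp: B_def)
          then have "(\<epsilon> * - B) ^ 3 \<le> ?q ^ 3" using \<epsilon> by (intro power_mono_odd mult_left_mono) auto
          then have q3: "- (\<epsilon> ^ 3 * B ^ 3) \<le> ?q ^ 3" by (simp add: power_mult_distrib)
          have "u x * G \<le> A * (\<theta> * A\<^sup>2)"
            using mult_mono[of "\<bar>u x\<bar>" A G "\<theta> * A\<^sup>2"] G A(1)[OF True] A0 mult_right_mono[of "u x" "\<bar>u x\<bar>" G] by linarith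
          then have "2 * \<epsilon> ^ 3 * (u x * G) \<le> 2 * \<epsilon> ^ 3 * (A * (\<theta> * A\<^sup>2))" using \<epsilon> by (intro mult_left_mono) auto
          moreover have "0 \<le> (\<epsilon>\<^sup>2 * G)\<^sup>2" by simp
          moreover have "?q\<^sup>2 = \<epsilon>\<^sup>2 * (u x)\<^sup>2 - 2 * \<epsilon> ^ 3 * (u x * G) + (\<epsilon>\<^sup>2 * G)\<^sup>2"
            by (simp add: power2_eq_square power3_eq_cube algebra_simps)
          ultimately have q2: "\<epsilon>\<^sup>2 * (u x)\<^sup>2 - 2 * \<epsilon> ^ 3 * (\<theta> * A ^ 3) \<le> ?q\<^sup>2"
            by (simp add: power2_eq_square power3_eq_cube algebra_simps)
          have q1: "?q = \<epsilon> * u x - \<epsilon>\<^sup>2 * G" by (simp add: algebra_simps power2_eq_square)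
          have "1 + \<epsilon> * u x + (\<epsilon>\<^sup>2 / 2 * (u x)\<^sup>2 - \<epsilon>\<^sup>2 * G) - \<epsilon> ^ 3 * (\<theta> * A ^ 3 + B ^ 3 / 6)
            = 1 + ?q + (\<epsilon>\<^sup>2 * (u x)\<^sup>2 - 2 * \<epsilon> ^ 3 * (\<theta> * A ^ 3)) / 2 - (\<epsilon> ^ 3 * B ^ 3) / 6"
            unfolding q1 by (simp add: algebra_simps diff_divide_distrib)
          also have "\<dots> \<le> exp ?q"
            by (rule exp_ge_of_square_cube_bounds[OF q2 q3])
          also have "exp ?q = exp (\<epsilon> * u x - \<epsilon>\<^sup>2 * \<theta> * (norm (g x))\<^sup>2)" by (simp add: G_def algebra_simps power2_eq_square)
          finally have "1 + \<epsilon> * u x + (\<epsilon>\<^sup>2 / 2 * (u x)\<^sup>2 - \<epsilon>\<^sup>2 * G) - \<epsilon> ^ 3 * (\<theta> * A ^ 3 + B ^ 3 / 6)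
            \<le> exp (\<epsilon> * u x - \<epsilon>\<^sup>2 * \<theta> * (norm (g x))\<^sup>2)" .
          from mult_right_mono[OF this w0[of x]] show ?thesis by (simp add: G_def algebra_simps)
        qed (simp add: w_def)
      next
        show "integrable lborel (\<lambda>x. exp (\<epsilon> * u x - \<epsilon>\<^sup>2 * \<theta> * (norm (g x))\<^sup>2) * w p \<kappa> x)"
        proof (rule int[of _ "exp (\<epsilon> * A)"])
          fix x assume "x \<in> C"
          then have "\<epsilon> * u x \<le> \<epsilon> * A" using A(1)[of x] \<epsilon> by (intro mult_left_mono) auto
          moreover have "0 \<le> \<epsilon>\<^sup>2 * \<theta> * (norm (g x))\<^sup>2" using \<theta>0 by auto
          ultimately have "\<epsilon> * u x - \<epsilon>\<^sup>2 * \<theta> * (norm (g x))\<^sup>2 \<le> \<epsilon> * A" by linarith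
          then show "\<bar>exp (\<epsilon> * u x - \<epsilon>\<^sup>2 * \<theta> * (norm (g x))\<^sup>2)\<bar> \<le> exp (\<epsilon> * A)" by simp
        qed measurable
      qed (use ints in auto)
      finally show "?Z + \<epsilon> * ?m + \<epsilon>\<^sup>2 * (?S / 2 - \<theta> * ?E) - \<epsilon> ^ 3 * c \<le> ?X \<epsilon>" .
    qed
  qed
  have "?Z * ?S - ?m\<^sup>2 \<le> 1 / (2 * \<kappa>) * (?Z * ?E)"
  proof (rule tendsto_lowerbound)
    show "((\<lambda>\<theta>. \<theta> * (?Z * ?E)) \<longlongrightarrow> 1 / (2 * \<kappa>) * (?Z * ?E)) (at_right (1 / (2 * \<kappa>)))"
      by (intro tendsto_intros)
    show "\<forall>\<^sub>F \<theta> in at_right (1 / (2 * \<kappa>)). ?Z * ?S - ?m\<^sup>2 \<le> \<theta> * (?Z * ?E)"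
      using eventually_at_right_less[of "1 / (2 * \<kappa>)"]
    proof eventually_elim
      case (elim \<theta>)
      from *[OF elim] show ?case by (simp add: algebra_simps)
    qed
  qed simp
  then show ?thesis using \<kappa> by (simp add: field_simps)
qed

section \<open>Smooth functions and bump functions\<close>

lemma frechet_derivative_eq: "(f has_derivative f') (at x) \<Longrightarrow> frechet_derivative f (at x) = f'"
  by (metis frechet_derivative_at)

lemma has_derivative_grad:
  assumes "f differentiable (at x)"
  shows "(f has_derivative (\<lambda>v. grad f x \<bullet> v)) (at x)"
proof -
  have d: "(f has_derivative frechet_derivative f (at x)) (at x)"
    using assms by (simp add: frechet_derivative_works)
  then have "linear (frechet_derivative f (at x))" by (rule has_derivative_linear)
  have "frechet_derivative f (at x) = (\<lambda>v. grad f x \<bullet> v)"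
  proof
    fix v
    have "frechet_derivative f (at x) v = frechet_derivative f (at x) (\<Sum>i\<in>Basis. (v \<bullet> i) *\<^sub>R i)"
      by (simp add: euclidean_representation)
    also have "\<dots> = (\<Sum>i\<in>Basis. (v \<bullet> i) * frechet_derivative f (at x) i)"
      using \<open>linear (frechet_derivative f (at x))\<close> by (simp add: linear_sum linear_scale)
    also have "\<dots> = grad f x \<bullet> v"
      by (simp add: grad_def inner_sum_left inner_commute[of v] mult.commute)
    finally show "frechet_derivative f (at x) v = grad f x \<bullet> v" .
  qed
  from d[unfolded this] show ?thesis .
qed

lemma grad_eqI:
  assumes "(f has_derivative (\<lambda>v. G \<bullet> v)) (at x)"
  shows "grad f x = G"
  using frechet_derivative_eq[OF assms] by (simp add: grad_def euclidean_representation)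

lemma Ck_on_SucI:
  assumes "\<And>x. (f has_derivative f' x) (at x)" "\<And>i. i \<in> Basis \<Longrightarrow> Ck_on k UNIV (\<lambda>x. f' x i)"
  shows "Ck_on (Suc k) UNIV f"
  using assms by (auto simp: differentiable_on_def differentiable_def frechet_derivative_eq[OF assms(1)])

lemma Ck_on_UNIV_has_derivative:
  assumes "Ck_on (Suc k) UNIV f"
  shows "(f has_derivative frechet_derivative f (at x)) (at x)"
  using assms by (auto simp: differentiable_on_def frechet_derivative_works)

lemma Ck_on_Suc_imp: "Ck_on (Suc k) UNIV f \<Longrightarrow> Ck_on k UNIV f"
proof (induction k arbitrary: f)
  case 0 then show ?case by (auto intro: differentiable_imp_continuous_on)
next
  case (Suc k) then show ?case by (metis Ck_on.simps(2))
qed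

lemma Ck_on_const: "Ck_on k UNIV (\<lambda>_. c)"
proof (induction k arbitrary: c)
  case (Suc k) then show ?case by (intro Ck_on_SucI[where f'="\<lambda>_ _. 0"] has_derivative_const)
qed simp

lemma Ck_on_inner: "Ck_on k UNIV (\<lambda>x::'a::euclidean_space. x \<bullet> v)"
proof (cases k)
  case (Suc k)
  show ?thesis unfolding Suc
    by (rule Ck_on_SucI[where f'="\<lambda>_ u. u \<bullet> v"])
       (auto intro!: has_derivative_inner_left has_derivative_ident Ck_on_const)
qed (auto intro: continuous_intros)

lemma Ck_on_add: "Ck_on k UNIV f \<Longrightarrow> Ck_on k UNIV g \<Longrightarrow> Ck_on k UNIV (\<lambda>x. f x + g x)"
proof (induction k arbitrary: f g)
  case (Suc k)
  note d = Suc.prems[THEN Ck_on_UNIV_has_derivative]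
  show ?case
    using Suc by (intro Ck_on_SucI[OF has_derivative_add[OF d]]) auto
qed (auto intro: continuous_intros)

lemma Ck_on_mult: "Ck_on k UNIV f \<Longrightarrow> Ck_on k UNIV g \<Longrightarrow> Ck_on k UNIV (\<lambda>x. f x * g x)"
proof (induction k arbitrary: f g)
  case (Suc k)
  note d = Suc.prems[THEN Ck_on_UNIV_has_derivative]
  show ?case
    using Suc.prems Suc.IH Suc.prems[THEN Ck_on_Suc_imp]
    by (intro Ck_on_SucI[OF has_derivative_mult[OF d]] Ck_on_add) auto
qed (auto intro: continuous_intros)

text \<open>The outer function is given by the sequence \<open>g\<close> of its successive
  derivatives, so the induction on \<open>k\<close> can run with \<open>m\<close> arbitrary: one
  differentiation replaces \<open>g m\<close> by \<open>g (Suc m)\<close> and produces a factor from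
  \<open>p\<close>.\<close>

lemma Ck_on_compose:
  assumes g: "\<And>m t. (g m has_real_derivative g (Suc m) t) (at t)" and p: "\<And>k. Ck_on k UNIV p"
  shows "Ck_on k UNIV (\<lambda>x. g m (p x))"
proof (induction k arbitrary: m)
  case 0
  have "continuous_on UNIV (g m)"
    using g by (auto intro!: continuous_at_imp_continuous_on DERIV_isCont)
  then have "continuous_on UNIV (g m \<circ> p)"
    using p[of 0] by (intro continuous_on_compose) (auto intro: continuous_on_subset)
  then show ?case by (simp add: o_def)
next
  case (Suc k)
  have g': "(g m has_derivative (\<lambda>v. g (Suc m) t * v)) (at t)" for t
    using g unfolding has_field_derivative_def .
  have d: "((\<lambda>x. g m (p x)) has_derivative (\<lambda>v. g (Suc m) (p x) * frechet_derivative p (at x) v)) (at x)" for x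
    by (rule has_derivative_compose[OF Ck_on_UNIV_has_derivative[OF p[of "Suc 0"]] g'])
  show ?case
    using p[of "Suc k"] Suc.IH by (intro Ck_on_SucI[OF d] Ck_on_mult) auto
qed

lemma smooth_on_UNIV_has_derivative:
  assumes "smooth_on UNIV f"
  shows "(f has_derivative (\<lambda>v. grad f x \<bullet> v)) (at x)"
proof (rule has_derivative_grad)
  have "Ck_on (Suc 0) UNIV f" using assms by (simp only: smooth_on_def)
  then show "f differentiable (at x)" by (simp add: differentiable_on_def)
qed

lemma smooth_on_UNIV_continuous: "smooth_on UNIV f \<Longrightarrow> continuous_on UNIV f"
  unfolding smooth_on_def by (metis Ck_on.simps(1))

lemma smooth_on_UNIV_grad_continuous:
  assumes "smooth_on UNIV f"
  shows "continuous_on UNIV (grad f)"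
proof -
  have "Ck_on (Suc 0) UNIV f" using assms by (simp only: smooth_on_def)
  then show ?thesis unfolding grad_def by (auto intro!: continuous_intros)
qed

lemma smooth_on_mult: "smooth_on UNIV f \<Longrightarrow> smooth_on UNIV g \<Longrightarrow> smooth_on UNIV (\<lambda>x. f x * g x)"
  by (simp add: smooth_on_def Ck_on_mult)

lemma grad_mult:
  assumes "smooth_on UNIV f" "smooth_on UNIV g"
  shows "grad (\<lambda>x. f x * g x) x = f x *\<^sub>R grad g x + g x *\<^sub>R grad f x"
proof (rule grad_eqI)
  show "((\<lambda>x. f x * g x) has_derivative (\<lambda>v. (f x *\<^sub>R grad g x + g x *\<^sub>R grad f x) \<bullet> v)) (at x)"
    using has_derivative_mult[OF assms[THEN smooth_on_UNIV_has_derivative, of x]]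
    by (simp add: inner_add_left mult.commute)
qed

lemma Ck_on_square_norm: "Ck_on k UNIV (\<lambda>x::'a::euclidean_space. a + b * (norm (x - c))\<^sup>2)"
proof -
  have "Ck_on k UNIV (\<lambda>x. a + b * (\<Sum>i\<in>B. (x \<bullet> i + (- (c \<bullet> i))) * (x \<bullet> i + (- (c \<bullet> i)))))"
    if "finite B" for B :: "'a set"
    using that
  proof (induction B rule: finite_induct)
    case (insert i B)
    have "Ck_on k UNIV (\<lambda>x. (a + b * (\<Sum>i\<in>B. (x \<bullet> i + (- (c \<bullet> i))) * (x \<bullet> i + (- (c \<bullet> i)))))
      + b * ((x \<bullet> i + (- (c \<bullet> i))) * (x \<bullet> i + (- (c \<bullet> i)))))"
      by (intro Ck_on_add Ck_on_mult Ck_on_inner Ck_on_const insert.IH)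
    then show ?case using insert by (simp add: algebra_simps)
  qed (simp add: Ck_on_const)
  moreover have "(norm (x - c))\<^sup>2 = (\<Sum>i\<in>Basis. (x \<bullet> i + (- (c \<bullet> i))) * (x \<bullet> i + (- (c \<bullet> i))))" for x
    unfolding power2_norm_eq_inner by (subst euclidean_inner) (simp add: inner_diff_left)
  ultimately show ?thesis by simp
qed

lemma has_derivative_square_norm:
  "((\<lambda>x::'a::euclidean_space. a + b * (norm (x - c))\<^sup>2) has_derivative (\<lambda>v. ((2 * b) *\<^sub>R (x - c)) \<bullet> v)) (at x)"
  unfolding power2_norm_eq_inner
  by (auto intro!: derivative_eq_intros simp: inner_diff_left inner_diff_right inner_commute algebra_simps)

lemma smooth_exp_square_norm: "smooth_on UNIV (\<lambda>x::'a::euclidean_space. exp (b * (norm x)\<^sup>2))"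
  unfolding smooth_on_def
proof
  fix k show "Ck_on k UNIV (\<lambda>x::'a. exp (b * (norm x)\<^sup>2))"
    using Ck_on_compose[of "\<lambda>_. exp" "\<lambda>x::'a. 0 + b * (norm (x - 0))\<^sup>2" k 0] Ck_on_square_norm[of _ 0 b "0::'a"]
    by (auto intro: DERIV_exp)
qed

lemma grad_exp_square_norm: "grad (\<lambda>x::'a::euclidean_space. exp (b * (norm x)\<^sup>2)) x = (2 * b * exp (b * (norm x)\<^sup>2)) *\<^sub>R x"
proof (rule grad_eqI)
  have e: "(exp has_derivative (\<lambda>v. exp t * v)) (at t)" for t :: real
    using DERIV_exp[of t] unfolding has_field_derivative_def .
  have "((\<lambda>x::'a. exp (0 + b * (norm (x - 0))\<^sup>2)) has_derivative (\<lambda>v. exp (0 + b * (norm (x - 0))\<^sup>2) * (((2 * b) *\<^sub>R (x - 0)) \<bullet> v))) (at x)"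
    by (rule has_derivative_compose[OF has_derivative_square_norm e])
  then show "((\<lambda>x. exp (b * (norm x)\<^sup>2)) has_derivative (\<lambda>v. ((2 * b * exp (b * (norm x)\<^sup>2)) *\<^sub>R x) \<bullet> v)) (at x)"
    by (simp add: ac_simps)
qed

definition flat :: "real poly \<Rightarrow> real \<Rightarrow> real" where
  "flat P t = (if 0 < t then poly P (1 / t) * exp (- (1 / t)) else 0)"

lemma tendsto_poly_div_exp: "((\<lambda>s::real. poly P s * exp (- s)) \<longlongrightarrow> 0) at_top"
proof -
  have "((\<lambda>s::real. \<Sum>i\<le>degree P. coeff P i * (s ^ i / exp s)) \<longlongrightarrow> (\<Sum>i\<le>degree P. coeff P i * 0)) at_top"
    by (intro tendsto_sum tendsto_mult tendsto_const tendsto_power_div_exp_0)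
  then show ?thesis
    by (simp add: poly_altdef sum_distrib_right exp_minus divide_inverse mult.assoc)
qed

text \<open>For positive \<open>t\<close> the derivative of P(1/t) exp(-1/t) is (P - P')(1/t)
  exp(-1/t) divided by the square of \<open>t\<close>, whence the factor \<open>[:0, 0, 1:]\<close>.
  At 0 the right difference quotient is s P(s) exp(-s) with s = 1/h, which tends to 0 as s
  grows.\<close>

lemma flat_has_derivative: "(flat P has_real_derivative flat ([:0, 0, 1:] * (P - pderiv P)) t) (at t)"
proof -
  consider "0 < t" | "t < 0" | "t = 0" by linarith
  then show ?thesis
  proof cases
    case 1
    have "((\<lambda>t. poly P (1 / t) * exp (- (1 / t))) has_real_derivative flat ([:0, 0, 1:] * (P - pderiv P)) t) (at t)"
      using 1 by (auto intro!: derivative_eq_intros DERIV_chain2[OF poly_DERIV] simp: flat_def power2_eq_square field_simps)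
    then show ?thesis
      by (rule has_field_derivative_transform_within_open[where S="{0<..}"]) (use 1 in \<open>auto simp: flat_def\<close>)
  next
    case 2
    have "((\<lambda>t. 0) has_real_derivative flat ([:0, 0, 1:] * (P - pderiv P)) t) (at t)"
      using 2 by (simp add: flat_def)
    then show ?thesis
      by (rule has_field_derivative_transform_within_open[where S="{..<0}"]) (use 2 in \<open>auto simp: flat_def\<close>)
  next
    case 3
    have "((\<lambda>h. (flat P (0 + h) - flat P 0) / h) \<longlongrightarrow> 0) (at 0)"
      unfolding filterlim_split_at
    proof (rule filterlim_split_at)
      show "((\<lambda>h. (flat P (0 + h) - flat P 0) / h) \<longlongrightarrow> 0) (at_left 0)"
        by (rule tendsto_eventually) (auto simp: eventually_at_left_field flat_def intro: exI[of _ "-1"])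
      have "((\<lambda>h. poly ([:0, 1:] * P) (inverse h) * exp (- (inverse h))) \<longlongrightarrow> 0) (at_right (0::real))"
        by (rule filterlim_compose[OF tendsto_poly_div_exp filterlim_inverse_at_top_right])
      then show "((\<lambda>h. (flat P (0 + h) - flat P 0) / h) \<longlongrightarrow> 0) (at_right 0)"
        by (rule Lim_transform_eventually)
           (auto simp: eventually_at_right_field flat_def divide_inverse intro: exI[of _ 1])
    qed
    then show ?thesis using 3 by (simp add: DERIV_def flat_def)
  qed
qed

text \<open>The derivatives of \<open>exp (- 1 / t)\<close> for \<open>t > 0\<close>, extended by \<open>0\<close>, stay in this family.\<close>

primrec flat_poly :: "nat \<Rightarrow> real poly" where
  "flat_poly 0 = 1"
| "flat_poly (Suc m) = [:0, 0, 1:] * (flat_poly m - pderiv (flat_poly m))"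

lemma DERIV_flat_poly: "(flat (flat_poly m) has_real_derivative flat (flat_poly (Suc m)) t) (at t)"
  unfolding flat_poly.simps by (rule flat_has_derivative)

lemma continuous_flat_poly: "continuous_on UNIV (flat (flat_poly m))"
  using DERIV_flat_poly by (auto intro!: continuous_at_imp_continuous_on DERIV_isCont)

text \<open>The second derivative is again a continuous member of the family, hence bounded on the
  interval. One constant for all pairs of arguments is what later makes mollified functions
  semiconvex.\<close>

lemma flat_poly_Taylor:
  assumes "0 < K"
  obtains L where "0 < L"
    "\<And>s. \<bar>s\<bar> \<le> K \<Longrightarrow> \<bar>flat (flat_poly m) s\<bar> \<le> L"
    "\<And>s t. \<bar>s\<bar> \<le> K \<Longrightarrow> \<bar>t\<bar> \<le> K \<Longrightarrow>
      \<bar>flat (flat_poly m) t - flat (flat_poly m) s - flat (flat_poly (Suc m)) s * (t - s)\<bar> \<le> L * (t - s)\<^sup>2"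
proof -
  let ?f = "\<lambda>i. flat (flat_poly (m + i))"
  have bd: "\<exists>L>0. \<forall>s\<in>{-K..K}. \<bar>?f i s\<bar> \<le> L" for i
  proof -
    have "compact (?f i ` {-K..K})"
      by (intro compact_continuous_image continuous_on_subset[OF continuous_flat_poly]) auto
    then have "bounded (?f i ` {-K..K})" by (rule compact_imp_bounded)
    then show ?thesis by (auto simp: bounded_pos)
  qed
  obtain L0 where L0: "L0 > 0" "\<And>s. s \<in> {-K..K} \<Longrightarrow> \<bar>?f 0 s\<bar> \<le> L0" using bd[of 0] by blast
  obtain L2 where L2: "L2 > 0" "\<And>s. s \<in> {-K..K} \<Longrightarrow> \<bar>?f 2 s\<bar> \<le> L2" using bd[of 2] by blast
  show thesis
  proof (rule that[of "L0 + L2"])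
    show "\<bar>flat (flat_poly m) s\<bar> \<le> L0 + L2" if "\<bar>s\<bar> \<le> K" for s
    proof -
      have "s \<in> {-K..K}" using that by (auto simp: abs_le_iff)
      then show ?thesis using L0(2)[of s] L2(1) by simp
    qed
    fix s t :: real assume st: "\<bar>s\<bar> \<le> K" "\<bar>t\<bar> \<le> K"
    have D1: "(?f 0 has_real_derivative ?f 1 x) (at x)" "(?f 1 has_real_derivative ?f 2 x) (at x)" for x
      using DERIV_flat_poly[of m x] DERIV_flat_poly[of "Suc m" x] by (simp_all add: numeral_2_eq_2)
    show "\<bar>flat (flat_poly m) t - flat (flat_poly m) s - flat (flat_poly (Suc m)) s * (t - s)\<bar> \<le> (L0 + L2) * (t - s)\<^sup>2"
    proof (cases "s = t")
      case False
      obtain x where x: "(if s < t then s < x \<and> x < t else t < x \<and> x < s)" "?f 0 t - ?f 0 s = ?f 1 x * (t - s)"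
      proof (cases "s < t")
        case True
        then show ?thesis using MVT2[OF True, of "?f 0" "?f 1"] D1 that by (auto simp: mult.commute)
      next
        case F: False
        then have ts: "t < s" using False by simp
        obtain x where "t < x" "x < s" "?f 0 s - ?f 0 t = (s - t) * ?f 1 x"
          using MVT2[OF ts, of "?f 0" "?f 1"] D1 by blast
        then show ?thesis using F that[of x] by (simp add: algebra_simps)
      qed
      have xK: "\<bar>x\<bar> \<le> K" "\<bar>x - s\<bar> \<le> \<bar>t - s\<bar>" using x(1) st by (auto split: if_splits)
      have "norm (?f 1 x - ?f 1 s) \<le> L2 * norm (x - s)"
      proof (rule field_differentiable_bound[where S="{-K..K}"])
        show "(?f 1 has_real_derivative ?f 2 z) (at z within {-K..K})" for z
          by (rule has_field_derivative_at_within[OF D1(2)])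
      qed (use L2 xK st in \<open>auto simp: abs_le_iff\<close>)
      also have "\<dots> \<le> L2 * \<bar>t - s\<bar>" using L2 xK by (intro mult_left_mono) auto
      finally have a: "\<bar>?f 1 x - ?f 1 s\<bar> \<le> L2 * \<bar>t - s\<bar>" by simp
      have "?f 0 t - ?f 0 s - ?f 1 s * (t - s) = (?f 1 x - ?f 1 s) * (t - s)"
        using x(2) by (simp add: algebra_simps)
      then have "\<bar>?f 0 t - ?f 0 s - ?f 1 s * (t - s)\<bar> = \<bar>?f 1 x - ?f 1 s\<bar> * \<bar>t - s\<bar>" by (simp only: abs_mult)
      also have "\<dots> \<le> L2 * \<bar>t - s\<bar> * \<bar>t - s\<bar>" by (intro mult_right_mono a) auto
      also have "\<dots> = L2 * (t - s)\<^sup>2" by (simp add: power2_eq_square mult.assoc)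
      also have "\<dots> \<le> (L0 + L2) * (t - s)\<^sup>2" using L0 by (intro mult_right_mono) auto
      finally show ?thesis by simp
    qed simp
  qed (use L0 L2 in auto)
qed

text \<open>The square of the norm makes this smooth at the centre as well. There is no normalising
  factor; the mass is divided out in the mollification.\<close>

definition bump :: "real \<Rightarrow> 'a::euclidean_space \<Rightarrow> 'a \<Rightarrow> real" where
  "bump \<epsilon> a z = flat 1 (\<epsilon>\<^sup>2 - (norm (z - a))\<^sup>2)"

lemma bump_nonneg: "0 \<le> bump \<epsilon> a z"
  and bump_le_1: "bump \<epsilon> a z \<le> 1"
  by (auto simp: bump_def flat_def)

lemma bump_eq_0_iff: "0 < \<epsilon> \<Longrightarrow> bump \<epsilon> a z \<noteq> 0 \<longleftrightarrow> z \<in> ball a \<epsilon>"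
  using power_strict_mono[of "norm (z - a)" \<epsilon> 2] power2_less_imp_less[of "norm (z - a)" \<epsilon>]
  by (auto simp: bump_def flat_def dist_norm norm_minus_commute)

lemma smooth_bump: "smooth_on UNIV (bump \<epsilon> a)"
  unfolding smooth_on_def
proof
  fix k show "Ck_on k UNIV (bump \<epsilon> a)"
    using Ck_on_compose[of "\<lambda>m. flat (flat_poly m)" "\<lambda>x. \<epsilon>\<^sup>2 + (-1) * (norm (x - a))\<^sup>2" k 0]
      Ck_on_square_norm[of _ "\<epsilon>\<^sup>2" "-1" a] DERIV_flat_poly
    by (simp add: bump_def[abs_def])
qed

lemma grad_bump: "grad (bump \<epsilon> a) z = (- 2 * flat (flat_poly 1) (\<epsilon>\<^sup>2 - (norm (z - a))\<^sup>2)) *\<^sub>R (z - a)"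
proof (rule grad_eqI)
  let ?p = "\<lambda>z. \<epsilon>\<^sup>2 + (-1) * (norm (z - a))\<^sup>2"
  have "((\<lambda>z. flat (flat_poly 0) (?p z)) has_derivative (\<lambda>v. flat (flat_poly (Suc 0)) (?p z) * (((2 * (-1)) *\<^sub>R (z - a)) \<bullet> v))) (at z)"
    using has_derivative_compose[OF has_derivative_square_norm[of "\<epsilon>\<^sup>2" "-1" a z]] DERIV_flat_poly[of 0 "?p z"]
    unfolding has_field_derivative_def by blast
  then show "(bump \<epsilon> a has_derivative (\<lambda>v. ((- 2 * flat (flat_poly 1) (\<epsilon>\<^sup>2 - (norm (z - a))\<^sup>2)) *\<^sub>R (z - a)) \<bullet> v)) (at z)"
    by (simp add: bump_def[abs_def] ac_simps del: flat_poly.simps(2))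
qed

lemma test_function_bump:
  assumes "0 < \<epsilon>" "cball a \<epsilon> \<subseteq> \<Omega>"
  shows "test_function \<Omega> (bump \<epsilon> a)"
proof -
  have "{x. bump \<epsilon> a x \<noteq> 0} = ball a \<epsilon>" using bump_eq_0_iff[OF assms(1)] by blast
  then show ?thesis using assms smooth_bump by (simp add: test_function_def)
qed

section \<open>Square integrable functions\<close>

text \<open>The measure is a parameter because the same facts are needed on the domain, on convex
  pieces of it, and for the Gaussian weighted measure.\<close>

definition sq_integrable :: "'a measure \<Rightarrow> ('a \<Rightarrow> 'b::euclidean_space) \<Rightarrow> bool" where
  "sq_integrable M f \<longleftrightarrow> f \<in> borel_measurable M \<and> integrable M (\<lambda>x. (norm (f x))\<^sup>2)"

lemma sq_integrable_measurable: "sq_integrable M f \<Longrightarrow> f \<in> borel_measurable M"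
  by (simp add: sq_integrable_def)

lemma sq_integrable_bound:
  assumes "integrable M g" "f \<in> borel_measurable M" "\<And>x. x \<in> space M \<Longrightarrow> (norm (f x))\<^sup>2 \<le> g x"
  shows "sq_integrable M f"
  unfolding sq_integrable_def
proof
  show "integrable M (\<lambda>x. (norm (f x))\<^sup>2)"
    by (rule Bochner_Integration.integrable_bound[OF assms(1)])
       (use assms(2,3) in \<open>auto intro!: AE_I2 intro: order_trans[OF _ abs_ge_self]\<close>)
qed fact

lemma sq_integrable_add:
  assumes "sq_integrable M f" "sq_integrable M g"
  shows "sq_integrable M (\<lambda>x. f x + g x)"
proof (rule sq_integrable_bound)
  show "integrable M (\<lambda>x. 2 * (norm (f x))\<^sup>2 + 2 * (norm (g x))\<^sup>2)"
    using assms by (auto simp: sq_integrable_def)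
  fix x
  have "(norm (f x + g x))\<^sup>2 \<le> (norm (f x) + norm (g x))\<^sup>2" by (intro power_mono norm_triangle_ineq) auto
  also have "\<dots> \<le> 2 * (norm (f x))\<^sup>2 + 2 * (norm (g x))\<^sup>2"
    using zero_le_power2[of "norm (f x) - norm (g x)"] by (simp add: power2_eq_square algebra_simps)
  finally show "(norm (f x + g x))\<^sup>2 \<le> 2 * (norm (f x))\<^sup>2 + 2 * (norm (g x))\<^sup>2" .
qed (use assms in \<open>auto simp: sq_integrable_def\<close>)

lemma sq_integrable_scaleR:
  assumes f: "sq_integrable M f" and c: "c \<in> borel_measurable M" "\<And>x. x \<in> space M \<Longrightarrow> \<bar>c x\<bar> \<le> K"
  shows "sq_integrable M (\<lambda>x. c x *\<^sub>R f x)"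
proof (rule sq_integrable_bound)
  show "integrable M (\<lambda>x. K\<^sup>2 * (norm (f x))\<^sup>2)" using f by (auto simp: sq_integrable_def)
  fix x assume "x \<in> space M"
  then have "\<bar>c x\<bar>\<^sup>2 \<le> K\<^sup>2" using c(2) by (intro power_mono) auto
  then have "\<bar>c x\<bar>\<^sup>2 * (norm (f x))\<^sup>2 \<le> K\<^sup>2 * (norm (f x))\<^sup>2" by (intro mult_right_mono) auto
  then show "(norm (c x *\<^sub>R f x))\<^sup>2 \<le> K\<^sup>2 * (norm (f x))\<^sup>2" by (simp add: power_mult_distrib)
qed (use f c in \<open>auto simp: sq_integrable_def\<close>)

lemma sq_integrable_scaleR_vec:
  fixes c :: "'a \<Rightarrow> 'b::euclidean_space"
  assumes f: "sq_integrable M f" and c: "c \<in> borel_measurable M" "\<And>x. x \<in> space M \<Longrightarrow> norm (c x) \<le> K"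
  shows "sq_integrable M (\<lambda>x. f x *\<^sub>R c x)"
proof (rule sq_integrable_bound)
  show "integrable M (\<lambda>x. K\<^sup>2 * (norm (f x))\<^sup>2)" using f by (auto simp: sq_integrable_def)
  fix x assume "x \<in> space M"
  then have "(norm (c x))\<^sup>2 \<le> K\<^sup>2" using c(2) by (intro power_mono) auto
  then have "(norm (f x))\<^sup>2 * (norm (c x))\<^sup>2 \<le> (norm (f x))\<^sup>2 * K\<^sup>2" by (intro mult_left_mono) auto
  then show "(norm (f x *\<^sub>R c x))\<^sup>2 \<le> K\<^sup>2 * (norm (f x))\<^sup>2" by (simp add: power_mult_distrib mult.commute)
qed (use f c in \<open>auto simp: sq_integrable_def\<close>)

lemma sq_integrable_cscale: "sq_integrable M f \<Longrightarrow> sq_integrable M (\<lambda>x. c *\<^sub>R f x)"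
  using sq_integrable_scaleR[of M f "\<lambda>_. c" "\<bar>c\<bar>"] by simp

lemma sq_integrable_diff:
  assumes "sq_integrable M f" "sq_integrable M g"
  shows "sq_integrable M (\<lambda>x. f x - g x)"
  using sq_integrable_add[OF assms(1) sq_integrable_cscale[OF assms(2), of "-1"]] by simp

lemma sq_integrable_const: "finite_measure M \<Longrightarrow> sq_integrable M (\<lambda>_. c)"
  by (simp add: sq_integrable_def finite_measure.integrable_const)

lemma sq_integrable_bounded:
  assumes "finite_measure M" "f \<in> borel_measurable M" "\<And>x. x \<in> space M \<Longrightarrow> norm (f x) \<le> K"
  shows "sq_integrable M f"
  using sq_integrable_scaleR_vec[OF sq_integrable_const[OF assms(1), of "1::real"] assms(2,3)] by simp

text \<open>Lets a function and its gradient be treated as one map into a product space, so that a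
  single appeal to completeness yields the limits of both.\<close>

lemma sq_integrable_Pair:
  "sq_integrable M (\<lambda>x. (f x, g x)) \<longleftrightarrow> sq_integrable M f \<and> sq_integrable M g"
proof safe
  assume fg: "sq_integrable M (\<lambda>x. (f x, g x))"
  then have i: "integrable M (\<lambda>x. (norm (f x))\<^sup>2 + (norm (g x))\<^sup>2)" and m: "(\<lambda>x. (f x, g x)) \<in> borel_measurable M"
    by (auto simp: sq_integrable_def norm_Pair)
  have "f \<in> borel_measurable M" "g \<in> borel_measurable M"
    using measurable_compose[OF m borel_measurable_continuous_onI[OF continuous_on_fst[OF continuous_on_id]]]
      measurable_compose[OF m borel_measurable_continuous_onI[OF continuous_on_snd[OF continuous_on_id]]]
    by simp_all
  then show "sq_integrable M f" "sq_integrable M g"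
    using sq_integrable_bound[OF i, of f] sq_integrable_bound[OF i, of g] by auto
qed (auto simp: sq_integrable_def norm_Pair)

lemma sq_integrable_inner:
  assumes "sq_integrable M f" "sq_integrable M g"
  shows "integrable M (\<lambda>x. f x \<bullet> g x)"
proof (rule Bochner_Integration.integrable_bound)
  show "integrable M (\<lambda>x. (norm (f x))\<^sup>2 + (norm (g x))\<^sup>2)"
    using assms by (auto simp: sq_integrable_def)
  show "AE x in M. norm (f x \<bullet> g x) \<le> norm ((norm (f x))\<^sup>2 + (norm (g x))\<^sup>2)"
  proof (intro AE_I2)
    fix x
    have "\<bar>f x \<bullet> g x\<bar> \<le> norm (f x) * norm (g x)" by (rule Cauchy_Schwarz_ineq2)
    also have "\<dots> \<le> (norm (f x))\<^sup>2 + (norm (g x))\<^sup>2"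
      using zero_le_power2[of "norm (f x) - norm (g x)"] mult_nonneg_nonneg[OF norm_ge_zero norm_ge_zero, of "f x" "g x"]
      unfolding power2_diff by linarith
    finally show "norm (f x \<bullet> g x) \<le> norm ((norm (f x))\<^sup>2 + (norm (g x))\<^sup>2)" by simp
  qed
qed (use assms in \<open>auto simp: sq_integrable_def\<close>)

lemma sq_integrable_mult:
  fixes f g :: "'a \<Rightarrow> real"
  shows "sq_integrable M f \<Longrightarrow> sq_integrable M g \<Longrightarrow> integrable M (\<lambda>x. f x * g x)"
  using sq_integrable_inner[of M f g] by simp

lemma sq_integrable_integrable:
  assumes "finite_measure M" "sq_integrable M f"
  shows "integrable M f"
proof (rule Bochner_Integration.integrable_bound)
  show "integrable M (\<lambda>x. 1 + (norm (f x))\<^sup>2)"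
    using assms by (auto simp: sq_integrable_def finite_measure.integrable_const)
  have "norm (f x) \<le> 1 + (norm (f x))\<^sup>2" for x
    using zero_le_power2[of "norm (f x) - 1"] norm_ge_zero[of "f x"] unfolding power2_diff
    by (simp del: norm_ge_zero)
  then show "AE x in M. norm (f x) \<le> norm (1 + (norm (f x))\<^sup>2)" by (intro AE_I2) (smt (verit) real_norm_def)
qed (use assms in \<open>auto simp: sq_integrable_def\<close>)

text \<open>Serves both for Cauchy-Schwarz and, with \<open>A = 0\<close>, for the Euler-Lagrange
  equation: there it forces the linear coefficient \<open>B\<close> to vanish.\<close>

lemma discriminant_nonpos_real:
  fixes A B C :: real
  assumes "\<And>t. 0 \<le> A + 2 * t * B + t\<^sup>2 * C" "0 \<le> C"
  shows "B\<^sup>2 \<le> A * C"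
proof (cases "C = 0")
  case True
  have "B = 0"
  proof (rule ccontr)
    assume "B \<noteq> 0"
    then show False using assms(1)[of "- (A + 1) / (2 * B)"] True by (simp add: field_simps)
  qed
  then show ?thesis using True by simp
next
  case False
  with assms(2) have "0 < C" by simp
  have "0 \<le> A + 2 * (- B / C) * B + (- B / C)\<^sup>2 * C" by (rule assms(1))
  also have "\<dots> = (A * C - B\<^sup>2) / C" using \<open>0 < C\<close> by (simp add: field_simps power2_eq_square)
  finally show ?thesis using \<open>0 < C\<close> by (simp add: zero_le_divide_iff)
qed

lemma integral_norm_add_scaleR:
  assumes f: "sq_integrable M f" and g: "sq_integrable M g"
  shows "(LINT x|M. (norm (f x + t *\<^sub>R g x))\<^sup>2)
    = (LINT x|M. (norm (f x))\<^sup>2) + 2 * t * (LINT x|M. f x \<bullet> g x) + t\<^sup>2 * (LINT x|M. (norm (g x))\<^sup>2)"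
proof -
  have "(norm (f x + t *\<^sub>R g x))\<^sup>2 = (norm (f x))\<^sup>2 + 2 * t * (f x \<bullet> g x) + t\<^sup>2 * (norm (g x))\<^sup>2" for x
    unfolding power2_norm_eq_inner by (simp add: inner_add_left inner_add_right inner_commute power2_eq_square)
  then show ?thesis using f g sq_integrable_inner[OF f g] by (simp add: sq_integrable_def)
qed

lemma Cauchy_Schwarz_integral:
  assumes f: "sq_integrable M f" and g: "sq_integrable M g"
  shows "(LINT x|M. f x \<bullet> g x)\<^sup>2 \<le> (LINT x|M. (norm (f x))\<^sup>2) * (LINT x|M. (norm (g x))\<^sup>2)"
proof (rule discriminant_nonpos_real)
  show "0 \<le> (LINT x|M. (norm (f x))\<^sup>2) + 2 * t * (LINT x|M. f x \<bullet> g x) + t\<^sup>2 * (LINT x|M. (norm (g x))\<^sup>2)" for t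
    unfolding integral_norm_add_scaleR[OF f g, symmetric] by simp
qed simp

section \<open>Convergence and completeness in the space of square integrable functions\<close>

definition L2_tendsto :: "'a measure \<Rightarrow> (nat \<Rightarrow> 'a \<Rightarrow> 'b::euclidean_space) \<Rightarrow> ('a \<Rightarrow> 'b) \<Rightarrow> bool" where
  "L2_tendsto M f g \<longleftrightarrow> (\<forall>n. sq_integrable M (f n)) \<and> sq_integrable M g \<and>
     (\<lambda>n. LINT x|M. (norm (f n x - g x))\<^sup>2) \<longlonglongrightarrow> 0"

lemma L2_tendsto_sq_integrable:
  assumes "L2_tendsto M f g"
  shows "sq_integrable M (f n)" "sq_integrable M g"
  using assms by (auto simp: L2_tendsto_def)

lemma L2_tendsto_const: "sq_integrable M g \<Longrightarrow> L2_tendsto M (\<lambda>_. g) g"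
  by (simp add: L2_tendsto_def)

lemma L2_tendsto_inner:
  assumes f: "L2_tendsto M f f'" and g: "L2_tendsto M g g'"
  shows "(\<lambda>n. LINT x|M. f n x \<bullet> g n x) \<longlonglongrightarrow> (LINT x|M. f' x \<bullet> g' x)"
proof -
  note sq = f[THEN L2_tendsto_sq_integrable(1)] f[THEN L2_tendsto_sq_integrable(2)]
    g[THEN L2_tendsto_sq_integrable(1)] g[THEN L2_tendsto_sq_integrable(2)]
  define F where "F n x = f n x - f' x" for n x
  define G where "G n x = g n x - g' x" for n x
  have sqF: "sq_integrable M (F n)" "sq_integrable M (G n)" for n
    unfolding F_def G_def by (intro sq_integrable_diff sq)+
  have lim: "(\<lambda>n. LINT x|M. (norm (F n x))\<^sup>2) \<longlonglongrightarrow> 0" "(\<lambda>n. LINT x|M. (norm (G n x))\<^sup>2) \<longlonglongrightarrow> 0"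
    using f g by (auto simp: L2_tendsto_def F_def G_def)
  have z: "(\<lambda>n. LINT x|M. P n x \<bullet> Q n x) \<longlonglongrightarrow> 0"
    if PQ: "\<And>n. sq_integrable M (P n)" "\<And>n. sq_integrable M (Q n)"
      and lim: "(\<lambda>n. (LINT x|M. (norm (P n x))\<^sup>2) * (LINT x|M. (norm (Q n x))\<^sup>2)) \<longlonglongrightarrow> 0"
    for P Q :: "nat \<Rightarrow> 'a \<Rightarrow> 'b"
  proof -
    have "(\<lambda>n. (LINT x|M. P n x \<bullet> Q n x)\<^sup>2) \<longlonglongrightarrow> 0"
      by (rule tendsto_sandwich[OF _ _ tendsto_const lim])
         (auto intro!: always_eventually Cauchy_Schwarz_integral PQ)
    then show ?thesis by simp
  qed
  have "(\<lambda>n. (LINT x|M. F n x \<bullet> G n x) + (LINT x|M. f' x \<bullet> G n x) + (LINT x|M. F n x \<bullet> g' x) + (LINT x|M. f' x \<bullet> g' x))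
    \<longlonglongrightarrow> 0 + 0 + 0 + (LINT x|M. f' x \<bullet> g' x)"
    using tendsto_mult[OF lim] tendsto_mult[OF tendsto_const lim(2), of "LINT x|M. (norm (f' x))\<^sup>2"]
      tendsto_mult[OF lim(1) tendsto_const, of "LINT x|M. (norm (g' x))\<^sup>2"]
    by (intro tendsto_add tendsto_const z sqF sq) simp_all
  moreover have "(LINT x|M. F n x \<bullet> G n x) + (LINT x|M. f' x \<bullet> G n x) + (LINT x|M. F n x \<bullet> g' x) + (LINT x|M. f' x \<bullet> g' x)
    = (LINT x|M. f n x \<bullet> g n x)" for n
  proof -
    have "f n x \<bullet> g n x = F n x \<bullet> G n x + f' x \<bullet> G n x + F n x \<bullet> g' x + f' x \<bullet> g' x" for x
      by (simp add: F_def G_def inner_diff_left inner_diff_right)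
    then show ?thesis using sqF sq by (simp add: sq_integrable_inner)
  qed
  ultimately show ?thesis by simp
qed

text \<open>Riesz-Fischer. Along a subsequence the squared increments have integral below 8 to the
  power -k; with weights 2 to the power k these are still summable, so almost everywhere the
  increments are bounded by a geometric sequence and the subsequence converges. Fatou then compares
  the whole sequence with the pointwise limit.\<close>

lemma L2_complete:
  fixes f :: "nat \<Rightarrow> 'a \<Rightarrow> 'b::euclidean_space"
  assumes sq: "\<And>n. sq_integrable M (f n)"
    and Cauchy: "\<And>e. 0 < e \<Longrightarrow> \<exists>N. \<forall>m\<ge>N. \<forall>n\<ge>N. (LINT x|M. (norm (f m x - f n x))\<^sup>2) < e"
  obtains g where "L2_tendsto M f g"
proof -
  note [measurable] = sq[THEN sq_integrable_measurable]
  have eq: "(\<integral>\<^sup>+x. ennreal ((norm (f m x - f n x))\<^sup>2) \<partial>M) = ennreal (LINT x|M. (norm (f m x - f n x))\<^sup>2)" for m n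
    using sq_integrable_diff[OF sq[of m] sq[of n]] by (intro nn_integral_eq_integral) (auto simp: sq_integrable_def)
  have "\<forall>k. \<exists>N. \<forall>m\<ge>N. \<forall>n\<ge>N. (LINT x|M. (norm (f m x - f n x))\<^sup>2) < (1/8)^k"
    by (intro allI Cauchy) simp
  then obtain N where N: "\<And>k m n. N k \<le> m \<Longrightarrow> N k \<le> n \<Longrightarrow> (LINT x|M. (norm (f m x - f n x))\<^sup>2) < (1/8)^k"
    by metis
  \<comment> \<open>The sum guarantees \<open>N k \<le> r k\<close> and
    \<open>N k \<le> r (Suc k)\<close>; the summand \<open>k\<close> makes the indices tend to
    infinity even if \<open>N\<close> is bounded.\<close>
  define r where "r k = k + (\<Sum>i\<le>k. N i)" for k
  have rN: "N k \<le> r k" "k \<le> r k" "N k \<le> r (Suc k)" for k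
    using member_le_sum[of k "{..k}" N] by (auto simp: r_def)
  define \<Delta> where "\<Delta> k x = norm (f (r (Suc k)) x - f (r k) x)" for k x
  have [measurable]: "\<Delta> k \<in> borel_measurable M" for k unfolding \<Delta>_def by measurable
  have "(\<integral>\<^sup>+x. (\<Sum>k. ennreal (2 ^ k * (\<Delta> k x)\<^sup>2)) \<partial>M) = (\<Sum>k. \<integral>\<^sup>+x. ennreal (2 ^ k * (\<Delta> k x)\<^sup>2) \<partial>M)"
    by (intro nn_integral_suminf) measurable
  also have "\<dots> \<le> (\<Sum>k. ennreal ((1/4) ^ k))"
  proof (intro suminf_le)
    fix k
    have "(\<integral>\<^sup>+x. ennreal (2 ^ k * (\<Delta> k x)\<^sup>2) \<partial>M) = ennreal (2 ^ k) * (\<integral>\<^sup>+x. ennreal ((\<Delta> k x)\<^sup>2) \<partial>M)"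
      by (simp add: ennreal_mult nn_integral_cmult)
    also have "\<dots> \<le> ennreal (2 ^ k) * ennreal ((1/8) ^ k)"
      unfolding \<Delta>_def eq using N[OF rN(3) rN(1), of k] by (intro mult_left_mono ennreal_leI) auto
    also have "\<dots> = ennreal ((1/4) ^ k)" by (simp flip: ennreal_mult power_mult_distrib)
    finally show "(\<integral>\<^sup>+x. ennreal (2 ^ k * (\<Delta> k x)\<^sup>2) \<partial>M) \<le> ennreal ((1/4) ^ k)" .
  qed auto
  also have "\<dots> < \<infinity>"
    by (subst suminf_ennreal2) (auto intro!: summable_geometric)
  finally have "AE x in M. (\<Sum>k. ennreal (2 ^ k * (\<Delta> k x)\<^sup>2)) \<noteq> \<infinity>"
    by (intro nn_integral_noteq_infinite) auto
  then have conv: "AE x in M. convergent (\<lambda>k. f (r k) x)"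
  proof eventually_elim
    case (elim x)
    have "summable (\<lambda>k. 2 ^ k * (\<Delta> k x)\<^sup>2)"
      using elim by (intro summable_suminf_not_top) (auto simp: \<Delta>_def)
    then have "Bseq (\<lambda>k. 2 ^ k * (\<Delta> k x)\<^sup>2)"
      by (intro convergent_imp_Bseq) (auto simp: convergent_def dest!: summable_LIMSEQ_zero)
    then obtain K where K: "0 < K" "\<And>k. \<bar>2 ^ k * (\<Delta> k x)\<^sup>2\<bar> \<le> K" by (auto simp: Bseq_def)
    have "summable (\<lambda>k. sqrt K * (1 / sqrt 2) ^ k)"
      by (intro summable_mult summable_geometric) (auto simp: field_simps)
    then have "summable (\<lambda>k. f (r (Suc k)) x - f (r k) x)"
    proof (rule summable_comparison_test')
      fix k :: nat
      have "(\<Delta> k x)\<^sup>2 \<le> K * (1/2) ^ k" using K(2)[of k] by (simp add: field_simps power_divide)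
      then have "\<Delta> k x \<le> sqrt (K * (1/2) ^ k)" by (rule real_le_rsqrt)
      also have "\<dots> = sqrt K * (1 / sqrt 2) ^ k" by (simp add: real_sqrt_mult real_sqrt_power real_sqrt_divide)
      finally show "norm (f (r (Suc k)) x - f (r k) x) \<le> sqrt K * (1 / sqrt 2) ^ k" by (simp add: \<Delta>_def)
    qed
    then have "convergent (\<lambda>n. f (r 0) x + (\<Sum>k<n. f (r (Suc k)) x - f (r k) x))"
      by (intro convergent_add convergent_const) (simp add: summable_iff_convergent)
    then show ?case by (simp add: sum_lessThan_telescope[of "\<lambda>k. f (r k) x"])
  qed
  define g where "g x = lim (\<lambda>k. f (r k) x)" for x
  have [measurable]: "g \<in> borel_measurable M" unfolding g_def by measurable
  \<comment> \<open>Fatou's lemma: a bound on the distances from \<open>f m\<close> to all late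
    members passes to the distance from \<open>f m\<close> to the limit.\<close>
  have le: "(\<integral>\<^sup>+x. ennreal ((norm (f m x - g x))\<^sup>2) \<partial>M) \<le> ennreal e"
    if m: "\<And>k. K \<le> k \<Longrightarrow> (LINT x|M. (norm (f m x - f k x))\<^sup>2) < e" for m K e
  proof -
    have "(\<integral>\<^sup>+x. ennreal ((norm (f m x - g x))\<^sup>2) \<partial>M) = (\<integral>\<^sup>+x. liminf (\<lambda>k. ennreal ((norm (f m x - f (r k) x))\<^sup>2)) \<partial>M)"
    proof (rule nn_integral_cong_AE)
      show "AE x in M. ennreal ((norm (f m x - g x))\<^sup>2) = liminf (\<lambda>k. ennreal ((norm (f m x - f (r k) x))\<^sup>2))"
        using conv
      proof eventually_elim
        case (elim x)
        then have "(\<lambda>k. f (r k) x) \<longlonglongrightarrow> g x" by (simp add: convergent_LIMSEQ_iff g_def)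
        then have "(\<lambda>k. ennreal ((norm (f m x - f (r k) x))\<^sup>2)) \<longlonglongrightarrow> ennreal ((norm (f m x - g x))\<^sup>2)"
          by (intro tendsto_intros)
        from lim_imp_Liminf[OF _ this] show ?case by simp
      qed
    qed
    also have "\<dots> \<le> liminf (\<lambda>k. \<integral>\<^sup>+x. ennreal ((norm (f m x - f (r k) x))\<^sup>2) \<partial>M)"
      by (intro nn_integral_liminf) measurable
    also have "\<dots> \<le> liminf (\<lambda>k. ennreal e)"
    proof (rule Liminf_mono)
      have "(\<integral>\<^sup>+x. ennreal ((norm (f m x - f (r k) x))\<^sup>2) \<partial>M) \<le> ennreal e" if "K \<le> k" for k
        unfolding eq using m[of "r k"] rN(2)[of k] that by (intro ennreal_leI) auto
      then show "\<forall>\<^sub>F k in sequentially. (\<integral>\<^sup>+x. ennreal ((norm (f m x - f (r k) x))\<^sup>2) \<partial>M) \<le> ennreal e"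
        by (auto simp: eventually_sequentially)
    qed
    also have "\<dots> = ennreal e" by (simp add: Liminf_const)
    finally show ?thesis .
  qed
  obtain N0 where N0: "\<And>m n. N0 \<le> m \<Longrightarrow> N0 \<le> n \<Longrightarrow> (LINT x|M. (norm (f m x - f n x))\<^sup>2) < 1"
    using Cauchy[of 1] by auto
  have "sq_integrable M (\<lambda>x. f N0 x - g x)"
    unfolding sq_integrable_def
    using le[of N0 N0 1] N0 by (auto simp: integrable_iff_bounded intro: le_less_trans)
  from sq_integrable_diff[OF sq[of N0] this] have sqg: "sq_integrable M g" by simp
  have "(\<lambda>n. LINT x|M. (norm (f n x - g x))\<^sup>2) \<longlonglongrightarrow> 0"
  proof (rule LIMSEQ_I)
    fix e :: real assume e: "0 < e"
    obtain K where K: "\<And>m n. K \<le> m \<Longrightarrow> K \<le> n \<Longrightarrow> (LINT x|M. (norm (f m x - f n x))\<^sup>2) < e/2"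
      using Cauchy[of "e/2"] e by auto
    have "(LINT x|M. (norm (f m x - g x))\<^sup>2) < e" if "K \<le> m" for m
    proof -
      have "ennreal (LINT x|M. (norm (f m x - g x))\<^sup>2) \<le> ennreal (e/2)"
        using le[of K m "e/2"] K[OF that] sq_integrable_diff[OF sq[of m] sqg]
        by (subst nn_integral_eq_integral[symmetric]) (auto simp: sq_integrable_def)
      then show ?thesis using e by (simp add: ennreal_le_iff)
    qed
    then show "\<exists>no. \<forall>n\<ge>no. norm ((LINT x|M. (norm (f n x - g x))\<^sup>2) - 0) < e" by auto
  qed
  then show thesis using that sq sqg by (auto simp: L2_tendsto_def)
qed

section \<open>Weak gradients\<close>

lemma integral_lebesgue_on_compact_support:
  fixes h :: "'a::euclidean_space \<Rightarrow> 'b::euclidean_space"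
  assumes h: "continuous_on UNIV h" and K: "compact K" "K \<subseteq> \<Omega>" "\<And>x. x \<notin> K \<Longrightarrow> h x = 0"
    and \<Omega>: "\<Omega> \<in> sets lebesgue"
  shows "integrable lborel h" "integrable (lebesgue_on \<Omega>) h" "integral\<^sup>L (lebesgue_on \<Omega>) h = integral\<^sup>L lborel h"
proof -
  have m: "h \<in> borel_measurable borel" by (rule borel_measurable_continuous_onI[OF h])
  have eq: "indicator K x *\<^sub>R h x = h x" "indicator \<Omega> x *\<^sub>R h x = h x" for x
    using K by (auto simp: indicator_def)
  show i: "integrable lborel h"
    using borel_integrable_compact[OF K(1) continuous_on_subset[OF h]] by (simp add: eq)
  then have "integrable lebesgue h" by (rule integrable_completion[THEN iffD2, rotated]) (use m in auto)
  then show "integrable (lebesgue_on \<Omega>) h"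
    using \<Omega> by (subst integrable_restrict_space) (auto simp: eq)
  show "integral\<^sup>L (lebesgue_on \<Omega>) h = integral\<^sup>L lborel h"
    using \<Omega> m by (subst integral_restrict_space) (auto simp: eq integral_completion)
qed

text \<open>Every difference quotient has integral 0 by translation invariance, and dominated
  convergence carries this to the derivative. The mean value theorem bounds the quotients by the
  maximum of the derivative.\<close>

lemma integral_frechet_derivative_eq_0:
  fixes F :: "'a::euclidean_space \<Rightarrow> real"
  assumes F: "Ck_on 1 UNIV F" and K: "compact K" "\<And>x. x \<notin> K \<Longrightarrow> F x = 0" and i: "i \<in> Basis"
  shows "(LINT x|lborel. frechet_derivative F (at x) i) = 0"
proof -
  define D where "D x = frechet_derivative F (at x) i" for x
  have F1: "Ck_on (Suc 0) UNIV F" using F by simp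
  have cD: "continuous_on UNIV D" using F i by (simp add: D_def)
  have cF: "continuous_on UNIV F" using Ck_on_Suc_imp[OF F1] by simp
  note [measurable] = borel_measurable_continuous_onI[OF cD] borel_measurable_continuous_onI[OF cF]
  have line: "((\<lambda>t. F (x + t *\<^sub>R i)) has_real_derivative D (x + t *\<^sub>R i)) (at t)" for x t
  proof -
    have "((\<lambda>t. x + t *\<^sub>R i) has_derivative (\<lambda>t. t *\<^sub>R i)) (at t)"
      by (auto intro!: derivative_eq_intros)
    from has_derivative_compose[OF this Ck_on_UNIV_has_derivative[OF F1]]
    have "((\<lambda>t. F (x + t *\<^sub>R i)) has_derivative (\<lambda>s. frechet_derivative F (at (x + t *\<^sub>R i)) (s *\<^sub>R i))) (at t)" .
    moreover have "(\<lambda>s. frechet_derivative F (at (x + t *\<^sub>R i)) (s *\<^sub>R i)) = (*) (D (x + t *\<^sub>R i))"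
      using linear_scale[OF has_derivative_linear[OF Ck_on_UNIV_has_derivative[OF F1]]]
      by (intro ext) (simp add: D_def)
    ultimately show ?thesis by (simp only: has_field_derivative_def)
  qed
  have D0: "D x = 0" if "x \<notin> K" for x
  proof -
    have "open (- K)" using compact_imp_closed[OF K(1)] by (rule open_Compl)
    then have "(F has_derivative (\<lambda>_. 0)) (at x)"
      by (rule has_derivative_transform_within_open[OF has_derivative_const[of 0]]) (use K that in auto)
    then show ?thesis unfolding D_def by (simp add: frechet_derivative_eq)
  qed
  obtain B where B: "0 < B" "\<And>x. x \<in> K \<Longrightarrow> \<bar>D x\<bar> \<le> B"
    using compact_imp_bounded[OF compact_continuous_image[OF continuous_on_subset[OF cD] K(1)]]
    by (auto simp: bounded_pos)
  have DB: "\<bar>D x\<bar> \<le> B" for x using B D0[of x] by (cases "x \<in> K") auto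
  obtain R where R: "0 < R" "K \<subseteq> cball 0 R"
    using compact_imp_bounded[OF K(1)] by (auto simp: bounded_pos subset_iff)
  define q where "q n x = real (Suc n) * (F (x + (1 / real (Suc n)) *\<^sub>R i) - F x)" for n x
  have qm[measurable]: "q n \<in> borel_measurable borel" for n unfolding q_def by measurable
  have "(\<lambda>n. LINT x|lborel. q n x) \<longlonglongrightarrow> (LINT x|lborel. D x)"
  proof (rule integral_dominated_convergence)
    \<comment> \<open>The steps have length at most 1, so the quotients vanish outside the ball of
      radius \<open>R + 1\<close>.\<close>
    show "integrable lborel (\<lambda>x. B * indicator (cball (0::'a) (R + 1)) x)"
      by (intro integrable_mult_right integrable_real_indicator emeasure_lborel_cball_finite) auto
    show "AE x in lborel. norm (q n x) \<le> B * indicator (cball 0 (R + 1)) x" for n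
    proof (intro AE_I2)
      fix x
      let ?t = "1 / real (Suc n)"
      show "norm (q n x) \<le> B * indicator (cball 0 (R + 1)) x"
      proof (cases "norm x \<le> R + 1")
        case True
        obtain z where z: "F (x + ?t *\<^sub>R i) - F (x + 0 *\<^sub>R i) = (?t - 0) * D (x + z *\<^sub>R i)"
          using MVT2[of 0 ?t "\<lambda>t. F (x + t *\<^sub>R i)" "\<lambda>t. D (x + t *\<^sub>R i)"] line by auto
        have "\<bar>q n x\<bar> = \<bar>D (x + z *\<^sub>R i)\<bar>" unfolding q_def using z by simp
        then show ?thesis using DB[of "x + z *\<^sub>R i"] True by simp
      next
        case False
        have "norm x \<le> norm (x + ?t *\<^sub>R i) + norm (?t *\<^sub>R i)"
          using norm_triangle_ineq4[of "x + ?t *\<^sub>R i" "?t *\<^sub>R i"] by simp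
        also have "norm (?t *\<^sub>R i) \<le> 1" using i by simp
        finally have "x + ?t *\<^sub>R i \<notin> K" using False R by auto
        moreover have "x \<notin> K" using False R by auto
        ultimately show ?thesis using K(2) B(1) by (auto simp: q_def indicator_def)
      qed
    qed
    show "AE x in lborel. (\<lambda>n. q n x) \<longlonglongrightarrow> D x"
    proof (intro AE_I2)
      fix x
      have "((\<lambda>h. (F (x + (0 + h) *\<^sub>R i) - F (x + 0 *\<^sub>R i)) / h) \<longlongrightarrow> D (x + 0 *\<^sub>R i)) (at 0)"
        using line[of x 0] by (simp only: DERIV_def)
      moreover have "filterlim (\<lambda>n. 1 / real (Suc n)) (at 0) sequentially"
        using LIMSEQ_inverse_real_of_nat by (auto simp: filterlim_at inverse_eq_divide)
      ultimately have "(\<lambda>n. (F (x + (0 + 1 / real (Suc n)) *\<^sub>R i) - F (x + 0 *\<^sub>R i)) / (1 / real (Suc n))) \<longlonglongrightarrow> D (x + 0 *\<^sub>R i)"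
        by (rule filterlim_compose)
      then show "(\<lambda>n. q n x) \<longlonglongrightarrow> D x"
        by (simp add: q_def mult.commute)
    qed
  qed auto
  moreover have "(LINT x|lborel. q n x) = 0" for n
  proof -
    have iF: "integrable lborel F"
      by (rule integral_lebesgue_on_compact_support(1)[OF cF K(1) order_refl K(2)]) (use K in \<open>auto simp: compact_imp_closed\<close>)
    let ?c = "(1 / real (Suc n)) *\<^sub>R i"
    have "integrable lborel (\<lambda>x. F (?c + x))" "(LINT x|lborel. F (?c + x)) = (LINT x|lborel. F x)"
      using iF integrable_distr_eq[of "(+) ?c" lborel borel F] integral_distr[of "(+) ?c" lborel borel F]
      by (simp_all add: lborel_distr_plus)
    then show ?thesis using iF by (simp add: q_def add.commute)
  qed
  ultimately have "(\<lambda>n::nat. 0::real) \<longlonglongrightarrow> (LINT x|lborel. D x)" by simp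
  then show ?thesis by (simp add: D_def LIMSEQ_const_iff)
qed

lemma test_function_facts:
  assumes "test_function \<Omega> \<phi>"
  defines "K \<equiv> closure {x. \<phi> x \<noteq> 0}"
  shows "smooth_on UNIV \<phi>" "compact K" "K \<subseteq> \<Omega>" "\<And>x. x \<notin> K \<Longrightarrow> \<phi> x = 0" "\<And>x. x \<notin> K \<Longrightarrow> grad \<phi> x = 0"
proof -
  show s: "smooth_on UNIV \<phi>" "compact K" "K \<subseteq> \<Omega>" using assms by (auto simp: test_function_def)
  show z: "\<phi> x = 0" if "x \<notin> K" for x using that closure_subset[of "{x. \<phi> x \<noteq> 0}"] by (auto simp: K_def)
  show "grad \<phi> x = 0" if "x \<notin> K" for x
  proof (rule grad_eqI)
    have "open (- K)" using compact_imp_closed[OF s(2)] by (rule open_Compl)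
    then have "(\<phi> has_derivative (\<lambda>_. 0)) (at x)"
      by (rule has_derivative_transform_within_open[OF has_derivative_const[of 0]]) (use z that in auto)
    moreover have "(\<lambda>_. 0) = (\<bullet>) (0::'a)" by (rule ext) simp
    ultimately show "(\<phi> has_derivative (\<bullet>) 0) (at x)" by (simp only:)
  qed
qed

lemma test_function_supportE:
  assumes "test_function \<Omega> \<phi>"
  obtains K where "compact K" "K \<subseteq> \<Omega>" "\<And>x. x \<notin> K \<Longrightarrow> \<phi> x = 0" "\<And>x. x \<notin> K \<Longrightarrow> grad \<phi> x = 0"
  using test_function_facts(2-5)[OF assms] by (rule that)

lemma test_function_mult:
  assumes "test_function \<Omega> \<phi>" "smooth_on UNIV \<psi>"
  shows "test_function \<Omega> (\<lambda>x. \<psi> x * \<phi> x)"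
proof -
  have "closure {x. \<psi> x * \<phi> x \<noteq> 0} \<subseteq> closure {x. \<phi> x \<noteq> 0}" by (intro closure_mono) auto
  then show ?thesis
    using assms smooth_on_mult[OF assms(2), of \<phi>] bounded_subset[of "closure {x. \<phi> x \<noteq> 0}" "{x. \<psi> x * \<phi> x \<noteq> 0}"]
      closure_subset[of "{x. \<psi> x * \<phi> x \<noteq> 0}"]
    unfolding test_function_def compact_closure by (meson bounded_closure order_trans)
qed

lemma measurable_lebesgue_on_continuous:
  fixes f :: "'a::euclidean_space \<Rightarrow> 'b::euclidean_space"
  assumes "continuous_on UNIV f"
  shows "f \<in> borel_measurable (lebesgue_on \<Omega>)"
  using borel_measurable_continuous_onI[OF assms] by (intro measurable_restrict_space1 measurable_completion) simp

text \<open>The product \<open>\<psi> x * \<phi> x\<close> has compact support in \<Omega>, so its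
  partial derivatives integrate to 0; the product rule splits this into the two sides of the weak
  identity.\<close>

lemma weak_grad_smooth:
  assumes \<psi>: "smooth_on UNIV \<psi>" and \<Omega>: "\<Omega> \<in> sets lebesgue"
  shows "weak_grad \<Omega> \<psi> (grad \<psi>)"
  unfolding weak_grad_def
proof (intro allI impI)
  fix \<phi> assume \<phi>: "test_function \<Omega> \<phi>"
  note t = test_function_facts(1)[OF \<phi>]
  note p = test_function_facts(1)[OF test_function_mult[OF \<phi> \<psi>]]
  obtain K where K: "compact K" "K \<subseteq> \<Omega>" and K0: "\<And>x. x \<notin> K \<Longrightarrow> \<phi> x = 0" "\<And>x. x \<notin> K \<Longrightarrow> grad \<phi> x = 0"
    using test_function_supportE[OF \<phi>] by blast
  define F where "F x = \<psi> x * \<phi> x" for x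
  have F: "smooth_on UNIV F" using p by (simp add: F_def[abs_def])
  have gradF: "grad F x = \<psi> x *\<^sub>R grad \<phi> x + \<phi> x *\<^sub>R grad \<psi> x" for x
    unfolding F_def by (rule grad_mult[OF \<psi> t])
  have F0: "F x = 0" "grad F x = 0" if "x \<notin> K" for x
    using K0[OF that] by (simp_all add: gradF F_def)
  note c = smooth_on_UNIV_continuous[OF \<psi>] smooth_on_UNIV_continuous[OF t]
    smooth_on_UNIV_grad_continuous[OF \<psi>] smooth_on_UNIV_grad_continuous[OF t]
  have cont: "continuous_on UNIV (\<lambda>x. \<psi> x *\<^sub>R grad \<phi> x)" "continuous_on UNIV (\<lambda>x. \<phi> x *\<^sub>R grad \<psi> x)"
    using c by (simp_all add: continuous_on_scaleR)
  have i1: "integrable (lebesgue_on \<Omega>) (\<lambda>x. \<psi> x *\<^sub>R grad \<phi> x)"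
    by (rule integral_lebesgue_on_compact_support(2)[OF cont(1) K _ \<Omega>]) (simp add: K0)
  have i2: "integrable (lebesgue_on \<Omega>) (\<lambda>x. \<phi> x *\<^sub>R grad \<psi> x)"
    by (rule integral_lebesgue_on_compact_support(2)[OF cont(2) K _ \<Omega>]) (simp add: K0)
  note iF = integral_lebesgue_on_compact_support[OF smooth_on_UNIV_grad_continuous[OF F] K F0(2) \<Omega>]
  have "(LINT x|lebesgue_on \<Omega>. \<psi> x *\<^sub>R grad \<phi> x) + (LINT x|lebesgue_on \<Omega>. \<phi> x *\<^sub>R grad \<psi> x)
    = (LINT x|lebesgue_on \<Omega>. grad F x)"
    unfolding gradF by (rule Bochner_Integration.integral_add[OF i1 i2, symmetric])
  also have "\<dots> = (LINT x|lborel. grad F x)" by (rule iF(3))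
  also have "\<dots> = 0"
  proof (rule euclidean_eqI)
    fix i :: 'a assume i: "i \<in> Basis"
    have "Ck_on 1 UNIV F" using F by (simp only: smooth_on_def)
    then have "(LINT x|lborel. frechet_derivative F (at x) i) = 0"
      by (rule integral_frechet_derivative_eq_0[OF _ K(1) F0(1) i])
    moreover have "frechet_derivative F (at x) i = grad F x \<bullet> i" for x
      using frechet_derivative_eq[OF smooth_on_UNIV_has_derivative[OF F]] by simp
    ultimately show "(LINT x|lborel. grad F x) \<bullet> i = 0 \<bullet> i"
      using iF(1) by simp
  qed
  finally show "(LINT x|lebesgue_on \<Omega>. \<psi> x *\<^sub>R grad \<phi> x) = - (LINT x|lebesgue_on \<Omega>. \<phi> x *\<^sub>R grad \<psi> x)"
    by (simp add: eq_neg_iff_add_eq_0)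
qed

lemma L2_on_1: "L2_on \<Omega> (\<lambda>_. 1) u \<longleftrightarrow> sq_integrable (lebesgue_on \<Omega>) u"
  by (simp add: L2_on_def sq_integrable_def)

lemma H1_on_iff: "H1_on \<Omega> u G \<longleftrightarrow> sq_integrable (lebesgue_on \<Omega>) u \<and> sq_integrable (lebesgue_on \<Omega>) G \<and> weak_grad \<Omega> u G"
  by (simp add: H1_on_def L2_on_1)

lemma smooth_bounded_on:
  fixes f :: "'a::euclidean_space \<Rightarrow> 'b::euclidean_space"
  assumes "continuous_on UNIV f" "bounded \<Omega>"
  obtains B where "\<And>x. x \<in> \<Omega> \<Longrightarrow> norm (f x) \<le> B"
proof -
  have "compact (f ` closure \<Omega>)"
    using assms by (intro compact_continuous_image continuous_on_subset[OF assms(1)]) auto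
  then have "bounded (f ` closure \<Omega>)" by (rule compact_imp_bounded)
  then obtain B where "\<forall>x\<in>closure \<Omega>. norm (f x) \<le> B" by (auto simp: bounded_iff)
  then show thesis using that closure_subset by blast
qed

section \<open>Sobolev functions on a bounded open set\<close>

locale bounded_domain =
  fixes \<Omega> :: "'a::euclidean_space set"
  assumes open_\<Omega>: "open \<Omega>" and bounded_\<Omega>: "bounded \<Omega>"
begin

abbreviation "M \<equiv> lebesgue_on \<Omega>"

lemma sets_\<Omega>: "\<Omega> \<in> sets lebesgue" "\<Omega> \<in> sets borel"
  using open_\<Omega> by auto

lemma lmeasurable_\<Omega>: "\<Omega> \<in> lmeasurable"
  by (rule lmeasurable_open[OF bounded_\<Omega> open_\<Omega>])

sublocale finite_measure M
  using lmeasurable_\<Omega> by (rule finite_measure_lebesgue_on)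

lemma sq_integrable_continuous:
  fixes f :: "'a \<Rightarrow> 'b::euclidean_space"
  assumes "continuous_on UNIV f"
  shows "sq_integrable M f"
proof -
  obtain B where "\<And>x. x \<in> \<Omega> \<Longrightarrow> norm (f x) \<le> B" using smooth_bounded_on[OF assms bounded_\<Omega>] by blast
  then show ?thesis
    by (intro sq_integrable_bounded[of _ _ B] measurable_lebesgue_on_continuous assms finite_measure_axioms) auto
qed

lemma sq_integrable_continuous_scaleR:
  fixes f :: "'a \<Rightarrow> 'b::euclidean_space"
  assumes "continuous_on UNIV c" "sq_integrable M f"
  shows "sq_integrable M (\<lambda>x. c x *\<^sub>R f x)"
proof -
  obtain B where "\<And>x. x \<in> \<Omega> \<Longrightarrow> norm (c x) \<le> B" using smooth_bounded_on[OF assms(1) bounded_\<Omega>] by blast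
  then show ?thesis
    by (intro sq_integrable_scaleR[of _ _ _ B] measurable_lebesgue_on_continuous assms) auto
qed

lemma sq_integrable_scaleR_continuous:
  fixes c :: "'a \<Rightarrow> 'b::euclidean_space"
  assumes "continuous_on UNIV c" "sq_integrable M f"
  shows "sq_integrable M (\<lambda>x. f x *\<^sub>R c x)"
proof -
  obtain B where "\<And>x. x \<in> \<Omega> \<Longrightarrow> norm (c x) \<le> B" using smooth_bounded_on[OF assms(1) bounded_\<Omega>] by blast
  then show ?thesis
    by (intro sq_integrable_scaleR_vec[of _ _ _ B] measurable_lebesgue_on_continuous assms) auto
qed

lemma integrable_test:
  assumes "test_function \<Omega> \<phi>"
  shows "sq_integrable M u \<Longrightarrow> integrable M (\<lambda>x. u x *\<^sub>R grad \<phi> x)"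
    "sq_integrable M (G :: 'a \<Rightarrow> 'b::euclidean_space) \<Longrightarrow> integrable M (\<lambda>x. \<phi> x *\<^sub>R G x)"
proof -
  note t = test_function_facts(1)[OF assms]
  note c = smooth_on_UNIV_continuous[OF t] smooth_on_UNIV_grad_continuous[OF t]
  show "sq_integrable M u \<Longrightarrow> integrable M (\<lambda>x. u x *\<^sub>R grad \<phi> x)"
    by (rule sq_integrable_integrable[OF finite_measure_axioms sq_integrable_scaleR_continuous[OF c(2)]])
  show "sq_integrable M G \<Longrightarrow> integrable M (\<lambda>x. \<phi> x *\<^sub>R G x)"
    by (rule sq_integrable_integrable[OF finite_measure_axioms sq_integrable_continuous_scaleR[OF c(1)]])
qed

lemma H1_on_lincomb:
  assumes u: "H1_on \<Omega> u G" and v: "H1_on \<Omega> v V"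
  shows "H1_on \<Omega> (\<lambda>x. u x + c * v x) (\<lambda>x. G x + c *\<^sub>R V x)"
  unfolding H1_on_iff
proof (intro conjI)
  show "sq_integrable M (\<lambda>x. u x + c * v x)"
    using u v sq_integrable_add[of M u "\<lambda>x. c *\<^sub>R v x"] sq_integrable_cscale[of M v c] by (simp add: H1_on_iff)
  show "sq_integrable M (\<lambda>x. G x + c *\<^sub>R V x)"
    using u v by (intro sq_integrable_add sq_integrable_cscale) (auto simp: H1_on_iff)
  show "weak_grad \<Omega> (\<lambda>x. u x + c * v x) (\<lambda>x. G x + c *\<^sub>R V x)"
    unfolding weak_grad_def
  proof (intro allI impI)
    fix \<phi> assume \<phi>: "test_function \<Omega> \<phi>"
    have i: "integrable M (\<lambda>x. u x *\<^sub>R grad \<phi> x)" "integrable M (\<lambda>x. v x *\<^sub>R grad \<phi> x)"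
      "integrable M (\<lambda>x. \<phi> x *\<^sub>R G x)" "integrable M (\<lambda>x. \<phi> x *\<^sub>R V x)"
      using integrable_test[OF \<phi>] u v by (auto simp: H1_on_iff)
    have e: "(LINT x|M. u x *\<^sub>R grad \<phi> x) = - (LINT x|M. \<phi> x *\<^sub>R G x)"
      "(LINT x|M. v x *\<^sub>R grad \<phi> x) = - (LINT x|M. \<phi> x *\<^sub>R V x)"
      using u v \<phi> by (auto simp: H1_on_iff weak_grad_def)
    have "(LINT x|M. (u x + c * v x) *\<^sub>R grad \<phi> x) = (LINT x|M. u x *\<^sub>R grad \<phi> x + c *\<^sub>R (v x *\<^sub>R grad \<phi> x))"
      by (simp add: scaleR_add_left)
    also have "\<dots> = - (LINT x|M. \<phi> x *\<^sub>R G x) + c *\<^sub>R (- (LINT x|M. \<phi> x *\<^sub>R V x))"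
      using i by (simp add: e del: scaleR_scaleR)
    also have "\<dots> = - (LINT x|M. \<phi> x *\<^sub>R G x + c *\<^sub>R (\<phi> x *\<^sub>R V x))"
      using i by (simp del: scaleR_scaleR)
    also have "\<dots> = - (LINT x|M. \<phi> x *\<^sub>R (G x + c *\<^sub>R V x))"
      by (simp add: scaleR_add_right mult.commute)
    finally show "(LINT x|M. (u x + c * v x) *\<^sub>R grad \<phi> x) = - (LINT x|M. \<phi> x *\<^sub>R (G x + c *\<^sub>R V x))" .
  qed
qed

lemma H1_on_smooth:
  assumes "smooth_on UNIV \<psi>"
  shows "H1_on \<Omega> \<psi> (grad \<psi>)"
  unfolding H1_on_iff
  using assms smooth_on_UNIV_continuous smooth_on_UNIV_grad_continuous
  by (auto intro!: sq_integrable_continuous weak_grad_smooth sets_\<Omega>)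

text \<open>\<open>s\<close> times a test function is again a test function, so the weak gradient of
  \<open>v\<close> can be tested with it. The lemma is what allows the Gaussian weight to be moved
  between the integrand and the test function.\<close>

lemma H1_on_mult_smooth:
  assumes v: "H1_on \<Omega> v V" and s: "smooth_on UNIV s"
  shows "H1_on \<Omega> (\<lambda>x. s x * v x) (\<lambda>x. s x *\<^sub>R V x + v x *\<^sub>R grad s x)"
  unfolding H1_on_iff
proof (intro conjI)
  note c = smooth_on_UNIV_continuous[OF s] smooth_on_UNIV_grad_continuous[OF s]
  show "sq_integrable M (\<lambda>x. s x * v x)"
    using sq_integrable_continuous_scaleR[OF c(1), of v] v by (simp add: H1_on_iff)
  show "sq_integrable M (\<lambda>x. s x *\<^sub>R V x + v x *\<^sub>R grad s x)"
    using v c by (intro sq_integrable_add sq_integrable_continuous_scaleR sq_integrable_scaleR_continuous) (auto simp: H1_on_iff)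
  show "weak_grad \<Omega> (\<lambda>x. s x * v x) (\<lambda>x. s x *\<^sub>R V x + v x *\<^sub>R grad s x)"
    unfolding weak_grad_def
  proof (intro allI impI)
    fix \<phi> assume \<phi>: "test_function \<Omega> \<phi>"
    note s\<phi> = test_function_mult[OF \<phi> s]
    have vsq: "sq_integrable M v" "sq_integrable M V" using v by (auto simp: H1_on_iff)
    have "integrable M (\<lambda>x. \<phi> x *\<^sub>R (v x *\<^sub>R grad s x))"
      by (intro integrable_test(2)[OF \<phi>] sq_integrable_scaleR_continuous c vsq)
    note i = integrable_test(1)[OF s\<phi> vsq(1)] integrable_test(2)[OF s\<phi> vsq(2)] this
    have e: "(LINT x|M. v x *\<^sub>R grad (\<lambda>x. s x * \<phi> x) x) = - (LINT x|M. (s x * \<phi> x) *\<^sub>R V x)"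
      using v s\<phi> by (auto simp: H1_on_iff weak_grad_def)
    have "(LINT x|M. (s x * v x) *\<^sub>R grad \<phi> x) = (LINT x|M. v x *\<^sub>R grad (\<lambda>x. s x * \<phi> x) x - \<phi> x *\<^sub>R (v x *\<^sub>R grad s x))"
      unfolding grad_mult[OF s test_function_facts(1)[OF \<phi>]] by (simp add: scaleR_add_right mult.commute)
    also have "\<dots> = - (LINT x|M. (s x * \<phi> x) *\<^sub>R V x) - (LINT x|M. \<phi> x *\<^sub>R (v x *\<^sub>R grad s x))"
      unfolding e[symmetric] by (rule Bochner_Integration.integral_diff[OF i(1,3)])
    also have "\<dots> = - (LINT x|M. (s x * \<phi> x) *\<^sub>R V x + \<phi> x *\<^sub>R (v x *\<^sub>R grad s x))"
      by (subst Bochner_Integration.integral_add[OF i(2,3)]) simp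
    also have "\<dots> = - (LINT x|M. \<phi> x *\<^sub>R (s x *\<^sub>R V x + v x *\<^sub>R grad s x))"
      by (simp add: scaleR_add_right mult.commute)
    finally show "(LINT x|M. (s x * v x) *\<^sub>R grad \<phi> x) = - (LINT x|M. \<phi> x *\<^sub>R (s x *\<^sub>R V x + v x *\<^sub>R grad s x))" .
  qed
qed

text \<open>The weak gradient is a closed operator: both sides of its defining identity are inner
  products with fixed square integrable functions. Components are taken because the limit theorem
  concerns scalar products.\<close>

lemma H1_on_limit:
  assumes H: "\<And>n. H1_on \<Omega> (u n) (G n)" and u: "L2_tendsto M u u'" and G: "L2_tendsto M G G'"
  shows "H1_on \<Omega> u' G'"
  unfolding H1_on_iff
proof (intro conjI)
  show sq: "sq_integrable M u'" "sq_integrable M G'" using u G by (auto simp: L2_tendsto_def)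
  have sqn: "sq_integrable M (u n)" "sq_integrable M (G n)" for n using u G by (auto simp: L2_tendsto_def)
  show "weak_grad \<Omega> u' G'"
    unfolding weak_grad_def
  proof (intro allI impI)
    fix \<phi> assume \<phi>: "test_function \<Omega> \<phi>"
    note t = test_function_facts(1)[OF \<phi>]
    show "(LINT x|M. u' x *\<^sub>R grad \<phi> x) = - (LINT x|M. \<phi> x *\<^sub>R G' x)"
    proof (rule euclidean_eqI)
      fix i :: 'a assume "i \<in> Basis"
      have c: "sq_integrable M (\<lambda>x. grad \<phi> x \<bullet> i)" "sq_integrable M (\<lambda>x. \<phi> x *\<^sub>R i)"
        by (intro sq_integrable_continuous continuous_intros smooth_on_UNIV_continuous smooth_on_UNIV_grad_continuous t)+
      have 1: "(\<lambda>n. LINT x|M. u n x \<bullet> (grad \<phi> x \<bullet> i)) \<longlonglongrightarrow> (LINT x|M. u' x \<bullet> (grad \<phi> x \<bullet> i))"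
        by (intro L2_tendsto_inner u L2_tendsto_const c)
      have 2: "(\<lambda>n. - (LINT x|M. G n x \<bullet> (\<phi> x *\<^sub>R i))) \<longlonglongrightarrow> - (LINT x|M. G' x \<bullet> (\<phi> x *\<^sub>R i))"
        by (intro tendsto_minus L2_tendsto_inner G L2_tendsto_const c)
      have e: "(LINT x|M. w x *\<^sub>R grad \<phi> x) \<bullet> i = (LINT x|M. w x \<bullet> (grad \<phi> x \<bullet> i))"
        "(- (LINT x|M. \<phi> x *\<^sub>R W x)) \<bullet> i = - (LINT x|M. W x \<bullet> (\<phi> x *\<^sub>R i))"
        if "sq_integrable M w" "sq_integrable M W" for w W
        using integral_inner_left[OF integrable_test(1)[OF \<phi> that(1)], of i]
          integral_inner_left[OF integrable_test(2)[OF \<phi> that(2)], of i]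
        by (simp_all add: inner_commute)
      have "(LINT x|M. u n x *\<^sub>R grad \<phi> x) = - (LINT x|M. \<phi> x *\<^sub>R G n x)" for n
        using H \<phi> by (auto simp: H1_on_iff weak_grad_def)
      then have "(LINT x|M. u n x \<bullet> (grad \<phi> x \<bullet> i)) = - (LINT x|M. G n x \<bullet> (\<phi> x *\<^sub>R i))" for n
        using e[OF sqn] by metis
      then have "(LINT x|M. u' x \<bullet> (grad \<phi> x \<bullet> i)) = - (LINT x|M. G' x \<bullet> (\<phi> x *\<^sub>R i))"
        using LIMSEQ_unique[OF 1] 2 by simp
      then show "(LINT x|M. u' x *\<^sub>R grad \<phi> x) \<bullet> i = (- (LINT x|M. \<phi> x *\<^sub>R G' x)) \<bullet> i"
        using e[OF sq] by simp
    qed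
  qed
qed

end

section \<open>Mollification and the Poincare inequality in the Sobolev space\<close>

lemma sq_integrable_lebesgue_on_subset:
  fixes f :: "'a::euclidean_space \<Rightarrow> 'b::euclidean_space"
  assumes f: "sq_integrable (lebesgue_on \<Omega>) f" and C: "C \<subseteq> \<Omega>" "C \<in> sets lebesgue" and \<Omega>: "\<Omega> \<in> sets lebesgue"
  shows "sq_integrable (lebesgue_on C) f"
    "(LINT x|lebesgue_on C. (norm (f x))\<^sup>2) \<le> (LINT x|lebesgue_on \<Omega>. (norm (f x))\<^sup>2)"
proof -
  have m: "f \<in> borel_measurable (lebesgue_on C)"
    using measurable_restrict_mono[OF sq_integrable_measurable[OF f] C(1)] .
  have i: "integrable lebesgue (\<lambda>x. indicator \<Omega> x *\<^sub>R (norm (f x))\<^sup>2)"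
    using f \<Omega> by (simp add: sq_integrable_def integrable_restrict_space)
  have e: "indicator C x *\<^sub>R (indicator \<Omega> x *\<^sub>R (norm (f x))\<^sup>2) = indicator C x *\<^sub>R (norm (f x))\<^sup>2" for x
    using C by (auto simp: indicator_def)
  have iC: "integrable lebesgue (\<lambda>x. indicator C x *\<^sub>R (norm (f x))\<^sup>2)"
    using integrable_mult_indicator[OF C(2) i] by (simp only: e)
  then show "sq_integrable (lebesgue_on C) f"
    using C m by (simp add: sq_integrable_def integrable_restrict_space)
  show "(LINT x|lebesgue_on C. (norm (f x))\<^sup>2) \<le> (LINT x|lebesgue_on \<Omega>. (norm (f x))\<^sup>2)"
    using C \<Omega> by (simp only: integral_restrict_space sets.Int_space_eq2 sets.Int)
      (rule integral_mono[OF iC i]; auto simp: indicator_def)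
qed

lemma integral_lebesgue_on_eq_lborel:
  fixes f :: "'a::euclidean_space \<Rightarrow> real"
  assumes "C \<in> sets borel" "f \<in> borel_measurable borel"
  shows "(LINT x|lebesgue_on C. f x) = (LINT x|lborel. indicator C x * f x)"
  using assms by (simp add: integral_restrict_space integral_completion)

text \<open>Two approximations of squared error below \<open>e / 4\<close> each: first
  \<open>v\<close> is clipped at a height \<open>K\<close>, then the clipped function is
  approximated by continuous functions with the same bound.\<close>

lemma (in bounded_domain) L2_dense_continuous:
  fixes v :: "'a \<Rightarrow> real"
  assumes v: "sq_integrable M v" and e: "0 < e"
  obtains w where "continuous_on UNIV w" "(LINT x|M. (v x - w x)\<^sup>2) < e"
proof -
  define clip :: "real \<Rightarrow> real \<Rightarrow> real" where "clip K s = max (- K) (min K s)" for K s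
  have clip_cont: "continuous_on UNIV (clip K)" for K unfolding clip_def by (intro continuous_intros)
  have vm[measurable]: "v \<in> borel_measurable M" using v by (rule sq_integrable_measurable)
  have cm[measurable]: "clip K \<in> borel_measurable borel" for K
    using clip_cont by (rule borel_measurable_continuous_onI)
  have "(\<lambda>n. LINT x|M. (v x - clip (real n) (v x))\<^sup>2) \<longlonglongrightarrow> (LINT x|M. 0)"
  proof (rule integral_dominated_convergence)
    show "integrable M (\<lambda>x. (norm (v x))\<^sup>2)" using v by (simp add: sq_integrable_def)
    show "AE x in M. norm ((v x - clip (real n) (v x))\<^sup>2) \<le> (norm (v x))\<^sup>2" for n
      by (intro AE_I2) (auto simp: clip_def abs_le_square_iff[symmetric])
    show "AE x in M. (\<lambda>n. (v x - clip (real n) (v x))\<^sup>2) \<longlonglongrightarrow> 0"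
    proof (intro AE_I2 tendsto_eventually)
      fix x
      obtain N where "\<bar>v x\<bar> \<le> real N" using real_arch_simple by blast
      then show "\<forall>\<^sub>F n in sequentially. (v x - clip (real n) (v x))\<^sup>2 = 0"
        by (auto simp: eventually_sequentially clip_def intro!: exI[of _ N])
    qed
  qed auto
  then have "\<forall>\<^sub>F n in sequentially. (LINT x|M. (v x - clip (real n) (v x))\<^sup>2) < e/4"
    using e by (intro order_tendstoD(2)[where y=0]) auto
  then obtain K where K: "(LINT x|M. (v x - clip (real K) (v x))\<^sup>2) < e/4"
    by (auto simp: eventually_sequentially)
  \<comment> \<open>By definition this supplies continuous functions converging to \<open>v\<close>
    off a negligible set. Nothing bounds them, so they are clipped at the height \<open>K\<close>
    too, which makes dominated convergence applicable.\<close>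
  have "v measurable_on \<Omega>" using measurable_on_iff_borel_measurable[OF sets_\<Omega>(1)] vm by blast
  then obtain N g where N: "negligible N" and g: "\<And>n. continuous_on UNIV (g n)"
    "\<And>x. x \<notin> N \<Longrightarrow> (\<lambda>n. g n x) \<longlonglongrightarrow> (if x \<in> \<Omega> then v x else 0)"
    unfolding measurable_on_def by blast
  define w where "w n x = clip (real K) (g n x)" for n x
  have wc: "continuous_on UNIV (w n)" for n
    unfolding w_def by (rule continuous_on_compose2[OF clip_cont g(1)]) auto
  have wm[measurable]: "w n \<in> borel_measurable M" for n using wc by (rule measurable_lebesgue_on_continuous)
  have AEN: "AE x in M. x \<notin> N"
  proof -
    have "AE x in lebesgue. x \<notin> N" using N by (simp add: negligible_iff_null_sets AE_not_in)
    then show ?thesis by (subst AE_restrict_space_iff) (auto simp: sets_\<Omega> elim: eventually_mono)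
  qed
  have "(\<lambda>n. LINT x|M. (clip (real K) (v x) - w n x)\<^sup>2) \<longlonglongrightarrow> (LINT x|M. 0)"
  proof (rule integral_dominated_convergence)
    show "integrable M (\<lambda>x. (2 * real K)\<^sup>2)" by simp
    have "\<bar>clip (real K) a - clip (real K) b\<bar> \<le> \<bar>2 * real K\<bar>" for a b by (auto simp: clip_def)
    then have "(clip (real K) a - clip (real K) b)\<^sup>2 \<le> (2 * real K)\<^sup>2" for a b
      unfolding abs_le_square_iff .
    then show "AE x in M. norm ((clip (real K) (v x) - w n x)\<^sup>2) \<le> (2 * real K)\<^sup>2" for n
      unfolding w_def by (intro AE_I2) simp
    show "AE x in M. (\<lambda>n. (clip (real K) (v x) - w n x)\<^sup>2) \<longlonglongrightarrow> 0"
      using AEN AE_space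
    proof eventually_elim
      case (elim x)
      then have "(\<lambda>n. g n x) \<longlonglongrightarrow> v x" using g(2)[of x] by simp
      then have "(\<lambda>n. w n x) \<longlonglongrightarrow> clip (real K) (v x)"
        unfolding w_def by (intro continuous_on_tendsto_compose[OF clip_cont]) auto
      then have "(\<lambda>n. (clip (real K) (v x) - w n x)\<^sup>2) \<longlonglongrightarrow> (clip (real K) (v x) - clip (real K) (v x))\<^sup>2"
        by (intro tendsto_intros)
      then show ?case by simp
    qed
  qed auto
  then have "\<forall>\<^sub>F n in sequentially. (LINT x|M. (clip (real K) (v x) - w n x)\<^sup>2) < e/4"
    using e by (intro order_tendstoD(2)[where y=0]) auto
  then obtain n where n: "(LINT x|M. (clip (real K) (v x) - w n x)\<^sup>2) < e/4"
    by (auto simp: eventually_sequentially)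
  have sqc: "sq_integrable M (\<lambda>x. clip (real K) (v x))"
    by (rule sq_integrable_bounded[where K="real K"]) (auto simp: clip_def finite_measure_axioms)
  have sqw: "sq_integrable M (w n)" using wc by (rule sq_integrable_continuous)
  have i: "integrable M (\<lambda>x. (v x - clip (real K) (v x))\<^sup>2)" "integrable M (\<lambda>x. (clip (real K) (v x) - w n x)\<^sup>2)"
    "integrable M (\<lambda>x. (v x - w n x)\<^sup>2)"
    using sq_integrable_diff[OF v sqc] sq_integrable_diff[OF sqc sqw] sq_integrable_diff[OF v sqw]
    by (auto simp: sq_integrable_def)
  have "(LINT x|M. (v x - w n x)\<^sup>2) \<le> (LINT x|M. 2 * (v x - clip (real K) (v x))\<^sup>2 + 2 * (clip (real K) (v x) - w n x)\<^sup>2)"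
  proof (rule integral_mono)
    fix x
    have "(a - c)\<^sup>2 \<le> 2 * (a - b)\<^sup>2 + 2 * (b - c)\<^sup>2" for a b c :: real
      using zero_le_power2[of "(a - b) - (b - c)"] by (simp add: power2_eq_square algebra_simps)
    then show "(v x - w n x)\<^sup>2 \<le> 2 * (v x - clip (real K) (v x))\<^sup>2 + 2 * (clip (real K) (v x) - w n x)\<^sup>2" .
  qed (use i in auto)
  also have "\<dots> < e" using K n i by simp
  finally show thesis using that[OF wc] by blast
qed

lemma bump_translate: "bump \<epsilon> a z = bump \<epsilon> 0 (a - z)"
  by (simp add: bump_def norm_minus_commute)

lemma continuous_on_bump: "continuous_on UNIV (bump \<epsilon> a)"
  by (rule smooth_on_UNIV_continuous[OF smooth_bump])

lemma borel_measurable_bump[measurable]: "bump \<epsilon> a \<in> borel_measurable borel"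
  by (rule borel_measurable_continuous_onI[OF continuous_on_bump])

lemma bump_eq_0: "0 < \<epsilon> \<Longrightarrow> z \<notin> cball a \<epsilon> \<Longrightarrow> bump \<epsilon> a z = 0"
  by (metis bump_eq_0_iff ball_subset_cball subsetD)

definition bump_mass :: "'a::euclidean_space itself \<Rightarrow> real \<Rightarrow> real" where
  "bump_mass _ \<epsilon> = (LINT z|lborel. bump \<epsilon> (0::'a) z)"

lemma integrable_bump:
  assumes "0 < \<epsilon>"
  shows "integrable lborel (bump \<epsilon> (a::'a::euclidean_space))"
  by (rule integral_lebesgue_on_compact_support(1)[where K="cball a \<epsilon>" and \<Omega>=UNIV])
     (use bump_eq_0[OF assms] in \<open>auto simp: continuous_on_bump\<close>)

lemma bump_mass_pos:
  assumes "0 < \<epsilon>"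
  shows "0 < bump_mass TYPE('a::euclidean_space) \<epsilon>"
proof -
  have "bump_mass TYPE('a) \<epsilon> \<noteq> 0"
  proof
    assume "bump_mass TYPE('a) \<epsilon> = 0"
    then have "AE z in lborel. bump \<epsilon> (0::'a) z = 0"
      unfolding bump_mass_def
      using integral_nonneg_eq_0_iff_AE[OF integrable_bump[OF assms, of "0::'a"]] by (simp add: bump_nonneg)
    then have "AE z in lborel. z \<notin> ball (0::'a) \<epsilon>"
      using bump_eq_0_iff[OF assms, of "0::'a"] by auto
    then have "ball (0::'a) \<epsilon> \<in> null_sets lborel"
      by (subst (asm) AE_iff_null) (auto simp: ball_def)
    then have "negligible (ball (0::'a) \<epsilon>)"
      by (metis negligible_iff_null_sets null_sets_completionI)
    then show False using open_not_negligible[of "ball (0::'a) \<epsilon>"] assms by simp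
  qed
  moreover have "0 \<le> bump_mass TYPE('a) \<epsilon>" unfolding bump_mass_def by (simp add: bump_nonneg)
  ultimately show ?thesis by simp
qed

text \<open>Here the centre varies and the argument is fixed: the substitution has Jacobian
  \<open>t ^ DIM('a)\<close>. It is the second half of a Fubini estimate for the
  mollification.\<close>

lemma nn_integral_bump_affine:
  fixes b z :: "'a::euclidean_space"
  assumes "0 < \<epsilon>" "0 < t"
  shows "(\<integral>\<^sup>+x. ennreal (bump \<epsilon> (b + t *\<^sub>R x) z) \<partial>lborel) = ennreal (bump_mass TYPE('a) \<epsilon> / t ^ DIM('a))"
proof -
  have "ennreal (bump_mass TYPE('a) \<epsilon>) = (\<integral>\<^sup>+x. ennreal (bump \<epsilon> 0 x) \<partial>(lborel :: 'a measure))"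
    unfolding bump_mass_def using integrable_bump[OF assms(1)] by (intro nn_integral_eq_integral[symmetric]) (auto simp: bump_nonneg)
  also have "\<dots> = (\<integral>\<^sup>+x. ennreal (bump \<epsilon> 0 x) \<partial>density (distr lborel borel (\<lambda>x. (b - z) + t *\<^sub>R x)) (\<lambda>_. ennreal (\<bar>t\<bar> ^ DIM('a))))"
    using lborel_affine[of t "b - z"] assms by simp
  also have "\<dots> = ennreal (t ^ DIM('a)) * (\<integral>\<^sup>+x. ennreal (bump \<epsilon> 0 ((b - z) + t *\<^sub>R x)) \<partial>lborel)"
    using assms by (simp add: nn_integral_density nn_integral_distr nn_integral_cmult)
  also have "(\<integral>\<^sup>+x. ennreal (bump \<epsilon> 0 ((b - z) + t *\<^sub>R x)) \<partial>lborel) = (\<integral>\<^sup>+x. ennreal (bump \<epsilon> (b + t *\<^sub>R x) z) \<partial>lborel)"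
    by (intro nn_integral_cong) (simp add: bump_translate[of \<epsilon> _ z] algebra_simps)
  finally have "ennreal (1 / t ^ DIM('a)) * ennreal (bump_mass TYPE('a) \<epsilon>)
    = ennreal (1 / t ^ DIM('a)) * ennreal (t ^ DIM('a)) * (\<integral>\<^sup>+x. ennreal (bump \<epsilon> (b + t *\<^sub>R x) z) \<partial>lborel)"
    by (simp add: mult.assoc)
  also have "ennreal (1 / t ^ DIM('a)) * ennreal (t ^ DIM('a)) = 1"
    using assms by (simp flip: ennreal_mult)
  finally show ?thesis using assms bump_mass_pos[OF assms(1), where 'a='a] by (simp flip: ennreal_mult)
qed

lemma tendsto_zeroI_le:
  fixes a :: "nat \<Rightarrow> real"
  assumes "\<And>k. 0 \<le> a k" "\<And>e. 0 < e \<Longrightarrow> \<forall>\<^sub>F k in sequentially. a k \<le> e"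
  shows "a \<longlonglongrightarrow> 0"
proof (rule order_tendstoI)
  fix e :: real assume "0 < e"
  then have "\<forall>\<^sub>F k in sequentially. a k \<le> e / 2" by (intro assms(2)) simp
  then show "\<forall>\<^sub>F k in sequentially. a k < e" by eventually_elim (use \<open>0 < e\<close> in simp)
next
  fix e :: real assume "e < 0"
  then show "\<forall>\<^sub>F k in sequentially. e < a k" using assms(1) by (auto intro: always_eventually less_le_trans)
qed

text \<open>\<open>C\<close> is separate from \<Omega> because weak gradients are tested on the open
  set \<Omega>, while the inequality is wanted on a convex part such as a grid cell, which need not
  be open. \<open>p\<close> with its ball is the centre of contraction.\<close>

locale convex_piece = bounded_domain \<Omega> for \<Omega> :: "'a::euclidean_space set" +
  fixes C :: "'a set" and p :: 'a and R :: real and D :: real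
  assumes C_subset: "C \<subseteq> \<Omega>" and convex_C: "convex C" and borel_C: "C \<in> sets borel"
    and R_pos: "0 < R" and ball_C: "ball p R \<subseteq> C" and \<Omega>_D: "\<Omega> \<subseteq> cball 0 D"
begin

abbreviation "MC \<equiv> lebesgue_on C"

text \<open>
  \<open>moll k v\<close> is the mollification at scale \<open>em k\<close> of the dilation of \<open>v\<close> by \<open>tm k < 1\<close> about \<open>p\<close>.
  Since \<open>em k < R (1 - tm k)\<close>, the kernel at a point of \<open>C\<close> is supported in \<open>C\<close>, so it is a test
  function and no extension of \<open>v\<close> is needed.
\<close>

definition tm :: "nat \<Rightarrow> real" where "tm k = 1 - 1 / (real k + 2)"
definition em :: "nat \<Rightarrow> real" where "em k = R / (2 * (real k + 2))"
definition am :: "nat \<Rightarrow> 'a \<Rightarrow> 'a" where "am k x = (1 - tm k) *\<^sub>R p + tm k *\<^sub>R x"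
definition moll :: "nat \<Rightarrow> ('a \<Rightarrow> real) \<Rightarrow> 'a \<Rightarrow> real" where
  "moll k v x = (LINT z|M. bump (em k) (am k x) z * v z) / bump_mass TYPE('a) (em k)"

lemma tm: "1/2 \<le> tm k" "tm k < 1" "0 < tm k" and em: "0 < em k" "em k < R * (1 - tm k)"
  using R_pos by (auto simp: tm_def em_def field_simps intro!: add_nonneg_pos)

lemma mass_pos: "0 < bump_mass TYPE('a) (em k)"
  using em(1) by (rule bump_mass_pos)

lemma bounded_C: "bounded C" using bounded_\<Omega> C_subset by (rule bounded_subset)

lemma lmeasurable_C: "C \<in> lmeasurable" "C \<in> sets lebesgue"
  using bounded_set_imp_lmeasurable[OF bounded_C] borel_C by auto

lemma finite_measure_MC: "finite_measure MC"
  using lmeasurable_C(1) by (rule finite_measure_lebesgue_on)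

text \<open>A point of the small ball is a convex combination of \<open>x\<close> and a point
  \<open>q\<close>: the displacement from \<open>am k x\<close>, magnified by the factor
  \<open>1 / (1 - tm k)\<close>, stays below \<open>R\<close>, so \<open>q\<close> lies in the ball
  around \<open>p\<close>.\<close>

lemma cball_am:
  assumes "x \<in> C" shows "cball (am k x) (em k) \<subseteq> C"
proof
  fix y assume y: "y \<in> cball (am k x) (em k)"
  define q where "q = p + (1 / (1 - tm k)) *\<^sub>R (y - am k x)"
  have t: "0 < 1 - tm k" using tm by simp
  have "norm (y - am k x) < R * (1 - tm k)" using y em(2)[of k] by (auto simp: dist_norm norm_minus_commute)
  moreover have "dist p q = norm (y - am k x) / (1 - tm k)"
    using t by (simp add: q_def dist_norm)
  ultimately have "dist p q < R" using t by (simp add: pos_divide_less_eq)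
  then have "q \<in> C" using ball_C by auto
  then have "(1 - tm k) *\<^sub>R q + tm k *\<^sub>R x \<in> C"
    using convexD[OF convex_C, of q x "1 - tm k" "tm k"] assms t tm(3)[of k] by simp
  also have "(1 - tm k) *\<^sub>R q + tm k *\<^sub>R x = y"
  proof -
    have "(1 - tm k) *\<^sub>R q = (1 - tm k) *\<^sub>R p + (y - am k x)" using t by (simp add: q_def scaleR_add_right)
    then show ?thesis by (simp add: am_def)
  qed
  finally show "y \<in> C" .
qed

lemma test_function_am:
  assumes "x \<in> C" shows "test_function \<Omega> (bump (em k) (am k x))"
  using cball_am[OF assms] C_subset by (intro test_function_bump em) auto

lemma integral_bump_am:
  assumes "x \<in> C" shows "(LINT z|M. bump (em k) (am k x) z) = bump_mass TYPE('a) (em k)"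
proof -
  have "(LINT z|M. bump (em k) (am k x) z) = (LINT z|lborel. bump (em k) (am k x) z)"
    using cball_am[OF assms, of k] C_subset bump_eq_0[OF em(1), of _ "am k x" k]
    by (intro integral_lebesgue_on_compact_support(3)[where K="cball (am k x) (em k)"])
       (auto simp: continuous_on_bump sets_\<Omega>)
  moreover have "ennreal (LINT z|lborel. bump (em k) (am k x) z) = ennreal (bump_mass TYPE('a) (em k))"
  proof -
    have "ennreal (LINT z|lborel. bump (em k) (am k x) z) = (\<integral>\<^sup>+z. ennreal (bump (em k) (am k x) z) \<partial>lborel)"
      using integrable_bump[OF em(1)] by (intro nn_integral_eq_integral[symmetric]) (auto simp: bump_nonneg)
    also have "\<dots> = (\<integral>\<^sup>+z. ennreal (bump (em k) (0 + 1 *\<^sub>R z) (am k x)) \<partial>lborel)"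
      by (intro nn_integral_cong) (simp add: bump_def norm_minus_commute)
    finally show ?thesis by (subst (asm) nn_integral_bump_affine) (use em in auto)
  qed
  ultimately show ?thesis
    using mass_pos[of k] by (simp add: ennreal_inj bump_nonneg integral_nonneg_AE)
qed

lemma bump_am_measurable: "(\<lambda>(x, z). bump (em k) (am k x) z) \<in> borel_measurable (borel \<Otimes>\<^sub>M borel)"
proof -
  have "continuous_on UNIV (\<lambda>u. bump (em k) 0 (am k (fst u) - snd u))"
    unfolding am_def by (intro continuous_on_compose2[OF continuous_on_bump[of "em k" 0]] continuous_intros) auto
  then have "(\<lambda>u. bump (em k) 0 (am k (fst u) - snd u)) \<in> borel_measurable borel"
    by (rule borel_measurable_continuous_onI)
  then show ?thesis
    by (simp add: borel_prod split_def bump_translate[of "em k" "am k _"])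
qed

lemma id_measurable: "(\<lambda>x. x) \<in> measurable (lebesgue_on S) (borel :: 'a measure)"
  by (intro measurable_restrict_space1 measurable_completion) simp

lemma moll_integrand_measurable:
  assumes v: "v \<in> borel_measurable M" and N: "(\<lambda>x. x) \<in> measurable N borel"
  shows "(\<lambda>(x, z). bump (em k) (am k x) z * v z) \<in> borel_measurable (N \<Otimes>\<^sub>M M)"
proof -
  have "(\<lambda>u. (fst u, snd u)) \<in> measurable (N \<Otimes>\<^sub>M M) (borel \<Otimes>\<^sub>M borel)"
    by (intro measurable_Pair measurable_compose[OF measurable_fst N] measurable_compose[OF measurable_snd id_measurable])
  from measurable_compose[OF this bump_am_measurable]
  have "(\<lambda>u. bump (em k) (am k (fst u)) (snd u)) \<in> borel_measurable (N \<Otimes>\<^sub>M M)" by (simp add: split_def)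
  then show ?thesis using measurable_compose[OF measurable_snd v, of N] by (simp add: split_def)
qed

lemma moll_measurable: "v \<in> borel_measurable M \<Longrightarrow> moll k v \<in> borel_measurable borel"
  unfolding moll_def
  using borel_measurable_lebesgue_integral[OF moll_integrand_measurable[of v borel k]] by simp

lemma sq_integrable_bump_mult: "sq_integrable M v \<Longrightarrow> sq_integrable M (\<lambda>z. bump \<epsilon> a z * v z)"
  using sq_integrable_continuous_scaleR[OF continuous_on_bump, of v] by simp

lemma integrable_bump_mult: "sq_integrable M v \<Longrightarrow> integrable M (\<lambda>z. bump \<epsilon> a z * v z)"
  by (intro sq_integrable_integrable finite_measure_axioms sq_integrable_bump_mult)

lemma moll_diff:
  "sq_integrable M v \<Longrightarrow> sq_integrable M w \<Longrightarrow> moll k (\<lambda>x. v x - w x) x = moll k v x - moll k w x"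
  by (simp add: moll_def right_diff_distrib integrable_bump_mult diff_divide_distrib)

text \<open>Jensen's inequality for the normalised kernel, from Cauchy-Schwarz with the kernel split
  into two square roots. The kernel has full mass in \<Omega> because \<open>x\<close> lies in
  \<open>C\<close>.\<close>

lemma moll_square_le:
  assumes v: "sq_integrable M v" and x: "x \<in> C"
  shows "(moll k v x)\<^sup>2 \<le> (LINT z|M. bump (em k) (am k x) z * (v z)\<^sup>2) / bump_mass TYPE('a) (em k)"
proof -
  let ?b = "bump (em k) (am k x)" and ?c = "bump_mass TYPE('a) (em k)"
  have b: "continuous_on UNIV (\<lambda>z. sqrt (?b z))" by (intro continuous_intros continuous_on_bump)
  have "(LINT z|M. sqrt (?b z) \<bullet> (sqrt (?b z) *\<^sub>R v z))\<^sup>2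
    \<le> (LINT z|M. (norm (sqrt (?b z)))\<^sup>2) * (LINT z|M. (norm (sqrt (?b z) *\<^sub>R v z))\<^sup>2)"
    by (intro Cauchy_Schwarz_integral sq_integrable_continuous sq_integrable_continuous_scaleR b v)
  also have "(LINT z|M. sqrt (?b z) \<bullet> (sqrt (?b z) *\<^sub>R v z)) = (LINT z|M. ?b z * v z)"
    by (simp add: bump_nonneg flip: mult.assoc)
  also have "(LINT z|M. (norm (sqrt (?b z)))\<^sup>2) = ?c"
    using integral_bump_am[OF x, of k] by (simp add: bump_nonneg)
  also have "(LINT z|M. (norm (sqrt (?b z) *\<^sub>R v z))\<^sup>2) = (LINT z|M. ?b z * (v z)\<^sup>2)"
    by (simp add: bump_nonneg power_mult_distrib)
  finally show ?thesis
    using mass_pos[of k] by (simp add: moll_def power_divide power2_eq_square[of ?c] field_simps)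
qed

text \<open>After Fubini the kernel is integrated over its centre, which yields the inverse of
  \<open>tm k ^ DIM('a)\<close>. As \<open>tm k\<close> is at least 1/2, the operator norms are
  bounded uniformly in \<open>k\<close>, which is what the density argument needs.\<close>

lemma moll_L2_bound:
  assumes v: "sq_integrable M v"
  shows "(\<integral>\<^sup>+x. ennreal ((moll k v x)\<^sup>2) \<partial>MC) \<le> ennreal (2 ^ DIM('a) * (LINT z|M. (v z)\<^sup>2))"
proof -
  let ?c = "bump_mass TYPE('a) (em k)"
  note [measurable] = sq_integrable_measurable[OF v]
  interpret C: finite_measure MC by (rule finite_measure_MC)
  interpret P: pair_sigma_finite MC M ..
  have iv: "integrable M (\<lambda>z. (v z)\<^sup>2)" using v by (simp add: sq_integrable_def)
  have "(\<lambda>z. (v z)\<^sup>2) \<in> borel_measurable M" by measurable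
  from moll_integrand_measurable[OF this id_measurable]
  have [measurable]: "(\<lambda>u. bump (em k) (am k (fst u)) (snd u) * (v (snd u))\<^sup>2) \<in> borel_measurable (MC \<Otimes>\<^sub>M M)"
    by (simp add: split_def)
  have "(\<integral>\<^sup>+x. ennreal ((moll k v x)\<^sup>2) \<partial>MC) \<le> (\<integral>\<^sup>+x. \<integral>\<^sup>+z. ennreal (bump (em k) (am k x) z * (v z)\<^sup>2 / ?c) \<partial>M \<partial>MC)"
  proof (intro nn_integral_mono)
    fix x assume "x \<in> space MC"
    then have x: "x \<in> C" by simp
    have "integrable M (\<lambda>z. bump (em k) (am k x) z * (v z)\<^sup>2)"
    proof (rule Bochner_Integration.integrable_bound[OF iv])
      show "(\<lambda>z. bump (em k) (am k x) z * (v z)\<^sup>2) \<in> borel_measurable M"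
        using measurable_lebesgue_on_continuous[OF continuous_on_bump[of "em k" "am k x"], of \<Omega>] by measurable
      show "AE z in M. norm (bump (em k) (am k x) z * (v z)\<^sup>2) \<le> norm ((v z)\<^sup>2)"
        by (intro AE_I2) (simp add: abs_mult bump_nonneg bump_le_1 mult_left_le_one_le)
    qed
    then have "(\<integral>\<^sup>+z. ennreal (bump (em k) (am k x) z * (v z)\<^sup>2 / ?c) \<partial>M) = ennreal ((LINT z|M. bump (em k) (am k x) z * (v z)\<^sup>2) / ?c)"
      using mass_pos[of k] by (subst nn_integral_eq_integral) (auto simp: bump_nonneg)
    then show "ennreal ((moll k v x)\<^sup>2) \<le> (\<integral>\<^sup>+z. ennreal (bump (em k) (am k x) z * (v z)\<^sup>2 / ?c) \<partial>M)"
      using moll_square_le[OF v x, of k] by (simp add: ennreal_leI)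
  qed
  also have "\<dots> = (\<integral>\<^sup>+z. \<integral>\<^sup>+x. ennreal (bump (em k) (am k x) z * (v z)\<^sup>2 / ?c) \<partial>MC \<partial>M)"
    by (rule P.Fubini'[symmetric]) (simp add: split_def)
  also have "\<dots> \<le> (\<integral>\<^sup>+z. ennreal (2 ^ DIM('a) * (v z)\<^sup>2) \<partial>M)"
  proof (intro nn_integral_mono)
    fix z
    have bm: "(\<lambda>x. bump (em k) (am k x) z) \<in> borel_measurable borel"
      using measurable_compose[OF _ bump_am_measurable[of k], of "\<lambda>x. (x, z)" borel] by (simp add: split_def)
    have "(\<integral>\<^sup>+x. ennreal (bump (em k) (am k x) z * (v z)\<^sup>2 / ?c) \<partial>MC)
      = (\<integral>\<^sup>+x. ennreal ((v z)\<^sup>2 / ?c) * ennreal (bump (em k) (am k x) z) \<partial>MC)"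
      using mass_pos[of k] by (intro nn_integral_cong) (simp flip: ennreal_mult add: bump_nonneg mult.commute)
    also have "\<dots> = ennreal ((v z)\<^sup>2 / ?c) * (\<integral>\<^sup>+x. ennreal (bump (em k) (am k x) z) \<partial>MC)"
      using measurable_compose[OF id_measurable bm] by (intro nn_integral_cmult) simp
    also have "(\<integral>\<^sup>+x. ennreal (bump (em k) (am k x) z) \<partial>MC) \<le> (\<integral>\<^sup>+x. ennreal (bump (em k) (am k x) z) \<partial>lborel)"
      using bm borel_C lmeasurable_C(2)
      by (simp add: nn_integral_restrict_space nn_integral_completion) (auto intro!: nn_integral_mono simp: indicator_def)
    also have "\<dots> = ennreal (?c / tm k ^ DIM('a))"
      unfolding am_def using nn_integral_bump_affine[OF em(1) tm(3)] .
    also have "ennreal ((v z)\<^sup>2 / ?c) * ennreal (?c / tm k ^ DIM('a)) = ennreal ((v z)\<^sup>2 / tm k ^ DIM('a))"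
      using mass_pos[of k] tm(3)[of k] by (simp flip: ennreal_mult)
    also have "(v z)\<^sup>2 / tm k ^ DIM('a) \<le> (v z)\<^sup>2 / (1/2) ^ DIM('a)"
      using tm(1)[of k] by (intro divide_left_mono power_mono) auto
    also have "\<dots> = 2 ^ DIM('a) * (v z)\<^sup>2" by (simp add: power_one_over)
    finally show "(\<integral>\<^sup>+x. ennreal (bump (em k) (am k x) z * (v z)\<^sup>2 / ?c) \<partial>MC) \<le> ennreal (2 ^ DIM('a) * (v z)\<^sup>2)"
      by (simp add: ennreal_leI mult_left_mono)
  qed
  also have "\<dots> = ennreal (2 ^ DIM('a) * (LINT z|M. (v z)\<^sup>2))"
    using iv by (subst nn_integral_eq_integral) auto
  finally show ?thesis .
qed

lemma moll_sq_integrable: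
  assumes v: "sq_integrable M v"
  shows "sq_integrable MC (moll k v)" "(LINT x|MC. (moll k v x)\<^sup>2) \<le> 2 ^ DIM('a) * (LINT z|M. (v z)\<^sup>2)"
proof -
  have m: "moll k v \<in> borel_measurable MC"
    using measurable_compose[OF id_measurable moll_measurable[OF sq_integrable_measurable[OF v]]] .
  show sq: "sq_integrable MC (moll k v)"
    unfolding sq_integrable_def
    using m moll_L2_bound[OF v, of k] by (auto simp: integrable_iff_bounded intro: le_less_trans)
  have "ennreal (LINT x|MC. (moll k v x)\<^sup>2) \<le> ennreal (2 ^ DIM('a) * (LINT z|M. (v z)\<^sup>2))"
    using moll_L2_bound[OF v, of k] sq by (subst nn_integral_eq_integral[symmetric]) (auto simp: sq_integrable_def)
  then show "(LINT x|MC. (moll k v x)\<^sup>2) \<le> 2 ^ DIM('a) * (LINT z|M. (v z)\<^sup>2)"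
    by (subst (asm) ennreal_le_iff) auto
qed

lemma moll_uniform:
  assumes w: "continuous_on UNIV w" and \<eta>: "0 < \<eta>"
  shows "\<forall>\<^sub>F k in sequentially. \<forall>x\<in>C. \<bar>moll k w x - w x\<bar> \<le> \<eta>"
proof -
  have p: "p \<in> C" using ball_C R_pos by auto
  have "uniformly_continuous_on (cball 0 D) w"
    by (intro compact_uniformly_continuous continuous_on_subset[OF w]) auto
  then obtain d where d: "0 < d" "\<And>x z. x \<in> cball 0 D \<Longrightarrow> z \<in> cball 0 D \<Longrightarrow> dist z x < d \<Longrightarrow> dist (w z) (w x) < \<eta>"
    using \<eta> unfolding uniformly_continuous_on_def by metis
  \<comment> \<open>This bounds the distance from \<open>x\<close> to the points where the kernel
    lives: the radius contributes less than \<open>R * (1 - tm k)\<close>, the shift of the centre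
    at most \<open>2 * D * (1 - tm k)\<close>.\<close>
  have "(\<lambda>k. (R + 2 * D) * (1 / (real k + 2))) \<longlonglongrightarrow> (R + 2 * D) * 0"
    by (intro tendsto_intros) real_asymp
  then have "\<forall>\<^sub>F k in sequentially. (R + 2 * D) * (1 / (real k + 2)) < d"
    using d(1) by (intro order_tendstoD(2)) auto
  then show ?thesis
  proof eventually_elim
    case (elim k)
    show ?case
    proof
      fix x assume x: "x \<in> C"
      let ?b = "bump (em k) (am k x)" and ?c = "bump_mass TYPE('a) (em k)"
      have D: "norm y \<le> D" if "y \<in> C" for y using that C_subset \<Omega>_D by auto
      have close: "\<bar>?b z * (w z - w x)\<bar> \<le> \<eta> * ?b z" for z
      proof (cases "?b z = 0")
        case False
        then have z: "dist (am k x) z < em k" using bump_eq_0_iff[OF em(1)] by auto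
        then have zC: "z \<in> C" using cball_am[OF x, of k] by auto
        have "am k x - x = (1 - tm k) *\<^sub>R (p - x)" by (simp add: am_def algebra_simps)
        then have "norm (am k x - x) = (1 - tm k) * norm (p - x)" using tm[of k] by simp
        also have "\<dots> \<le> (1 - tm k) * (2 * D)"
          using tm[of k] D[OF p] D[OF x] norm_triangle_ineq4[of p x] by (intro mult_left_mono) auto
        finally have "norm (am k x - x) \<le> (1 - tm k) * (2 * D)" .
        moreover have "dist z x \<le> dist (am k x) z + norm (am k x - x)"
          using dist_triangle[of z x "am k x"] by (simp add: dist_commute dist_norm norm_minus_commute)
        ultimately have "dist z x < R * (1 - tm k) + (1 - tm k) * (2 * D)" using z em(2)[of k] by linarith
        also have "\<dots> = (R + 2 * D) * (1 / (real k + 2))" by (simp add: tm_def algebra_simps add_divide_distrib)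
        also have "\<dots> < d" by (rule elim)
        finally have "dist (w z) (w x) < \<eta>" using d(2)[of x z] D[OF x] D[OF zC] by simp
        then have "\<bar>w z - w x\<bar> \<le> \<eta>" by (simp add: dist_real_def)
        then have "?b z * \<bar>w z - w x\<bar> \<le> ?b z * \<eta>" by (intro mult_left_mono) (auto simp: bump_nonneg)
        then show ?thesis by (simp add: abs_mult bump_nonneg mult.commute)
      qed simp
      have sqw: "sq_integrable M w" "sq_integrable M (\<lambda>_. 1::real)" "sq_integrable M (\<lambda>z. w z - w x)"
        using w by (auto intro!: sq_integrable_continuous continuous_intros)
      have ib: "integrable M ?b" using integrable_bump_mult[OF sqw(2)] by simp
      have e: "moll k w x - w x = (LINT z|M. ?b z * (w z - w x)) / ?c"
        using integrable_bump_mult[OF sqw(1)] ib integral_bump_am[OF x, of k] mass_pos[of k]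
        by (simp add: moll_def right_diff_distrib field_simps)
      have "\<bar>LINT z|M. ?b z * (w z - w x)\<bar> \<le> (LINT z|M. \<eta> * ?b z)"
        using close ib integrable_bump_mult[OF sqw(3)]
        by (intro order_trans[OF integral_abs_bound] integral_mono) auto
      also have "\<dots> = \<eta> * ?c" using integral_bump_am[OF x, of k] by simp
      finally show "\<bar>moll k w x - w x\<bar> \<le> \<eta>"
        unfolding e using mass_pos[of k] by (simp add: field_simps)
    qed
  qed
qed

lemma moll_tendsto:
  assumes v: "sq_integrable M v"
  shows "L2_tendsto MC (\<lambda>k. moll k v) v"
  unfolding L2_tendsto_def
proof (intro conjI allI)
  interpret C: finite_measure MC by (rule finite_measure_MC)
  note sub = sq_integrable_lebesgue_on_subset[OF _ C_subset lmeasurable_C(2) sets_\<Omega>(1)]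
  show sqv: "sq_integrable MC v" by (rule sub(1)[OF v])
  show "sq_integrable MC (moll k v)" for k by (rule moll_sq_integrable(1)[OF v])
  show "(\<lambda>k. LINT x|MC. (norm (moll k v x - v x))\<^sup>2) \<longlonglongrightarrow> 0"
  proof (rule tendsto_zeroI_le)
    fix e :: real assume e: "0 < e"
    define m where "m = measure MC C"
    \<comment> \<open>Each of the two groups of error terms, before the common factor 3, becomes at
      most \<open>e / 12\<close>. The summand 1 in \<open>m + 1\<close> avoids a division by
      zero.\<close>
    define e1 where "e1 = e / (12 * (2 ^ DIM('a) + 1))"
    define \<eta> where "\<eta> = sqrt (e / (12 * (m + 1)))"
    have pos: "0 < e1" "0 < \<eta>" using e by (auto simp: e1_def \<eta>_def m_def add_nonneg_pos add_pos_nonneg)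
    obtain w where w: "continuous_on UNIV w" "(LINT x|M. (v x - w x)\<^sup>2) < e1"
      using L2_dense_continuous[OF v pos(1)] by blast
    have sqw: "sq_integrable M w" using w(1) by (rule sq_integrable_continuous)
    have sqvw: "sq_integrable M (\<lambda>x. v x - w x)" by (intro sq_integrable_diff v sqw)
    show "\<forall>\<^sub>F k in sequentially. (LINT x|MC. (norm (moll k v x - v x))\<^sup>2) \<le> e"
      using moll_uniform[OF w(1) pos(2)]
    proof eventually_elim
      case (elim k)
      have sq3: "sq_integrable MC (moll k (\<lambda>x. v x - w x))" "sq_integrable MC (\<lambda>x. moll k w x - w x)" "sq_integrable MC (\<lambda>x. v x - w x)"
        by (intro moll_sq_integrable(1) sq_integrable_diff sqvw sub(1) sqw v)+
      have sq4: "sq_integrable MC (\<lambda>x. moll k v x - v x)"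
        by (intro moll_sq_integrable(1) sq_integrable_diff sqv v)
      have "(LINT x|MC. (norm (moll k v x - v x))\<^sup>2)
        \<le> (LINT x|MC. 3 * (moll k (\<lambda>x. v x - w x) x)\<^sup>2 + 3 * (moll k w x - w x)\<^sup>2 + 3 * (v x - w x)\<^sup>2)"
      proof (rule integral_mono)
        fix x
        have "(a + b - c)\<^sup>2 \<le> 3 * a\<^sup>2 + 3 * b\<^sup>2 + 3 * c\<^sup>2" for a b c :: real
          using zero_le_power2[of "a - b"] zero_le_power2[of "a + c"] zero_le_power2[of "b + c"]
          by (simp add: power2_eq_square algebra_simps)
        from this[of "moll k (\<lambda>x. v x - w x) x" "moll k w x - w x" "v x - w x"]
        show "(norm (moll k v x - v x))\<^sup>2 \<le> 3 * (moll k (\<lambda>x. v x - w x) x)\<^sup>2 + 3 * (moll k w x - w x)\<^sup>2 + 3 * (v x - w x)\<^sup>2"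
          by (simp add: moll_diff[OF v sqw])
      qed (use sq3 sq4 in \<open>auto simp: sq_integrable_def\<close>)
      also have "\<dots> = 3 * (LINT x|MC. (moll k (\<lambda>x. v x - w x) x)\<^sup>2) + 3 * (LINT x|MC. (moll k w x - w x)\<^sup>2) + 3 * (LINT x|MC. (v x - w x)\<^sup>2)"
        using sq3 by (simp add: sq_integrable_def)
      also have "\<dots> \<le> 3 * (2 ^ DIM('a) * e1) + 3 * (\<eta>\<^sup>2 * m) + 3 * e1"
      proof (intro add_mono mult_left_mono)
        show "(LINT x|MC. (moll k (\<lambda>x. v x - w x) x)\<^sup>2) \<le> 2 ^ DIM('a) * e1"
        proof -
          have "2 ^ DIM('a) * (LINT z|M. (v z - w z)\<^sup>2) \<le> 2 ^ DIM('a) * e1"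
            using w(2) by (intro mult_left_mono) auto
          then show ?thesis using moll_sq_integrable(2)[OF sqvw, of k] by linarith
        qed
        show "(LINT x|MC. (v x - w x)\<^sup>2) \<le> e1" using sub(2)[OF sqvw] w(2) by simp
        have "(LINT x|MC. (moll k w x - w x)\<^sup>2) \<le> (LINT x|MC. \<eta>\<^sup>2)"
          using sq3 elim pos by (intro integral_mono) (auto simp: sq_integrable_def abs_le_square_iff[symmetric])
        then show "(LINT x|MC. (moll k w x - w x)\<^sup>2) \<le> \<eta>\<^sup>2 * m" by (simp add: m_def mult.commute)
      qed auto
      also have "\<dots> = 3 * (\<eta>\<^sup>2 * m) + 3 * ((2 ^ DIM('a) + 1) * e1)" by (simp add: algebra_simps)
      also have "\<dots> \<le> e"
      proof -
        have "(2 ^ DIM('a) + 1) * e1 = e / 12"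
        proof -
          have "q * (e / (12 * q)) = e / 12" if "0 < q" for q using that by simp
          from this[of "2 ^ DIM('a) + 1"] show ?thesis unfolding e1_def by (simp add: add_pos_pos)
        qed
        moreover have "\<eta>\<^sup>2 * m \<le> e / 12"
        proof -
          have m0: "0 \<le> m" by (simp add: m_def)
          have "\<eta>\<^sup>2 * m = e / 12 * (m / (m + 1))" using e m0 by (simp add: \<eta>_def)
          also have "\<dots> \<le> e / 12 * 1" using e m0 by (intro mult_left_mono) auto
          finally show ?thesis by simp
        qed
        ultimately show ?thesis using e by simp
      qed
      finally show ?case .
    qed
  qed simp
qed

text \<open>Plays the role of the gradient of \<open>moll k v\<close> on \<open>C\<close> when
  \<open>V\<close> is the weak gradient of \<open>v\<close>. The factor \<open>tm k\<close> is the
  derivative of the contraction \<open>am k\<close>.\<close>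

definition moll_grad :: "nat \<Rightarrow> ('a \<Rightarrow> 'a) \<Rightarrow> 'a \<Rightarrow> 'a" where
  "moll_grad k V x = (\<Sum>i\<in>Basis. (tm k * moll k (\<lambda>z. V z \<bullet> i) x) *\<^sub>R i)"

lemma moll_bounded:
  assumes "sq_integrable M v" shows "\<bar>moll k v x\<bar> \<le> (LINT z|M. \<bar>v z\<bar>) / bump_mass TYPE('a) (em k)"
proof -
  have iv: "integrable M v" by (rule sq_integrable_integrable[OF finite_measure_axioms assms])
  have "\<bar>LINT z|M. bump (em k) (am k x) z * v z\<bar> \<le> (LINT z|M. \<bar>v z\<bar>)"
  proof (intro order_trans[OF integral_abs_bound] integral_mono)
    show "integrable M (\<lambda>z. \<bar>bump (em k) (am k x) z * v z\<bar>)"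
      by (rule integrable_abs[OF integrable_bump_mult[OF assms]])
    show "\<bar>bump (em k) (am k x) z * v z\<bar> \<le> \<bar>v z\<bar>" for z
      by (simp add: abs_mult bump_nonneg bump_le_1 mult_left_le_one_le)
  qed (use iv in simp)
  then show ?thesis using mass_pos[of k] by (simp add: moll_def divide_right_mono)
qed

lemma sq_integrable_component: "sq_integrable N V \<Longrightarrow> sq_integrable N (\<lambda>z. V z \<bullet> (i::'c::euclidean_space))"
proof (rule sq_integrable_bound)
  fix x assume "sq_integrable N V"
  show "(norm (V x \<bullet> i))\<^sup>2 \<le> (norm i)\<^sup>2 * (norm (V x))\<^sup>2"
    using power_mono[OF Cauchy_Schwarz_ineq2[of "V x" i], of 2] by (simp add: power_mult_distrib mult.commute)
qed (auto simp: sq_integrable_def)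

text \<open>Only the kernel is expanded, with an error uniform in the integration variable;
  multiplied by \<open>v\<close> and integrated, the error remains quadratic in
  \<open>y - x\<close>. The linear term contains the gradient of the kernel, which the weak gradient
  of \<open>v\<close> absorbs.\<close>

lemma moll_Taylor:
  assumes H: "H1_on \<Omega> v V"
  obtains L where "\<And>x y. x \<in> C \<Longrightarrow> y \<in> C \<Longrightarrow>
    moll k v x + moll_grad k V x \<bullet> (y - x) - L * (norm (y - x))\<^sup>2 \<le> moll k v y"
proof -
  let ?c = "bump_mass TYPE('a) (em k)" and ?t = "tm k"
  let ?f0 = "flat (flat_poly 0)" and ?f1 = "flat (flat_poly (Suc 0))"
  have v: "sq_integrable M v" and V: "sq_integrable M V" and wg: "weak_grad \<Omega> v V" using H by (auto simp: H1_on_iff)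
  have DC: "norm y \<le> D" if "y \<in> C" for y using that C_subset \<Omega>_D by auto
  define S where "S k' x z = (em k)\<^sup>2 - (norm (z - am k' x))\<^sup>2" for k' x and z :: 'a
  have amD: "norm (am k x) \<le> D" if "x \<in> C" for x
    using subsetD[OF cball_am[OF that, of k], of "am k x"] DC[of "am k x"] em(1)[of k] by simp
  define K where "K = (em k)\<^sup>2 + (2 * D)\<^sup>2"
  have K: "0 < K" using em(1)[of k] by (simp add: K_def add_pos_nonneg)
  have zam: "norm (z - am k x) \<le> 2 * D" if "x \<in> C" "z \<in> \<Omega>" for x z
    using amD[OF that(1)] \<Omega>_D that(2) norm_triangle_ineq4[of z "am k x"] by auto
  have SK: "\<bar>S k x z\<bar> \<le> K" if "x \<in> C" "z \<in> \<Omega>" for x z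
  proof -
    have "(norm (z - am k x))\<^sup>2 \<le> (2 * D)\<^sup>2" using zam[OF that] by (intro power_mono) auto
    then show ?thesis by (simp add: S_def K_def abs_le_iff add_increasing)  (smt (verit) zero_le_power2)
  qed
  obtain L0 where L0: "0 < L0"
    "\<And>s t. \<bar>s\<bar> \<le> K \<Longrightarrow> \<bar>t\<bar> \<le> K \<Longrightarrow> \<bar>?f0 t - ?f0 s - ?f1 s * (t - s)\<bar> \<le> L0 * (t - s)\<^sup>2"
    using flat_poly_Taylor[OF K, of 0] by metis
  obtain L1 where L1: "0 < L1" "\<And>s. \<bar>s\<bar> \<le> K \<Longrightarrow> \<bar>?f1 s\<bar> \<le> L1"
    using flat_poly_Taylor[OF K, of "Suc 0"] by metis
  \<comment> \<open>\<open>S k x z\<close> is the argument of \<open>flat\<close> in the kernel. Its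
    change under a shift \<open>d\<close> of the centre is at most \<open>6 * D * norm d\<close>,
    since \<open>z - am k x\<close> and \<open>d\<close> have norm at most \<open>2 * D\<close>;
    \<open>L1\<close> accounts for the part of that change which is quadratic in
    \<open>d\<close>.\<close>
  define L where "L = L0 * (6 * D)\<^sup>2 + L1"
  define I where "I = (LINT z|M. \<bar>v z\<bar>)"
  show thesis
  proof (rule that[of "L * I / ?c"])
    fix x y assume x: "x \<in> C" and y: "y \<in> C"
    define d where "d = ?t *\<^sub>R (y - x)"
    have amy: "am k y = am k x + d" by (simp add: am_def d_def algebra_simps)
    have nd: "norm d \<le> norm (y - x)" using tm[of k] by (simp add: d_def mult_left_le_one_le)
    have nd2: "norm d \<le> 2 * D" using amD[OF x] amD[OF y] norm_triangle_ineq4[of "am k y" "am k x"] by (simp add: amy)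
    let ?bx = "bump (em k) (am k x)" and ?by = "bump (em k) (am k y)"
    let ?e = "\<lambda>z. 2 * ?f1 (S k x z) * ((z - am k x) \<bullet> d)"
    have pt: "\<bar>?by z - ?bx z - ?e z\<bar> \<le> L * (norm (y - x))\<^sup>2" if z: "z \<in> \<Omega>" for z
    proof -
      have dS: "S k y z - S k x z = 2 * ((z - am k x) \<bullet> d) - (norm d)\<^sup>2"
        unfolding S_def amy power2_norm_eq_inner by (simp add: inner_diff_left inner_diff_right inner_add_left inner_add_right inner_commute)
      have "\<bar>(z - am k x) \<bullet> d\<bar> \<le> norm (z - am k x) * norm d" by (rule Cauchy_Schwarz_ineq2)
      also have "\<dots> \<le> 2 * D * norm d" using zam[OF x z] by (intro mult_right_mono) auto
      finally have a: "\<bar>(z - am k x) \<bullet> d\<bar> \<le> 2 * D * norm d" .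
      have b: "(norm d)\<^sup>2 \<le> 2 * D * norm d" using nd2 by (simp add: power2_eq_square mult_right_mono)
      have "\<bar>S k y z - S k x z\<bar> \<le> 6 * D * norm d" using abs_le_D1[OF a] abs_le_D2[OF a] b zero_le_power2[of "norm d"]
        unfolding dS by (intro abs_leI) linarith+
      then have "(S k y z - S k x z)\<^sup>2 \<le> (6 * D * norm d)\<^sup>2" by (metis abs_le_square_iff abs_ge_self order_trans)
      then have "L0 * (S k y z - S k x z)\<^sup>2 \<le> L0 * ((6 * D)\<^sup>2 * (norm d)\<^sup>2)"
        using L0(1) by (intro mult_left_mono) (auto simp: power_mult_distrib)
      then have T1: "\<bar>?f0 (S k y z) - ?f0 (S k x z) - ?f1 (S k x z) * (S k y z - S k x z)\<bar> \<le> L0 * ((6 * D)\<^sup>2 * (norm d)\<^sup>2)"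
        using L0(2)[OF SK[OF x z] SK[OF y z]] by linarith
      have T2: "\<bar>?f1 (S k x z) * (norm d)\<^sup>2\<bar> \<le> L1 * (norm d)\<^sup>2"
        using L1(2)[OF SK[OF x z]] by (simp add: abs_mult mult_right_mono)
      have "?by z - ?bx z - ?e z = (?f0 (S k y z) - ?f0 (S k x z) - ?f1 (S k x z) * (S k y z - S k x z)) - ?f1 (S k x z) * (norm d)\<^sup>2"
        unfolding dS by (simp add: bump_def S_def algebra_simps)
      then have "\<bar>?by z - ?bx z - ?e z\<bar> \<le> L0 * ((6 * D)\<^sup>2 * (norm d)\<^sup>2) + L1 * (norm d)\<^sup>2"
        using T1 T2 by linarith
      also have "\<dots> = L * (norm d)\<^sup>2" by (simp add: L_def algebra_simps)
      also have "\<dots> \<le> L * (norm (y - x))\<^sup>2"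
        using nd L0(1) L1(1) by (intro mult_left_mono power_mono) (auto simp: L_def)
      finally show ?thesis .
    qed
    \<comment> \<open>The kernel itself is the test function, which is legitimate because
      \<open>x\<close> lies in \<open>C\<close>.\<close>
    have gb: "(LINT z|M. v z *\<^sub>R grad ?bx z) = - (LINT z|M. ?bx z *\<^sub>R V z)"
      using wg test_function_am[OF x, of k] by (auto simp: weak_grad_def)
    have ig: "integrable M (\<lambda>z. v z *\<^sub>R grad ?bx z)" "integrable M (\<lambda>z. ?bx z *\<^sub>R V z)"
      using integrable_test[OF test_function_am[OF x, of k]] v V by auto
    have ge: "(v z *\<^sub>R grad ?bx z) \<bullet> d = - (?e z * v z)" for z
      by (simp add: grad_bump S_def mult.commute mult.left_commute)
    have ie: "integrable M (\<lambda>z. ?e z * v z)"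
      using integrable_inner_left[OF ig(1), of d] unfolding ge by simp
    have "(LINT z|M. ?e z * v z) = - ((LINT z|M. v z *\<^sub>R grad ?bx z) \<bullet> d)"
      using integral_inner_left[OF ig(1), of d] unfolding ge by simp
    also have "\<dots> = (LINT z|M. ?bx z *\<^sub>R V z) \<bullet> d" by (simp add: gb)
    also have "\<dots> = (LINT z|M. ?bx z *\<^sub>R V z) \<bullet> (y - x) * ?t" by (simp add: d_def)
    also have "(LINT z|M. ?bx z *\<^sub>R V z) \<bullet> (y - x) = (\<Sum>i\<in>Basis. (LINT z|M. ?bx z * (V z \<bullet> i)) * ((y - x) \<bullet> i))"
      using integral_inner_left[OF ig(2)] by (subst euclidean_inner) simp
    finally have eI: "(LINT z|M. ?e z * v z) / ?c = moll_grad k V x \<bullet> (y - x)"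
      by (simp add: moll_grad_def moll_def inner_sum_left sum_distrib_right sum_distrib_left sum_divide_distrib inner_commute[of "y - x"] ac_simps)
    have ib: "integrable M (\<lambda>z. ?bx z * v z)" "integrable M (\<lambda>z. ?by z * v z)" by (intro integrable_bump_mult v)+
    have iv: "integrable M v" by (rule sq_integrable_integrable[OF finite_measure_axioms v])
    have "\<bar>LINT z|M. (?by z - ?bx z - ?e z) * v z\<bar> \<le> (LINT z|M. L * (norm (y - x))\<^sup>2 * \<bar>v z\<bar>)"
    proof (intro order_trans[OF integral_abs_bound] integral_mono)
      have "integrable M (\<lambda>z. (?by z - ?bx z - ?e z) * v z)"
        using ib ie by (simp add: left_diff_distrib)
      then show "integrable M (\<lambda>z. \<bar>(?by z - ?bx z - ?e z) * v z\<bar>)" by simp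
      fix z assume "z \<in> space M"
      then show "\<bar>(?by z - ?bx z - ?e z) * v z\<bar> \<le> L * (norm (y - x))\<^sup>2 * \<bar>v z\<bar>"
        using pt[of z] by (simp only: abs_mult) (intro mult_right_mono, auto)
    qed (use iv in simp)
    also have "\<dots> = L * (norm (y - x))\<^sup>2 * I" by (simp add: I_def)
    finally have "- (L * (norm (y - x))\<^sup>2 * I) \<le> (LINT z|M. (?by z - ?bx z - ?e z) * v z)" by linarith
    then have "- (L * (norm (y - x))\<^sup>2 * I) / ?c \<le> (LINT z|M. (?by z - ?bx z - ?e z) * v z) / ?c"
      using mass_pos[of k] by (intro divide_right_mono) auto
    also have "(LINT z|M. (?by z - ?bx z - ?e z) * v z) = (LINT z|M. ?by z * v z) - (LINT z|M. ?bx z * v z) - (LINT z|M. ?e z * v z)"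
      using ib ie by (simp add: left_diff_distrib)
    also have "\<dots> / ?c = moll k v y - moll k v x - moll_grad k V x \<bullet> (y - x)"
      by (simp only: diff_divide_distrib eI moll_def)
    finally show "moll k v x + moll_grad k V x \<bullet> (y - x) - L * I / ?c * (norm (y - x))\<^sup>2 \<le> moll k v y"
      by (simp add: algebra_simps)
  qed
qed

text \<open>The mollifications are bounded and semiconvex on \<open>C\<close>, hence obey the
  inequality, and all its terms converge. It is kept in the form multiplied by the total mass, so
  that no weighted mean has to be divided out on the way.\<close>

lemma H1_poincare:
  assumes H: "H1_on \<Omega> v V" and \<kappa>: "0 < \<kappa>"
  defines "\<sigma> \<equiv> \<lambda>x. exp (- (\<kappa> * (norm (x - p))\<^sup>2))"
  shows "2 * \<kappa> * ((LINT x|MC. \<sigma> x) * (LINT x|MC. (v x)\<^sup>2 * \<sigma> x) - (LINT x|MC. v x * \<sigma> x)\<^sup>2)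
    \<le> (LINT x|MC. \<sigma> x) * (LINT x|MC. (norm (V x))\<^sup>2 * \<sigma> x)"
proof -
  interpret C: finite_measure MC by (rule finite_measure_MC)
  have v: "sq_integrable M v" and V: "sq_integrable M V" using H by (auto simp: H1_on_iff)
  have Vi: "sq_integrable M (\<lambda>z. V z \<bullet> i)" for i by (rule sq_integrable_component[OF V])
  note sub = sq_integrable_lebesgue_on_subset[OF _ C_subset lmeasurable_C(2) sets_\<Omega>(1)]
  \<comment> \<open>The square root of the weight: multiplying by it preserves convergence in L2,
    and the weighted integrals become inner products of convergent sequences.\<close>
  define s where "s x = exp (- (\<kappa> / 2 * (norm (x - p))\<^sup>2))" for x
  have s_cont: "continuous_on UNIV s" unfolding s_def by (intro continuous_intros)
  have s1: "\<bar>s x\<bar> \<le> 1" for x using \<kappa> by (simp add: s_def)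
  have ss: "s x * s x = \<sigma> x" for x
  proof -
    have "- (\<kappa> / 2 * (norm (x - p))\<^sup>2) + - (\<kappa> / 2 * (norm (x - p))\<^sup>2) = - (\<kappa> * (norm (x - p))\<^sup>2)" by simp
    then show ?thesis unfolding s_def \<sigma>_def exp_add[symmetric] by presburger
  qed
  have sm: "s \<in> borel_measurable MC" by (rule measurable_lebesgue_on_continuous[OF s_cont])
  have \<sigma>m[measurable]: "\<sigma> \<in> borel_measurable borel" unfolding \<sigma>_def by measurable
  have sq_s: "sq_integrable MC (\<lambda>x. s x *\<^sub>R f x)" if "sq_integrable MC f" for f :: "'a \<Rightarrow> real"
    by (rule sq_integrable_scaleR[OF that sm s1])
  have lim_s: "L2_tendsto MC (\<lambda>k x. s x *\<^sub>R f k x) (\<lambda>x. s x *\<^sub>R f' x)" if f: "L2_tendsto MC f f'" for f :: "nat \<Rightarrow> 'a \<Rightarrow> real" and f'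
    unfolding L2_tendsto_def
  proof (intro conjI allI sq_s)
    show "sq_integrable MC (f n)" "sq_integrable MC f'" for n using f by (auto simp: L2_tendsto_def)
    then have sqd: "sq_integrable MC (\<lambda>x. f n x - f' x)" for n by (intro sq_integrable_diff)
    show "(\<lambda>n. LINT x|MC. (norm (s x *\<^sub>R f n x - s x *\<^sub>R f' x))\<^sup>2) \<longlonglongrightarrow> 0"
    proof (rule tendsto_sandwich[OF _ _ tendsto_const])
      show "(\<lambda>n. LINT x|MC. (norm (f n x - f' x))\<^sup>2) \<longlonglongrightarrow> 0" using f by (simp add: L2_tendsto_def)
      show "\<forall>\<^sub>F n in sequentially. (LINT x|MC. (norm (s x *\<^sub>R f n x - s x *\<^sub>R f' x))\<^sup>2) \<le> (LINT x|MC. (norm (f n x - f' x))\<^sup>2)"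
      proof (intro always_eventually allI integral_mono)
        fix n x
        show "integrable MC (\<lambda>x. (norm (f n x - f' x))\<^sup>2)" using sqd by (simp add: sq_integrable_def)
        show "integrable MC (\<lambda>x. (norm (s x *\<^sub>R f n x - s x *\<^sub>R f' x))\<^sup>2)"
          using sq_s[OF sqd[of n]] by (simp add: sq_integrable_def right_diff_distrib)
        have "norm (s x *\<^sub>R f n x - s x *\<^sub>R f' x) = \<bar>s x\<bar> * norm (f n x - f' x)"
          by (simp add: abs_mult flip: right_diff_distrib)
        also have "\<dots> \<le> norm (f n x - f' x)" using s1[of x] by (simp add: mult_left_le_one_le)
        finally show "(norm (s x *\<^sub>R f n x - s x *\<^sub>R f' x))\<^sup>2 \<le> (norm (f n x - f' x))\<^sup>2" by (rule power_mono) simp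
      qed
    qed simp
  qed
  have lim2: "(\<lambda>k. LINT x|MC. (moll k f x)\<^sup>2 * \<sigma> x) \<longlonglongrightarrow> (LINT x|MC. (f x)\<^sup>2 * \<sigma> x)" if f: "sq_integrable M f" for f
    using L2_tendsto_inner[OF lim_s[OF moll_tendsto[OF f]] lim_s[OF moll_tendsto[OF f]]]
    by (simp add: ss[symmetric] power2_eq_square ac_simps)
  have lim1: "(\<lambda>k. LINT x|MC. moll k v x * \<sigma> x) \<longlonglongrightarrow> (LINT x|MC. v x * \<sigma> x)"
    using L2_tendsto_inner[OF lim_s[OF moll_tendsto[OF v]] L2_tendsto_const[OF sq_s[OF sq_integrable_const[OF finite_measure_MC, of 1]]]]
    by (simp add: ss[symmetric] ac_simps)
  have int\<sigma>: "integrable MC (\<lambda>x. (f x)\<^sup>2 * \<sigma> x)" if "sq_integrable MC f" for f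
    using sq_integrable_mult[OF sq_s[OF that] sq_s[OF that]] by (simp add: ss[symmetric] power2_eq_square ac_simps)
  have tm1: "tm \<longlonglongrightarrow> 1" unfolding tm_def by real_asymp
  have limE: "(\<lambda>k. LINT x|MC. (norm (moll_grad k V x))\<^sup>2 * \<sigma> x) \<longlonglongrightarrow> (LINT x|MC. (norm (V x))\<^sup>2 * \<sigma> x)"
  proof -
    have "(\<lambda>k. \<Sum>i\<in>Basis. (tm k)\<^sup>2 * (LINT x|MC. (moll k (\<lambda>z. V z \<bullet> i) x)\<^sup>2 * \<sigma> x))
      \<longlonglongrightarrow> (\<Sum>i\<in>Basis. 1\<^sup>2 * (LINT x|MC. (V x \<bullet> i)\<^sup>2 * \<sigma> x))"
      by (intro tendsto_sum tendsto_mult tendsto_power tm1 lim2 Vi)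
    moreover have "(\<Sum>i\<in>Basis. (tm k)\<^sup>2 * (LINT x|MC. (moll k (\<lambda>z. V z \<bullet> i) x)\<^sup>2 * \<sigma> x)) = (LINT x|MC. (norm (moll_grad k V x))\<^sup>2 * \<sigma> x)" for k
    proof -
      have "(norm (moll_grad k V x))\<^sup>2 * \<sigma> x = (\<Sum>i\<in>Basis. (tm k)\<^sup>2 * ((moll k (\<lambda>z. V z \<bullet> i) x)\<^sup>2 * \<sigma> x))" for x
      proof -
        have "moll_grad k V x \<bullet> i = tm k * moll k (\<lambda>z. V z \<bullet> i) x" if "i \<in> Basis" for i
          using that unfolding moll_grad_def by (simp add: inner_sum_left_Basis)
        then have "(norm (moll_grad k V x))\<^sup>2 = (\<Sum>i\<in>Basis. (tm k)\<^sup>2 * (moll k (\<lambda>z. V z \<bullet> i) x)\<^sup>2)"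
          unfolding power2_norm_eq_inner by (subst euclidean_inner) (simp add: power2_eq_square ac_simps)
        then show ?thesis by (simp add: sum_distrib_right mult.assoc)
      qed
      then show ?thesis by (simp add: int\<sigma> moll_sq_integrable Vi)
    qed
    moreover have "(\<Sum>i\<in>Basis. 1\<^sup>2 * (LINT x|MC. (V x \<bullet> i)\<^sup>2 * \<sigma> x)) = (LINT x|MC. (norm (V x))\<^sup>2 * \<sigma> x)"
    proof -
      have "(norm (V x))\<^sup>2 * \<sigma> x = (\<Sum>i\<in>Basis. (V x \<bullet> i)\<^sup>2 * \<sigma> x)" for x
        unfolding power2_norm_eq_inner by (subst euclidean_inner) (simp add: power2_eq_square sum_distrib_right)
      then show ?thesis by (simp add: int\<sigma> sub(1) Vi)
    qed
    ultimately show ?thesis by simp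
  qed
  have conv: "(LINT x|lborel. f x * (indicator C x * \<sigma> x)) = (LINT x|MC. f x * \<sigma> x)" if [measurable]: "f \<in> borel_measurable borel" for f
    by (subst integral_lebesgue_on_eq_lborel) (auto simp: borel_C ac_simps)
  have conv1: "(LINT x|lborel. indicator C x * \<sigma> x) = (LINT x|MC. \<sigma> x)"
    using conv[of "\<lambda>_. 1"] by simp
  have i\<sigma>: "integrable MC \<sigma>" using int\<sigma>[OF sq_integrable_const[OF finite_measure_MC, of 1]] by simp
  have \<sigma>0: "0 < \<sigma> x" for x by (simp add: \<sigma>_def)
  have Zpos: "0 < (LINT x|MC. \<sigma> x)"
  proof -
    have "(LINT x|MC. \<sigma> x) \<noteq> 0"
    proof
      assume "(LINT x|MC. \<sigma> x) = 0"
      then have "AE x in MC. \<sigma> x = 0" using integral_nonneg_eq_0_iff_AE[OF i\<sigma>] \<sigma>0 by (simp add: less_imp_le)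
      then have "AE x in MC. False" using \<sigma>0 by (simp add: less_imp_neq[symmetric])
      then have "emeasure MC C = 0"
        using emeasure_eq_0_AE[of "\<lambda>_. True" MC] by simp
      then have "C \<in> null_sets lebesgue"
        using lmeasurable_C(2) by (simp add: emeasure_restrict_space null_sets_def)
      then have "negligible C" by (simp add: negligible_iff_null_sets)
      then have "negligible (ball p R)" using ball_C by (rule negligible_subset)
      then show False using open_not_negligible[of "ball p R"] R_pos by simp
    qed
    moreover have "0 \<le> (LINT x|MC. \<sigma> x)" using \<sigma>0 by (simp add: less_imp_le)
    ultimately show ?thesis by simp
  qed
  have "2 * \<kappa> * ((LINT x|MC. \<sigma> x) * (LINT x|MC. (moll k v x)\<^sup>2 * \<sigma> x) - (LINT x|MC. moll k v x * \<sigma> x)\<^sup>2)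
    \<le> (LINT x|MC. \<sigma> x) * (LINT x|MC. (norm (moll_grad k V x))\<^sup>2 * \<sigma> x)" for k
  proof -
    have [measurable]: "moll k v \<in> borel_measurable borel"
      by (rule moll_measurable[OF sq_integrable_measurable[OF v]])
    have [measurable]: "moll k (\<lambda>z. V z \<bullet> i) \<in> borel_measurable borel" for i
      by (rule moll_measurable[OF sq_integrable_measurable[OF Vi]])
    have [measurable]: "moll_grad k V \<in> borel_measurable borel"
      unfolding moll_grad_def by measurable
    \<comment> \<open>\<open>L\<close> may depend on \<open>k\<close>; it does not occur in the
      conclusion of \<open>poincare_semiconvex\<close>.\<close>
    obtain L where L: "\<And>x y. x \<in> C \<Longrightarrow> y \<in> C \<Longrightarrow>
      moll k v x + moll_grad k V x \<bullet> (y - x) - L * (norm (y - x))\<^sup>2 \<le> moll k v y"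
      using moll_Taylor[OF H] by blast
    define c where "c = bump_mass TYPE('a) (em k)"
    define A1 where "A1 = (LINT z|M. \<bar>v z\<bar>) / c"
    define A2 where "A2 = (\<Sum>i\<in>Basis. tm k * ((LINT z|M. \<bar>V z \<bullet> i\<bar>) / c))"
    have A1: "\<bar>moll k v x\<bar> \<le> max A1 A2" for x
      using moll_bounded[OF v, of k x] by (simp add: A1_def c_def le_max_iff_disj)
    have "norm (moll_grad k V x) \<le> A2" for x
      unfolding moll_grad_def A2_def
    proof (rule sum_norm_le)
      fix i :: 'a assume "i \<in> Basis"
      then show "norm ((tm k * moll k (\<lambda>z. V z \<bullet> i) x) *\<^sub>R i) \<le> tm k * ((LINT z|M. \<bar>V z \<bullet> i\<bar>) / c)"
        using tm(3)[of k] mult_left_mono[OF moll_bounded[OF Vi, of k i x], of "tm k"] by (simp add: abs_mult c_def)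
    qed
    then have A2: "norm (moll_grad k V x) \<le> max A1 A2" for x by (simp add: le_max_iff_disj)
    have fold: "exp (- (\<kappa> * (norm (x - p))\<^sup>2)) = \<sigma> x" for x by (simp add: \<sigma>_def)
    have c: "(LINT x|lborel. (moll k v x)\<^sup>2 * (indicator C x * \<sigma> x)) = (LINT x|MC. (moll k v x)\<^sup>2 * \<sigma> x)"
      "(LINT x|lborel. moll k v x * (indicator C x * \<sigma> x)) = (LINT x|MC. moll k v x * \<sigma> x)"
      "(LINT x|lborel. (norm (moll_grad k V x))\<^sup>2 * (indicator C x * \<sigma> x)) = (LINT x|MC. (norm (moll_grad k V x))\<^sup>2 * \<sigma> x)"
      by (intro conv; measurable)+
    from poincare_semiconvex[OF convex_C bounded_C borel_C _ _ A1 A2 L \<kappa>, of p]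
    show ?thesis using Zpos by (simp only: fold c conv1) simp
  qed
  moreover have "(\<lambda>k. 2 * \<kappa> * ((LINT x|MC. \<sigma> x) * (LINT x|MC. (moll k v x)\<^sup>2 * \<sigma> x) - (LINT x|MC. moll k v x * \<sigma> x)\<^sup>2))
    \<longlonglongrightarrow> 2 * \<kappa> * ((LINT x|MC. \<sigma> x) * (LINT x|MC. (v x)\<^sup>2 * \<sigma> x) - (LINT x|MC. v x * \<sigma> x)\<^sup>2)"
    by (intro tendsto_intros lim1 lim2 v)
  ultimately show ?thesis
    using LIMSEQ_le[OF _ tendsto_mult[OF tendsto_const limE]] by blast
qed

end

section \<open>Compactness of the Sobolev embedding\<close>

context bounded_domain
begin

lemma integral_lebesgue_on_subset:
  fixes f :: "'a \<Rightarrow> real"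
  assumes "C \<subseteq> \<Omega>" "C \<in> sets lebesgue"
  shows "(LINT x|lebesgue_on C. f x) = (LINT x|M. indicator C x *\<^sub>R f x)"
proof -
  have "indicator \<Omega> x *\<^sub>R (indicator C x *\<^sub>R f x) = indicator C x *\<^sub>R f x" for x
    using assms(1) by (auto simp: indicator_def)
  note e = this
  have 1: "(LINT x|lebesgue_on C. f x) = (LINT x|lebesgue. indicator C x *\<^sub>R f x)"
    by (rule integral_restrict_space) (use assms in simp)
  have 2: "(LINT x|M. indicator C x *\<^sub>R f x) = (LINT x|lebesgue. indicator \<Omega> x *\<^sub>R (indicator C x *\<^sub>R f x))"
    by (rule integral_restrict_space) (simp add: sets_\<Omega>)
  show ?thesis unfolding 1 2 e ..
qed

text \<open>Take \<open>\<kappa> = 1 / d\<^sup>2\<close> in the weighted inequality: on \<open>C\<close> that weight lies between \<open>exp (- 1)\<close> and \<open>1\<close>.\<close>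

lemma poincare_small_piece:
  assumes H: "H1_on \<Omega> v V" and C: "C \<subseteq> \<Omega>" "convex C" "C \<in> sets borel"
    and d: "0 < d" "\<And>x y. x \<in> C \<Longrightarrow> y \<in> C \<Longrightarrow> dist x y \<le> d"
  shows "(LINT x|lebesgue_on C. (v x)\<^sup>2)
    \<le> (LINT x|lebesgue_on C. v x)\<^sup>2 / measure lebesgue C + exp 1 * d\<^sup>2 / 2 * (LINT x|lebesgue_on C. (norm (V x))\<^sup>2)"
proof (cases "interior C = {}")
  \<comment> \<open>A convex set without interior is a null set, so all integrals vanish; the
    quotient of squared average and measure is 0 even though the measure is 0.\<close>
  case True
  then have "C \<in> null_sets lebesgue"
    using negligible_convex_interior[OF C(2)] by (simp add: negligible_iff_null_sets)
  then have "AE x in lebesgue_on C. False"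
    by (subst AE_restrict_space_iff) (use AE_not_in in \<open>auto simp: C elim: eventually_mono\<close>)
  then have "(LINT x|lebesgue_on C. f x) = (0::real)" for f
    using integral_cong_AE[of f "lebesgue_on C" "\<lambda>_. 0"]
    by (metis (mono_tags, lifting) AE_cong eventually_False eventually_mono integral_eq_zero_AE)
  then show ?thesis by simp
next
  case False
  then obtain p where "p \<in> interior C" by auto
  then obtain R where R: "0 < R" "ball p R \<subseteq> C" by (auto simp: mem_interior)
  obtain D where D: "\<Omega> \<subseteq> cball 0 D" using bounded_\<Omega> by (auto simp: bounded_iff subset_iff)
  interpret P: convex_piece \<Omega> C p R D
    by unfold_locales (use C R D in auto)
  interpret CM: finite_measure "lebesgue_on C" by (rule P.finite_measure_MC)
  let ?N = "lebesgue_on C"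
  define \<kappa> where "\<kappa> = 1 / d\<^sup>2"
  have \<kappa>: "0 < \<kappa>" using d by (simp add: \<kappa>_def)
  define \<sigma> where "\<sigma> x = exp (- (\<kappa> * (norm (x - p))\<^sup>2))" for x
  have pC: "p \<in> C" using R by auto
  have \<sigma>1: "\<sigma> x \<le> 1" and \<sigma>0: "0 < \<sigma> x" for x using \<kappa> by (auto simp: \<sigma>_def)
  have \<sigma>e: "exp (-1) \<le> \<sigma> x" if "x \<in> C" for x
  proof -
    have "(norm (x - p))\<^sup>2 \<le> d\<^sup>2" using d(2)[OF that pC] by (intro power_mono) (auto simp: dist_norm)
    then have "\<kappa> * (norm (x - p))\<^sup>2 \<le> 1" using d(1) by (simp add: \<kappa>_def field_simps)
    then show ?thesis by (simp add: \<sigma>_def)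
  qed
  have \<sigma>m: "\<sigma> \<in> borel_measurable ?N"
    unfolding \<sigma>_def by (intro measurable_lebesgue_on_continuous continuous_intros)
  have v: "sq_integrable ?N v" and V: "sq_integrable ?N V"
    using H sq_integrable_lebesgue_on_subset(1)[OF _ C(1) P.lmeasurable_C(2) sets_\<Omega>(1)] by (auto simp: H1_on_iff)
  have sqm: "sq_integrable ?N (\<lambda>x. v x - c)" for c by (intro sq_integrable_diff v sq_integrable_const P.finite_measure_MC)
  have iv: "integrable ?N (\<lambda>x. (v x)\<^sup>2)" "integrable ?N v" using v sq_integrable_integrable[OF P.finite_measure_MC v] by (auto simp: sq_integrable_def)
  have iV: "integrable ?N (\<lambda>x. (norm (V x))\<^sup>2)" using V by (simp add: sq_integrable_def)
  have wt: "integrable ?N (\<lambda>x. f x * \<sigma> x)" if "integrable ?N f" for f :: "'a \<Rightarrow> real"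
    by (rule Bochner_Integration.integrable_bound[OF that])
       (use \<sigma>1 \<sigma>0 \<sigma>m that in \<open>auto intro!: AE_I2 mult_left_le simp: abs_mult less_imp_le\<close>)
  let ?Z = "LINT x|?N. \<sigma> x" and ?m = "LINT x|?N. v x * \<sigma> x" and ?S = "LINT x|?N. (v x)\<^sup>2 * \<sigma> x"
  let ?E = "LINT x|?N. (norm (V x))\<^sup>2"
  have i\<sigma>: "integrable ?N \<sigma>" using wt[of "\<lambda>_. 1"] by simp
  have mpos: "0 < measure lebesgue C"
  proof -
    have "measure lebesgue C \<noteq> 0"
      using negligible_subset[OF _ R(2)] open_not_negligible[of "ball p R"] R(1) P.lmeasurable_C(1)
      by (auto simp: negligible_iff_measure)
    then show ?thesis by (simp add: less_le)
  qed
  have mC: "measure ?N C = measure lebesgue C"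
    using P.lmeasurable_C(2) by (simp add: measure_restrict_space)
  have Z: "0 < ?Z"
  proof -
    have "exp (-1) * measure lebesgue C = (LINT x|?N. exp (-1))" by (simp add: mC)
    also have "\<dots> \<le> ?Z" by (intro integral_mono i\<sigma>) (auto simp: \<sigma>e)
    finally show ?thesis using mpos by (smt (verit) exp_gt_zero mult_pos_pos)
  qed
  \<comment> \<open>The mean with respect to the weighted measure. The weighted inequality controls
    the deviation from this \<open>c\<close>, not from the plain mean of \<open>v\<close>.\<close>
  define c where "c = ?m / ?Z"
  have "2 * \<kappa> * (?Z * ?S - ?m\<^sup>2) \<le> ?Z * (LINT x|?N. (norm (V x))\<^sup>2 * \<sigma> x)"
    using P.H1_poincare[OF H \<kappa>] by (simp add: \<sigma>_def)
  also have "\<dots> \<le> ?Z * ?E"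
    using Z \<sigma>1 \<sigma>0 by (intro mult_left_mono integral_mono wt iV) (auto intro: mult_left_le)
  finally have 1: "2 * \<kappa> * (?Z * ?S - ?m\<^sup>2) \<le> ?Z * ?E" .
  have 2: "?Z * ?S - ?m\<^sup>2 = ?Z * (LINT x|?N. (v x - c)\<^sup>2 * \<sigma> x)"
  proof -
    have "(LINT x|?N. (v x - c)\<^sup>2 * \<sigma> x) = (LINT x|?N. (v x)\<^sup>2 * \<sigma> x - 2 * c * (v x * \<sigma> x) + c\<^sup>2 * \<sigma> x)"
      by (simp add: power2_eq_square algebra_simps)
    also have "\<dots> = ?S - 2 * c * ?m + c\<^sup>2 * ?Z" using wt[OF iv(1)] wt[OF iv(2)] i\<sigma> by simp
    finally show ?thesis using Z by (simp add: c_def field_simps power2_eq_square)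
  qed
  have "?Z * (2 * \<kappa> * (LINT x|?N. (v x - c)\<^sup>2 * \<sigma> x)) \<le> ?Z * ?E"
    using 1 unfolding 2 by (simp add: ac_simps)
  then have 3: "2 * \<kappa> * (LINT x|?N. (v x - c)\<^sup>2 * \<sigma> x) \<le> ?E" using Z by simp
  have ic: "integrable ?N (\<lambda>x. (v x - c)\<^sup>2)" using sqm[of c] by (simp add: sq_integrable_def)
  have "exp (-1) * (LINT x|?N. (v x - c)\<^sup>2) = (LINT x|?N. (v x - c)\<^sup>2 * exp (-1))" by (simp add: mult.commute)
  also have "\<dots> \<le> (LINT x|?N. (v x - c)\<^sup>2 * \<sigma> x)"
    using wt[OF ic] ic by (intro integral_mono) (auto intro!: mult_left_mono \<sigma>e)
  also have "\<dots> \<le> d\<^sup>2 / 2 * ?E" using 3 d(1) by (simp add: \<kappa>_def field_simps)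
  finally have "exp 1 * (exp (-1) * (LINT x|?N. (v x - c)\<^sup>2)) \<le> exp 1 * (d\<^sup>2 / 2 * ?E)"
    by (intro mult_left_mono) auto
  moreover have "exp 1 * (exp (-1) * (LINT x|?N. (v x - c)\<^sup>2)) = (LINT x|?N. (v x - c)\<^sup>2)"
    by (simp add: exp_minus)
  ultimately have 4: "(LINT x|?N. (v x - c)\<^sup>2) \<le> exp 1 * d\<^sup>2 / 2 * ?E" by simp
  have 5: "(LINT x|?N. (v x - c)\<^sup>2) = (LINT x|?N. (v x)\<^sup>2) - 2 * c * (LINT x|?N. v x) + c\<^sup>2 * measure lebesgue C"
  proof -
    have "(LINT x|?N. (v x - c)\<^sup>2) = (LINT x|?N. (v x)\<^sup>2 - 2 * c * v x + c\<^sup>2)"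
      by (simp add: power2_eq_square algebra_simps)
    also have "\<dots> = (LINT x|?N. (v x)\<^sup>2) - 2 * c * (LINT x|?N. v x) + c\<^sup>2 * measure lebesgue C"
      using iv by (simp add: mC)
    finally show ?thesis .
  qed
  \<comment> \<open>Completing the square: no constant \<open>c\<close> does better than the plain
    mean, so the weighted mean may be traded for it at no cost.\<close>
  have "2 * c * a - c\<^sup>2 * m \<le> a\<^sup>2 / m" if "0 < m" for a m
  proof -
    have "0 \<le> (a - c * m)\<^sup>2 / m" using that by simp
    also have "\<dots> = a\<^sup>2 / m - (2 * c * a - c\<^sup>2 * m)" using that by (simp add: field_simps power2_eq_square)
    finally show ?thesis by simp
  qed
  from this[OF mpos, of "LINT x|?N. v x"] show ?thesis using 4 unfolding 5 by linarith
qed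

text \<open>The label of the half-open cube of side \<open>1 / N\<close> that contains
  \<open>x\<close>, as a point with integer coordinates. Half-open cubes partition the domain
  exactly and, being cut out by bounds on coordinates, meet a convex domain in convex cells.\<close>

definition cell_index :: "nat \<Rightarrow> 'a \<Rightarrow> 'a" where
  "cell_index N x = (\<Sum>b\<in>Basis. real_of_int \<lfloor>real N * (x \<bullet> b)\<rfloor> *\<^sub>R b)"

definition cell :: "nat \<Rightarrow> 'a \<Rightarrow> 'a set" where
  "cell N y = {x \<in> \<Omega>. cell_index N x = y}"

lemma cell_index_inner: "b \<in> Basis \<Longrightarrow> cell_index N x \<bullet> b = real_of_int \<lfloor>real N * (x \<bullet> b)\<rfloor>"
  by (simp add: cell_index_def inner_sum_left_Basis)

lemma cell_subset: "cell N y \<subseteq> \<Omega>" by (auto simp: cell_def)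

lemma cell_borel: "cell N y \<in> sets borel" "cell N y \<in> sets lebesgue"
proof -
  have [measurable]: "cell_index N \<in> borel_measurable borel" unfolding cell_index_def by measurable
  have "cell N y = \<Omega> \<inter> (cell_index N -` {y} \<inter> space borel)" by (auto simp: cell_def)
  also have "\<dots> \<in> sets borel" using sets_\<Omega> by measurable
  finally show "cell N y \<in> sets borel" .
  then show "cell N y \<in> sets lebesgue" by simp
qed

lemma cell_convex:
  assumes "convex \<Omega>" shows "convex (cell N y)"
proof (rule convexI)
  fix x z u w assume x: "x \<in> cell N y" and z: "z \<in> cell N y" and uw: "0 \<le> u" "0 \<le> w" "u + w = (1::real)"
  have "cell_index N (u *\<^sub>R x + w *\<^sub>R z) = y"
  proof (rule euclidean_eqI)
    fix b :: 'a assume b: "b \<in> Basis"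
    define k where "k = \<lfloor>real N * (x \<bullet> b)\<rfloor>"
    have k: "real_of_int k = y \<bullet> b" using x cell_index_inner[OF b, of N x] by (simp add: cell_def k_def)
    moreover have "real_of_int \<lfloor>real N * (z \<bullet> b)\<rfloor> = y \<bullet> b" using z cell_index_inner[OF b, of N z] by (simp add: cell_def)
    ultimately have kz: "\<lfloor>real N * (z \<bullet> b)\<rfloor> = k" by linarith
    have e: "real N * ((u *\<^sub>R x + w *\<^sub>R z) \<bullet> b) = u * (real N * (x \<bullet> b)) + w * (real N * (z \<bullet> b))"
      by (simp add: inner_add_left algebra_simps)
    have b1: "of_int k \<le> real N * (x \<bullet> b)" "real N * (x \<bullet> b) < of_int k + 1"
      "of_int k \<le> real N * (z \<bullet> b)" "real N * (z \<bullet> b) < of_int k + 1"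
      using kz by (auto simp: k_def floor_eq_iff)
    have "of_int k \<le> u * (real N * (x \<bullet> b)) + w * (real N * (z \<bullet> b))"
      using convex_bound_le[of "- (real N * (x \<bullet> b))" "- of_int k" "- (real N * (z \<bullet> b))" u w] b1 uw by simp
    moreover have "u * (real N * (x \<bullet> b)) + w * (real N * (z \<bullet> b)) < of_int k + 1"
      using convex_bound_lt[of "real N * (x \<bullet> b)" "of_int k + 1" "real N * (z \<bullet> b)" u w] b1 uw by simp
    ultimately have "\<lfloor>real N * ((u *\<^sub>R x + w *\<^sub>R z) \<bullet> b)\<rfloor> = k" unfolding e by (simp add: floor_eq_iff)
    then show "cell_index N (u *\<^sub>R x + w *\<^sub>R z) \<bullet> b = y \<bullet> b" using k by (simp add: cell_index_inner[OF b])
  qed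
  moreover have "u *\<^sub>R x + w *\<^sub>R z \<in> \<Omega>" using convexD[OF assms] x z uw by (auto simp: cell_def)
  ultimately show "u *\<^sub>R x + w *\<^sub>R z \<in> cell N y" by (simp add: cell_def)
qed

lemma cell_dist:
  assumes "0 < N" "x \<in> cell N y" "z \<in> cell N y" shows "dist x z \<le> DIM('a) / N"
proof -
  have "\<bar>(x - z) \<bullet> b\<bar> \<le> 1 / N" if b: "b \<in> Basis" for b
  proof -
    have "\<lfloor>real N * (x \<bullet> b)\<rfloor> = \<lfloor>real N * (z \<bullet> b)\<rfloor>"
      using assms cell_index_inner[OF b, of N x] cell_index_inner[OF b, of N z] by (auto simp: cell_def)
    then have "\<bar>real N * (x \<bullet> b) - real N * (z \<bullet> b)\<bar> \<le> 1" by linarith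
    also have "real N * (x \<bullet> b) - real N * (z \<bullet> b) = real N * ((x - z) \<bullet> b)" by (simp add: inner_diff_left algebra_simps)
    finally show ?thesis using assms(1) by (simp add: abs_mult field_simps)
  qed
  then have "(\<Sum>b\<in>Basis. \<bar>(x - z) \<bullet> b\<bar>) \<le> (\<Sum>b\<in>(Basis::'a set). 1 / N)" by (intro sum_mono)
  then show ?thesis using norm_le_l1[of "x - z"] by (simp add: dist_norm)
qed

lemma finite_cells: "finite (cell_index N ` \<Omega>)"
proof -
  obtain D where D: "\<And>x. x \<in> \<Omega> \<Longrightarrow> norm x \<le> D" using bounded_\<Omega> by (auto simp: bounded_iff)
  define L where "L = \<lceil>real N * D\<rceil> + 1"
  have "cell_index N ` \<Omega> \<subseteq> (\<lambda>f. \<Sum>b\<in>Basis. real_of_int (f b) *\<^sub>R b) ` (PiE Basis (\<lambda>_. {- L..L}))"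
  proof
    fix y assume "y \<in> cell_index N ` \<Omega>"
    then obtain x where x: "x \<in> \<Omega>" "y = cell_index N x" by auto
    define f where "f = restrict (\<lambda>b. \<lfloor>real N * (x \<bullet> b)\<rfloor>) Basis"
    have "\<lfloor>real N * (x \<bullet> b)\<rfloor> \<in> {- L..L}" if b: "b \<in> Basis" for b
    proof -
      have "\<bar>x \<bullet> b\<bar> \<le> D" using Basis_le_norm[OF b, of x] D[OF x(1)] by linarith
      then have "real N * \<bar>x \<bullet> b\<bar> \<le> real N * D" by (intro mult_left_mono) auto
      then have "\<bar>real N * (x \<bullet> b)\<bar> \<le> real N * D" by (simp add: abs_mult)
      then show ?thesis unfolding L_def by (auto simp: abs_le_iff; linarith)
    qed
    then have "f \<in> PiE Basis (\<lambda>_. {- L..L})" by (auto simp: f_def)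
    moreover have "y = (\<Sum>b\<in>Basis. real_of_int (f b) *\<^sub>R b)" by (simp add: x(2) f_def cell_index_def)
    ultimately show "y \<in> (\<lambda>f. \<Sum>b\<in>Basis. real_of_int (f b) *\<^sub>R b) ` (PiE Basis (\<lambda>_. {- L..L}))" by blast
  qed
  then show ?thesis by (rule finite_subset) (intro finite_imageI finite_PiE; simp)
qed

lemma integral_sum_cells:
  fixes f :: "'a \<Rightarrow> real"
  assumes "integrable M f"
  shows "(LINT x|M. f x) = (\<Sum>y\<in>cell_index N ` \<Omega>. (LINT x|lebesgue_on (cell N y). f x))"
proof -
  have "(LINT x|M. f x) = (LINT x|M. (\<Sum>y\<in>cell_index N ` \<Omega>. indicator (cell N y) x *\<^sub>R f x))"
  proof (rule Bochner_Integration.integral_cong)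
    fix x assume "x \<in> space M"
    then have x: "x \<in> \<Omega>" by simp
    have "(\<Sum>y\<in>cell_index N ` \<Omega>. indicator (cell N y) x *\<^sub>R f x) = (\<Sum>y\<in>{cell_index N x}. indicator (cell N y) x *\<^sub>R f x)"
      using x by (intro sum.mono_neutral_right finite_cells) (auto simp: cell_def indicator_def)
    also have "\<dots> = f x" using x by (simp add: cell_def)
    finally show "f x = (\<Sum>y\<in>cell_index N ` \<Omega>. indicator (cell N y) x *\<^sub>R f x)" by simp
  qed simp
  also have "\<dots> = (\<Sum>y\<in>cell_index N ` \<Omega>. (LINT x|M. indicator (cell N y) x *\<^sub>R f x))"
  proof (rule Bochner_Integration.integral_sum)
    fix y
    have "cell N y \<in> sets M" using cell_borel(2) cell_subset sets_\<Omega> by (auto simp: sets_restrict_space_iff)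
    then show "integrable M (\<lambda>x. indicator (cell N y) x *\<^sub>R f x)" using assms by (rule integrable_mult_indicator)
  qed
  finally show ?thesis by (simp only: integral_lebesgue_on_subset[OF cell_subset cell_borel(2)])
qed

lemma square_le_sum_cells:
  assumes H: "H1_on \<Omega> v V" and conv: "convex \<Omega>" and N: "0 < N"
  shows "(LINT x|M. (v x)\<^sup>2) \<le> (\<Sum>y\<in>cell_index N ` \<Omega>. (LINT x|lebesgue_on (cell N y). v x)\<^sup>2 / measure lebesgue (cell N y))
    + exp 1 * (DIM('a) / real N)\<^sup>2 / 2 * (LINT x|M. (norm (V x))\<^sup>2)"
proof -
  have i: "integrable M (\<lambda>x. (v x)\<^sup>2)" "integrable M (\<lambda>x. (norm (V x))\<^sup>2)"
    using H by (auto simp: H1_on_iff sq_integrable_def)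
  have "(LINT x|M. (v x)\<^sup>2) = (\<Sum>y\<in>cell_index N ` \<Omega>. (LINT x|lebesgue_on (cell N y). (v x)\<^sup>2))"
    by (rule integral_sum_cells[OF i(1)])
  also have "\<dots> \<le> (\<Sum>y\<in>cell_index N ` \<Omega>. (LINT x|lebesgue_on (cell N y). v x)\<^sup>2 / measure lebesgue (cell N y)
    + exp 1 * (DIM('a) / N)\<^sup>2 / 2 * (LINT x|lebesgue_on (cell N y). (norm (V x))\<^sup>2))"
    using N by (intro sum_mono poincare_small_piece[OF H cell_subset cell_convex[OF conv] cell_borel(1)] cell_dist[OF N]) auto
  also have "\<dots> = (\<Sum>y\<in>cell_index N ` \<Omega>. (LINT x|lebesgue_on (cell N y). v x)\<^sup>2 / measure lebesgue (cell N y))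
    + exp 1 * (DIM('a) / N)\<^sup>2 / 2 * (LINT x|M. (norm (V x))\<^sup>2)"
    by (simp only: sum.distrib integral_sum_cells[OF i(2), of N] sum_distrib_left)
  finally show ?thesis .
qed

text \<open>The integrals over all cells of all grids form a countable family of bounded sequences,
  so one subsequence makes all of them converge. On a fixed fine grid the L2 distance is then
  governed by finitely many convergent numbers and a small multiple of the gradient energy.\<close>

theorem rellich:
  assumes H: "\<And>m. H1_on \<Omega> (v m) (V m)" and conv: "convex \<Omega>"
    and B: "\<And>m. (LINT x|M. (v m x)\<^sup>2) \<le> B" "\<And>m. (LINT x|M. (norm (V m x))\<^sup>2) \<le> B"
  shows "\<exists>r :: nat \<Rightarrow> nat. strict_mono r \<and>
    (\<forall>e>0. \<exists>N. \<forall>m\<ge>N. \<forall>n\<ge>N. (LINT x|M. (v (r m) x - v (r n) x)\<^sup>2) < e)"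
proof -
  have v: "sq_integrable M (v m)" and V: "sq_integrable M (V m)" for m using H by (auto simp: H1_on_iff)
  have iv: "integrable M (v m)" for m by (rule sq_integrable_integrable[OF finite_measure_axioms v])
  define S where "S = (\<Union>N. Pair N ` (cell_index N ` \<Omega>))"
  define f where "f m = (\<lambda>(N, y). LINT x|lebesgue_on (cell N y). v m x)" for m
  have cS: "countable S" unfolding S_def
    using countable_finite[OF finite_imageI[OF finite_cells]] by (intro countable_UN) auto
  have bd: "norm (f m s) \<le> measure M \<Omega> + B" if "s \<in> S" for m s
  proof -
    obtain N y where s: "s = (N, y)" by (cases s)
    have cM: "cell N y \<in> sets M" using cell_borel(2) cell_subset sets_\<Omega> by (auto simp: sets_restrict_space_iff)
    have "f m s = (LINT x|M. indicator (cell N y) x *\<^sub>R v m x)"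
      by (simp add: s f_def integral_lebesgue_on_subset[OF cell_subset cell_borel(2)])
    also have "\<bar>\<dots>\<bar> \<le> (LINT x|M. 1 + (v m x)\<^sup>2)"
    proof (rule order_trans[OF integral_abs_bound integral_mono])
      show "integrable M (\<lambda>x. \<bar>indicator (cell N y) x *\<^sub>R v m x\<bar>)"
        using integrable_abs[OF integrable_mult_indicator[OF cM iv]] .
      show "integrable M (\<lambda>x. 1 + (v m x)\<^sup>2)" using v[of m] by (simp add: sq_integrable_def)
      fix x
      have "\<bar>v m x\<bar> \<le> 1 + (v m x)\<^sup>2"
        using zero_le_power2[of "\<bar>v m x\<bar> - 1"] zero_le_power2[of "v m x"] by (simp add: power2_diff)
      then show "\<bar>indicator (cell N y) x *\<^sub>R v m x\<bar> \<le> 1 + (v m x)\<^sup>2" by (auto simp: indicator_def)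
    qed
    also have "\<dots> \<le> measure M \<Omega> + B" using v[of m] B(1)[of m] by (simp add: sq_integrable_def)
    finally show ?thesis by simp
  qed
  obtain r where r: "strict_mono r" "\<And>s. s \<in> S \<Longrightarrow> \<exists>l. (\<lambda>n. f (r n) s) \<longlonglongrightarrow> l"
    using function_convergent_subsequence[of S f "measure M \<Omega> + B", OF cS bd] by blast
  have "\<exists>M0. \<forall>m\<ge>M0. \<forall>n\<ge>M0. (LINT x|M. (v (r m) x - v (r n) x)\<^sup>2) < e" if e: "0 < e" for e
  proof -
    \<comment> \<open>The mesh is fixed first, so that the gradient term is below
      \<open>e / 2\<close> for all pairs of indices; the gradient of a difference of two members has
      energy at most \<open>4 * B\<close>.\<close>
    have "(\<lambda>N. exp 1 * (DIM('a) / real N)\<^sup>2 / 2 * (4 * B)) \<longlonglongrightarrow> 0" by real_asymp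
    then have "\<forall>\<^sub>F N in sequentially. exp 1 * (DIM('a) / real N)\<^sup>2 / 2 * (4 * B) < e / 2"
      using e by (intro order_tendstoD(2)[where y=0]) auto
    with eventually_gt_at_top[of 0] obtain N where N: "0 < N" "exp 1 * (DIM('a) / real N)\<^sup>2 / 2 * (4 * B) < e / 2"
      using eventually_happens[OF eventually_conj[of "\<lambda>N. 0 < N" sequentially]] by auto
    let ?Y = "cell_index N ` \<Omega>"
    define a where "a y = measure lebesgue (cell N y)" for y
    define \<delta> where "\<delta> = e / (2 * (card ?Y + 1))"
    have \<delta>: "0 < \<delta>" using e by (simp add: \<delta>_def add_pos_nonneg)
    have "\<exists>K. \<forall>m\<ge>K. \<forall>n\<ge>K. (f (r m) (N, y) - f (r n) (N, y))\<^sup>2 / a y < \<delta>" if "y \<in> ?Y" for y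
    \<comment> \<open>On a cell of measure 0 the quotient is 0 by the convention for division, and
      any index will do.\<close>
    proof (cases "a y = 0")
      case False
      then have a: "0 < a y" by (simp add: a_def less_le)
      have "(N, y) \<in> S" using that by (auto simp: S_def)
      then have "Cauchy (\<lambda>n. f (r n) (N, y))" using r(2) by (auto intro: LIMSEQ_imp_Cauchy)
      then obtain K where K: "\<And>m n. K \<le> m \<Longrightarrow> K \<le> n \<Longrightarrow> norm (f (r m) (N, y) - f (r n) (N, y)) < sqrt (\<delta> * a y)"
        using a \<delta> unfolding Cauchy_iff by (metis mult_pos_pos real_sqrt_gt_zero)
      have "(f (r m) (N, y) - f (r n) (N, y))\<^sup>2 / a y < \<delta>" if "K \<le> m" "K \<le> n" for m n
      proof -
        have "(norm (f (r m) (N, y) - f (r n) (N, y)))\<^sup>2 < (sqrt (\<delta> * a y))\<^sup>2"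
          using K[OF that] by (intro power_strict_mono) auto
        then show ?thesis using a \<delta> by (simp add: field_simps)
      qed
      then show ?thesis by blast
    qed (use \<delta> in auto)
    then obtain K where K: "\<And>y m n. y \<in> ?Y \<Longrightarrow> K y \<le> m \<Longrightarrow> K y \<le> n \<Longrightarrow> (f (r m) (N, y) - f (r n) (N, y))\<^sup>2 / a y < \<delta>"
      by metis
    have "(LINT x|M. (v (r m) x - v (r n) x)\<^sup>2) < e" if mn: "(\<Sum>y\<in>?Y. K y) \<le> m" "(\<Sum>y\<in>?Y. K y) \<le> n" for m n
    proof -
      have Hd: "H1_on \<Omega> (\<lambda>x. v (r m) x - v (r n) x) (\<lambda>x. V (r m) x - V (r n) x)"
        using H1_on_lincomb[OF H[of "r m"] H[of "r n"], of "-1"] by simp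
      have fd: "(LINT x|lebesgue_on (cell N y). v (r m) x - v (r n) x) = f (r m) (N, y) - f (r n) (N, y)" for y
      proof -
        have "integrable (lebesgue_on (cell N y)) (v k)" for k
        proof (rule sq_integrable_integrable)
          show "finite_measure (lebesgue_on (cell N y))"
            by (intro finite_measure_lebesgue_on bounded_set_imp_lmeasurable bounded_subset[OF bounded_\<Omega> cell_subset] cell_borel)
          show "sq_integrable (lebesgue_on (cell N y)) (v k)"
            by (rule sq_integrable_lebesgue_on_subset(1)[OF v cell_subset cell_borel(2) sets_\<Omega>(1)])
        qed
        then show ?thesis by (simp add: f_def)
      qed
      have "(\<Sum>y\<in>?Y. (f (r m) (N, y) - f (r n) (N, y))\<^sup>2 / a y) \<le> (\<Sum>y\<in>?Y. \<delta>)"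
      proof (rule sum_mono)
        fix y assume y: "y \<in> ?Y"
        then have "K y \<le> (\<Sum>y\<in>?Y. K y)" by (intro member_le_sum finite_cells) auto
        then have "K y \<le> m" "K y \<le> n" using mn by auto
        then show "(f (r m) (N, y) - f (r n) (N, y))\<^sup>2 / a y \<le> \<delta>" by (rule less_imp_le[OF K[OF y]])
      qed
      also have "\<dots> \<le> e / 2"
        using e by (simp add: \<delta>_def field_simps)
      finally have s1: "(\<Sum>y\<in>?Y. (f (r m) (N, y) - f (r n) (N, y))\<^sup>2 / a y) \<le> e / 2" .
      have "(LINT x|M. (norm (V (r m) x - V (r n) x))\<^sup>2) \<le> (LINT x|M. 2 * (norm (V (r m) x))\<^sup>2 + 2 * (norm (V (r n) x))\<^sup>2)"
      proof (rule integral_mono)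
        fix x
        have "(norm (V (r m) x - V (r n) x))\<^sup>2 \<le> (norm (V (r m) x) + norm (V (r n) x))\<^sup>2" by (intro power_mono norm_triangle_ineq4) auto
        also have "\<dots> \<le> 2 * (norm (V (r m) x))\<^sup>2 + 2 * (norm (V (r n) x))\<^sup>2"
          using zero_le_power2[of "norm (V (r m) x) - norm (V (r n) x)"] by (simp add: power2_eq_square algebra_simps)
        finally show "(norm (V (r m) x - V (r n) x))\<^sup>2 \<le> 2 * (norm (V (r m) x))\<^sup>2 + 2 * (norm (V (r n) x))\<^sup>2" .
      qed (use V Hd in \<open>auto simp: sq_integrable_def H1_on_iff\<close>)
      also have "\<dots> = 2 * (LINT x|M. (norm (V (r m) x))\<^sup>2) + 2 * (LINT x|M. (norm (V (r n) x))\<^sup>2)"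
        using V by (simp add: sq_integrable_def)
      also have "\<dots> \<le> 4 * B" using B(2)[of "r m"] B(2)[of "r n"] by simp
      finally have "exp 1 * (DIM('a) / real N)\<^sup>2 / 2 * (LINT x|M. (norm (V (r m) x - V (r n) x))\<^sup>2) \<le> exp 1 * (DIM('a) / real N)\<^sup>2 / 2 * (4 * B)"
        by (intro mult_left_mono) auto
      then show ?thesis
        using square_le_sum_cells[OF Hd conv N(1)] s1 N(2) unfolding fd a_def by linarith
    qed
    then show ?thesis by blast
  qed
  then show ?thesis using r(1) by (intro exI[of _ r]) simp
qed

end

section \<open>The Neumann operator of a Gaussian density\<close>

locale gauss_domain = bounded_domain \<Omega> for \<Omega> :: "'a::euclidean_space set" +
  fixes j :: nat
  assumes convex_\<Omega>: "convex \<Omega>" and zero_in: "0 \<in> \<Omega>" and j: "1 \<le> j"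
begin

abbreviation \<sigma> :: "'a \<Rightarrow> real" where "\<sigma> \<equiv> gauss_density j"

text \<open>The reciprocal of the density, as a function smooth on the whole space: multiplying a
  test function by it removes the weight.\<close>

definition \<tau> :: "'a \<Rightarrow> real" where "\<tau> x = exp (real j * (norm x)\<^sup>2)"

lemma smooth_\<sigma>: "smooth_on UNIV \<sigma>" and grad_\<sigma>: "grad \<sigma> x = (- 2 * real j * \<sigma> x) *\<^sub>R x"
  using smooth_exp_square_norm[of "- real j", where 'a='a] grad_exp_square_norm[of "- real j" x]
  by (simp_all add: gauss_density_def[abs_def])

lemma smooth_\<tau>: "smooth_on UNIV \<tau>" and grad_\<tau>: "grad \<tau> x = (2 * real j * \<tau> x) *\<^sub>R x"
  using smooth_exp_square_norm[of "real j", where 'a='a] grad_exp_square_norm[of "real j" x]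
  by (simp_all add: \<tau>_def[abs_def])

lemma \<sigma>_pos: "0 < \<sigma> x" and \<sigma>_le_1: "\<sigma> x \<le> 1" and \<sigma>_\<tau>: "\<sigma> x * \<tau> x = 1"
  by (simp_all add: gauss_density_def \<tau>_def flip: exp_add)

lemma \<sigma>_measurable[measurable]: "\<sigma> \<in> borel_measurable M"
  by (intro measurable_lebesgue_on_continuous smooth_on_UNIV_continuous smooth_\<sigma>)

lemma \<sigma>_lower: obtains s where "0 < s" "\<And>x. x \<in> \<Omega> \<Longrightarrow> s \<le> \<sigma> x"
proof -
  obtain D where D: "\<And>x. x \<in> \<Omega> \<Longrightarrow> norm x \<le> D" using bounded_\<Omega> by (auto simp: bounded_iff)
  show thesis
  proof (rule that[of "exp (- (real j * D\<^sup>2))"])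
    fix x assume "x \<in> \<Omega>"
    then have "real j * (norm x)\<^sup>2 \<le> real j * D\<^sup>2" using D by (intro mult_left_mono power_mono) auto
    then show "exp (- (real j * D\<^sup>2)) \<le> \<sigma> x" by (simp add: gauss_density_def)
  qed simp
qed

text \<open>With the weight absorbed into a measure, the L2 facts proved for arbitrary measures
  apply to the weighted space. Since the density lies between a positive constant and 1 on \<Omega>,
  both spaces have the same elements.\<close>

definition nu :: "'a measure" where "nu = density M (\<lambda>x. ennreal (\<sigma> x))"

lemma measurable_nu: "f \<in> borel_measurable nu \<longleftrightarrow> f \<in> borel_measurable M"
  by (simp add: nu_def)

lemma integral_nu:
  fixes f :: "'a \<Rightarrow> real"
  assumes "f \<in> borel_measurable M"
  shows "(LINT x|nu. f x) = (LINT x|M. f x * \<sigma> x)"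
  unfolding nu_def using assms \<sigma>_pos by (subst integral_density) (auto simp: mult.commute less_imp_le)

lemma integrable_nu_iff:
  fixes f :: "'a \<Rightarrow> real"
  assumes m: "f \<in> borel_measurable M"
  shows "integrable nu f \<longleftrightarrow> integrable M f"
proof -
  have e: "integrable nu f \<longleftrightarrow> integrable M (\<lambda>x. \<sigma> x * f x)"
    unfolding nu_def using m \<sigma>_pos by (subst integrable_density) (auto simp: less_imp_le)
  show ?thesis
  proof
    assume "integrable nu f"
    then have i: "integrable M (\<lambda>x. \<sigma> x * f x)" by (simp add: e)
    obtain s where s: "0 < s" "\<And>x. x \<in> \<Omega> \<Longrightarrow> s \<le> \<sigma> x" using \<sigma>_lower by blast
    show "integrable M f"
    proof (rule Bochner_Integration.integrable_bound)
      show "integrable M (\<lambda>x. (1 / s) * (\<sigma> x * f x))" using i by simp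
      show "AE x in M. norm (f x) \<le> norm ((1 / s) * (\<sigma> x * f x))"
      proof (intro AE_I2)
        fix x assume "x \<in> space M"
        then have "s * \<bar>f x\<bar> \<le> \<sigma> x * \<bar>f x\<bar>" using s by (intro mult_right_mono) auto
        then show "norm (f x) \<le> norm ((1 / s) * (\<sigma> x * f x))"
          using s \<sigma>_pos[of x] by (simp add: abs_mult field_simps)
      qed
    qed fact
  next
    assume i: "integrable M f"
    have "integrable M (\<lambda>x. \<sigma> x * f x)"
    proof (rule Bochner_Integration.integrable_bound[OF i])
      show "AE x in M. norm (\<sigma> x * f x) \<le> norm (f x)"
        using \<sigma>_pos \<sigma>_le_1 by (intro AE_I2) (simp add: abs_mult mult_left_le_one_le less_imp_le)
    qed (use m in measurable)
    then show "integrable nu f" by (simp add: e)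
  qed
qed

lemma sq_integrable_nu: "sq_integrable nu f \<longleftrightarrow> sq_integrable M f"
proof (cases "f \<in> borel_measurable M")
  case True
  then have "(\<lambda>x. (norm (f x))\<^sup>2) \<in> borel_measurable M" by measurable
  from integrable_nu_iff[OF this] show ?thesis using True by (simp add: sq_integrable_def measurable_nu)
qed (simp add: sq_integrable_def measurable_nu)

lemma integrable_nu_sq: "sq_integrable M f \<Longrightarrow> integrable nu (\<lambda>x. (norm (f x))\<^sup>2)"
  using sq_integrable_nu[of f] by (simp add: sq_integrable_def)

sublocale nu: finite_measure nu
proof
  have "integrable nu (\<lambda>_. 1::real)" by (simp add: integrable_nu_iff)
  then have "(\<integral>\<^sup>+x. ennreal (norm (1::real)) \<partial>nu) < \<infinity>" by (simp add: integrable_iff_bounded del: nn_integral_const)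
  then show "emeasure nu (space nu) \<noteq> \<infinity>" by simp
qed

lemma integral_nu_bounds:
  assumes f: "sq_integrable M f" and s: "0 < s" "\<And>x. x \<in> \<Omega> \<Longrightarrow> s \<le> \<sigma> x"
  shows "(LINT x|nu. (norm (f x))\<^sup>2) \<le> (LINT x|M. (norm (f x))\<^sup>2)"
    "s * (LINT x|M. (norm (f x))\<^sup>2) \<le> (LINT x|nu. (norm (f x))\<^sup>2)"
proof -
  have m: "(\<lambda>x. (norm (f x))\<^sup>2) \<in> borel_measurable M" using sq_integrable_measurable[OF f] by measurable
  have i: "integrable M (\<lambda>x. (norm (f x))\<^sup>2)" using f by (simp add: sq_integrable_def)
  have i2: "integrable M (\<lambda>x. (norm (f x))\<^sup>2 * \<sigma> x)"
    by (rule Bochner_Integration.integrable_bound[OF i])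
       (use m \<sigma>_pos \<sigma>_le_1 in \<open>auto intro!: AE_I2 mult_left_le simp: abs_mult less_imp_le\<close>)
  show "(LINT x|nu. (norm (f x))\<^sup>2) \<le> (LINT x|M. (norm (f x))\<^sup>2)"
    unfolding integral_nu[OF m] using \<sigma>_le_1 by (intro integral_mono i i2) (simp add: mult_left_le)
  have "(LINT x|M. (norm (f x))\<^sup>2 * s) \<le> (LINT x|M. (norm (f x))\<^sup>2 * \<sigma> x)"
    using s i by (intro integral_mono i2) (auto intro: mult_left_mono)
  then show "s * (LINT x|M. (norm (f x))\<^sup>2) \<le> (LINT x|nu. (norm (f x))\<^sup>2)"
    unfolding integral_nu[OF m] by (simp add: mult.commute)
qed

lemma L2_tendsto_nu: "L2_tendsto nu f g \<Longrightarrow> L2_tendsto M f g"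
proof -
  assume fg: "L2_tendsto nu f g"
  obtain s where s: "0 < s" "\<And>x. x \<in> \<Omega> \<Longrightarrow> s \<le> \<sigma> x" using \<sigma>_lower by blast
  have sq: "sq_integrable M (f n)" "sq_integrable M g" for n using fg by (auto simp: L2_tendsto_def sq_integrable_nu)
  have "(\<lambda>n. (1 / s) * (LINT x|nu. (norm (f n x - g x))\<^sup>2)) \<longlonglongrightarrow> (1 / s) * 0"
    using fg by (intro tendsto_mult tendsto_const) (simp add: L2_tendsto_def)
  then have lim: "(\<lambda>n. (1 / s) * (LINT x|nu. (norm (f n x - g x))\<^sup>2)) \<longlonglongrightarrow> 0" by simp
  have "(\<lambda>n. LINT x|M. (norm (f n x - g x))\<^sup>2) \<longlonglongrightarrow> 0"
  proof (rule tendsto_sandwich[OF _ _ tendsto_const lim])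
    show "\<forall>\<^sub>F n in sequentially. (LINT x|M. (norm (f n x - g x))\<^sup>2) \<le> (1 / s) * (LINT x|nu. (norm (f n x - g x))\<^sup>2)"
      using integral_nu_bounds(2)[OF sq_integrable_diff[OF sq] s] s(1)
      by (intro always_eventually allI) (simp add: field_simps)
  qed simp
  then show ?thesis using sq by (auto simp: L2_tendsto_def)
qed

lemma nu_pos: "0 < (LINT x|nu. (1::real))"
proof -
  obtain s where s: "0 < s" "\<And>x. x \<in> \<Omega> \<Longrightarrow> s \<le> \<sigma> x" using \<sigma>_lower by blast
  have sq1: "sq_integrable M (\<lambda>_. 1::real)" by (rule sq_integrable_const[OF finite_measure_axioms])
  have "0 < measure lebesgue \<Omega>"
  proof -
    have "measure lebesgue \<Omega> \<noteq> 0"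
      using open_not_negligible[OF open_\<Omega>] zero_in lmeasurable_\<Omega> by (auto simp: negligible_iff_measure)
    then show ?thesis by (simp add: less_le)
  qed
  then have "0 < s * (LINT x|M. (norm (1::real))\<^sup>2)"
    using s sets_\<Omega> by (simp add: measure_restrict_space)
  also have "\<dots> \<le> (LINT x|nu. (norm (1::real))\<^sup>2)" by (rule integral_nu_bounds(2)[OF sq1 s])
  finally show ?thesis by simp
qed

lemma mean_zero_shift:
  assumes "sq_integrable M v"
  shows "(LINT x|nu. v x - (LINT x|nu. v x) / (LINT x|nu. (1::real))) = 0"
proof -
  have "integrable nu v" using assms by (intro sq_integrable_integrable nu.finite_measure_axioms) (simp add: sq_integrable_nu)
  then show ?thesis using nu_pos by simp
qed

lemma H1_on_const: "H1_on \<Omega> (\<lambda>_. c) (\<lambda>_. 0)"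
proof -
  have "smooth_on UNIV (\<lambda>_::'a. c)" by (simp add: smooth_on_def Ck_on_const)
  moreover have "grad (\<lambda>_::'a. c) = (\<lambda>_. 0)"
  proof
    fix x :: 'a
    have "((\<lambda>_::'a. c) has_derivative (\<bullet>) 0) (at x)"
      using has_derivative_const[of c "at x"] by (simp add: inner_zero_left[abs_def])
    then show "grad (\<lambda>_::'a. c) x = 0" by (rule grad_eqI)
  qed
  ultimately show ?thesis using H1_on_smooth by metis
qed

lemma H1_on_shift: "H1_on \<Omega> v V \<Longrightarrow> H1_on \<Omega> (\<lambda>x. v x - c) V"
  using H1_on_lincomb[OF _ H1_on_const[of c], of v V "-1"] by simp

lemma H1_on_scale: "H1_on \<Omega> v V \<Longrightarrow> H1_on \<Omega> (\<lambda>x. c * v x) (\<lambda>x. c *\<^sub>R V x)"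
  using H1_on_lincomb[OF H1_on_const[of 0], of v V c] by simp

lemma H1_on_coordinate:
  assumes "i \<in> Basis" shows "H1_on \<Omega> (\<lambda>x. x \<bullet> i) (\<lambda>_. i)"
proof -
  have "smooth_on UNIV (\<lambda>x. x \<bullet> i)" by (simp add: smooth_on_def Ck_on_inner)
  moreover have "grad (\<lambda>x. x \<bullet> i) = (\<lambda>_. i)"
  proof
    fix x
    have "((\<lambda>x. x \<bullet> i) has_derivative (\<lambda>v. v \<bullet> i)) (at x)" by (intro has_derivative_inner_left has_derivative_ident)
    then have "((\<lambda>x. x \<bullet> i) has_derivative (\<lambda>v. i \<bullet> v)) (at x)" by (simp add: inner_commute)
    then show "grad (\<lambda>x. x \<bullet> i) x = i" by (rule grad_eqI)
  qed
  ultimately show ?thesis using H1_on_smooth by metis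
qed

text \<open>A hyperplane is negligible and a nonempty open set is not. This makes the set of
  Rayleigh quotients nonempty, so that its infimum is meaningful.\<close>

lemma coordinate_not_const:
  assumes i: "i \<in> Basis" shows "0 < (LINT x|nu. (x \<bullet> i - c)\<^sup>2)"
proof -
  have H: "H1_on \<Omega> (\<lambda>x. x \<bullet> i - c) (\<lambda>_. i)" by (rule H1_on_shift[OF H1_on_coordinate[OF i]])
  then have sq: "sq_integrable M (\<lambda>x. x \<bullet> i - c)" by (simp add: H1_on_iff)
  obtain s where s: "0 < s" "\<And>x. x \<in> \<Omega> \<Longrightarrow> s \<le> \<sigma> x" using \<sigma>_lower by blast
  have im: "integrable M (\<lambda>x. (norm (x \<bullet> i - c))\<^sup>2)" using sq by (simp add: sq_integrable_def)
  have "(LINT x|M. (norm (x \<bullet> i - c))\<^sup>2) \<noteq> 0"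
  proof
    assume "(LINT x|M. (norm (x \<bullet> i - c))\<^sup>2) = 0"
    then have "AE x in M. x \<bullet> i = c" using integral_nonneg_eq_0_iff_AE[OF im] by simp
    then have "AE x in lebesgue. x \<in> \<Omega> \<longrightarrow> x \<bullet> i = c" by (simp add: AE_restrict_space_iff sets_\<Omega>)
    moreover have "AE x in lebesgue. x \<bullet> i \<noteq> c"
    proof -
      have "negligible {x. i \<bullet> x = c}" using i by (intro negligible_hyperplane) (auto simp: nonzero_Basis)
      then have "{x. i \<bullet> x = c} \<in> null_sets lebesgue" by (simp add: negligible_iff_null_sets)
      from AE_not_in[OF this] show ?thesis by (simp add: inner_commute)
    qed
    ultimately have "AE x in lebesgue. x \<notin> \<Omega>" by eventually_elim auto
    then have "\<Omega> \<in> null_sets lebesgue" by (subst (asm) AE_iff_null) (auto simp: sets_\<Omega>)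
    then show False using open_not_negligible[OF open_\<Omega>] zero_in by (auto simp: negligible_iff_null_sets)
  qed
  moreover have "0 \<le> (LINT x|M. (norm (x \<bullet> i - c))\<^sup>2)" by simp
  ultimately have "0 < (LINT x|M. (norm (x \<bullet> i - c))\<^sup>2)" by linarith
  then have "0 < s * (LINT x|M. (norm (x \<bullet> i - c))\<^sup>2)" using s by (intro mult_pos_pos)
  also have "\<dots> \<le> (LINT x|nu. (norm (x \<bullet> i - c))\<^sup>2)" by (rule integral_nu_bounds(2)[OF sq s])
  finally show ?thesis by simp
qed

text \<open>The direct method. Compactness gives strong convergence of a minimising subsequence,
  which preserves both constraints, mean 0 and norm 1. The minimum is not named separately: it is
  the energy of \<open>G\<close>.\<close>

theorem rayleigh_minimizer:
  obtains u G where "H1_on \<Omega> u G" "(LINT x|nu. u x) = 0" "(LINT x|nu. (u x)\<^sup>2) = 1"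
    "\<And>v V. H1_on \<Omega> v V \<Longrightarrow> (LINT x|nu. v x) = 0 \<Longrightarrow>
      (LINT x|nu. (norm (G x))\<^sup>2) * (LINT x|nu. (v x)\<^sup>2) \<le> (LINT x|nu. (norm (V x))\<^sup>2)"
proof -
  define P where "P u G \<longleftrightarrow> H1_on \<Omega> u G \<and> (LINT x|nu. u x) = 0 \<and> (LINT x|nu. (u x)\<^sup>2) = 1" for u G
  define A where "A = {a. \<exists>u G. P u G \<and> a = (LINT x|nu. (norm (G x))\<^sup>2)}"
  define \<Lambda> where "\<Lambda> = Inf A"
  have normalise: "\<exists>u G. P u G \<and> (LINT x|nu. (norm (G x))\<^sup>2) = (LINT x|nu. (norm (V x))\<^sup>2) / (LINT x|nu. (v x)\<^sup>2)"
    if "H1_on \<Omega> v V" "(LINT x|nu. v x) = 0" "0 < (LINT x|nu. (v x)\<^sup>2)" for v V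
  proof -
    define c where "c = 1 / sqrt (LINT x|nu. (v x)\<^sup>2)"
    have c: "c\<^sup>2 = 1 / (LINT x|nu. (v x)\<^sup>2)" using that(3) by (simp add: c_def power_divide)
    have "P (\<lambda>x. c * v x) (\<lambda>x. c *\<^sub>R V x)"
      unfolding P_def using that H1_on_scale[OF that(1), of c] by (simp add: power_mult_distrib c)
    moreover have "(LINT x|nu. (norm (c *\<^sub>R V x))\<^sup>2) = (LINT x|nu. (norm (V x))\<^sup>2) / (LINT x|nu. (v x)\<^sup>2)"
      by (simp add: power_mult_distrib c)
    ultimately show ?thesis by blast
  qed
  obtain i :: 'a where i: "i \<in> Basis" using nonempty_Basis by blast
  have Ane: "A \<noteq> {}"
  proof -
    let ?c = "(LINT x|nu. x \<bullet> i) / (LINT x|nu. (1::real))"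
    have H: "H1_on \<Omega> (\<lambda>x. x \<bullet> i) (\<lambda>_. i)" by (rule H1_on_coordinate[OF i])
    then have "(LINT x|nu. x \<bullet> i - ?c) = 0" by (intro mean_zero_shift) (simp add: H1_on_iff)
    from normalise[OF H1_on_shift[OF H] this coordinate_not_const[OF i]] show ?thesis unfolding A_def by blast
  qed
  have A0: "0 \<le> a" if "a \<in> A" for a using that by (auto simp: A_def)
  have bdd: "bdd_below A" using A0 by (rule bdd_belowI)
  have \<Lambda>0: "0 \<le> \<Lambda>" unfolding \<Lambda>_def using Ane A0 by (intro cInf_greatest) auto
  have min: "\<Lambda> * (LINT x|nu. (v x)\<^sup>2) \<le> (LINT x|nu. (norm (V x))\<^sup>2)"
    if H: "H1_on \<Omega> v V" "(LINT x|nu. v x) = 0" for v V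
  proof (cases "(LINT x|nu. (v x)\<^sup>2) = 0")
    case False
    then have pos: "0 < (LINT x|nu. (v x)\<^sup>2)" by (simp add: less_le)
    have "(LINT x|nu. (norm (V x))\<^sup>2) / (LINT x|nu. (v x)\<^sup>2) \<in> A"
      using normalise[OF H pos] unfolding A_def by force
    then have "\<Lambda> \<le> (LINT x|nu. (norm (V x))\<^sup>2) / (LINT x|nu. (v x)\<^sup>2)"
      unfolding \<Lambda>_def using bdd by (rule cInf_lower)
    then show ?thesis using pos by (simp add: field_simps)
  qed simp
  have "\<exists>u G. P u G \<and> (LINT x|nu. (norm (G x))\<^sup>2) < \<Lambda> + 1 / (real k + 1)" for k
  proof -
    have "\<Lambda> < \<Lambda> + 1 / (real k + 1)" by simp
    then obtain a where "a \<in> A" "a < \<Lambda> + 1 / (real k + 1)"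
      unfolding \<Lambda>_def using cInf_less_iff[OF Ane bdd] by blast
    then show ?thesis unfolding A_def by blast
  qed
  then obtain u G where uG: "\<And>k. P (u k) (G k)" "\<And>k. (LINT x|nu. (norm (G k x))\<^sup>2) < \<Lambda> + 1 / (real k + 1)"
    by metis
  have H: "H1_on \<Omega> (u k) (G k)" and mean: "(LINT x|nu. u k x) = 0" and norm1: "(LINT x|nu. (u k x)\<^sup>2) = 1" for k
    using uG(1) by (auto simp: P_def)
  have squ: "sq_integrable M (u k)" "sq_integrable M (G k)" for k using H by (auto simp: H1_on_iff)
  obtain s where s: "0 < s" "\<And>x. x \<in> \<Omega> \<Longrightarrow> s \<le> \<sigma> x" using \<sigma>_lower by blast
  have G1: "(LINT x|nu. (norm (G k x))\<^sup>2) \<le> \<Lambda> + 1" for k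
  proof -
    have "1 / (real k + 1) \<le> 1" by simp
    then show ?thesis using uG(2)[of k] by linarith
  qed
  have div: "X \<le> (\<Lambda> + 1) / s" if "s * X \<le> Y" "Y \<le> \<Lambda> + 1" for X Y
    using that s(1) by (simp add: pos_le_divide_eq mult.commute[of X])
  have bounds: "(LINT x|M. (u k x)\<^sup>2) \<le> (\<Lambda> + 1) / s" "(LINT x|M. (norm (G k x))\<^sup>2) \<le> (\<Lambda> + 1) / s" for k
  proof -
    have "s * (LINT x|M. (u k x)\<^sup>2) \<le> (LINT x|nu. (u k x)\<^sup>2)"
      using integral_nu_bounds(2)[OF squ(1) s, of k] by (simp only: real_norm_def power2_abs)
    then show "(LINT x|M. (u k x)\<^sup>2) \<le> (\<Lambda> + 1) / s"
      by (rule div) (simp only: norm1, use \<Lambda>0 in simp)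
    show "(LINT x|M. (norm (G k x))\<^sup>2) \<le> (\<Lambda> + 1) / s"
      by (rule div[OF integral_nu_bounds(2)[OF squ(2)[of k] s] G1[of k]])
  qed
  obtain r :: "nat \<Rightarrow> nat" where r: "strict_mono r" and rc: "\<forall>e>0. \<exists>N. \<forall>m\<ge>N. \<forall>n\<ge>N. (LINT x|M. (u (r m) x - u (r n) x)\<^sup>2) < e"
    using rellich[where v=u and V=G, OF H convex_\<Omega> bounds] by blast
  \<comment> \<open>Functions and gradients are completed together, so one limit has both a function
    and a field as components; these are then recognised as a pair in H1 because the weak gradient
    is closed.\<close>
  define F where "F m x = (u (r m) x, G (r m) x)" for m x
  have sqF: "sq_integrable nu (F m)" for m unfolding F_def sq_integrable_nu sq_integrable_Pair using squ by simp
  have sqd: "sq_integrable M (\<lambda>x. u (r m) x - u (r n) x)" "sq_integrable M (\<lambda>x. G (r m) x - G (r n) x)" for m n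
    by (intro sq_integrable_diff squ)+
  \<comment> \<open>By the parallelogram law, a minimising sequence that converges in \<open>L\<^sup>2\<close> also has converging gradients.\<close>
  have par: "(LINT x|nu. (norm (G m x - G n x))\<^sup>2) \<le> 2 / (real m + 1) + 2 / (real n + 1) + \<Lambda> * (LINT x|nu. (u m x - u n x)\<^sup>2)" for m n
  proof -
    have nsq: "sq_integrable nu (u k)" "sq_integrable nu (G k)" for k
      unfolding sq_integrable_nu by (rule squ)+
    have i: "integrable nu (\<lambda>x. (norm (G k x))\<^sup>2)" "integrable nu (\<lambda>x. (u k x)\<^sup>2)" "integrable nu (\<lambda>x. G k x \<bullet> G l x)"
      "integrable nu (\<lambda>x. u k x * u l x)" "integrable nu (u k)" for k l
      using sq_integrable_inner[of nu "G k" "G l"] sq_integrable_mult[of nu "u k" "u l"] nsq(2)[of k, unfolded sq_integrable_def]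
        sq_integrable_mult[of nu "u k" "u k"] sq_integrable_integrable[OF nu.finite_measure_axioms, of "u k"]
      by (simp_all add: nsq power2_eq_square)
    have p1: "(norm (G m x - G n x))\<^sup>2 = (norm (G m x))\<^sup>2 - 2 * (G m x \<bullet> G n x) + (norm (G n x))\<^sup>2"
      "(norm (G m x + G n x))\<^sup>2 = (norm (G m x))\<^sup>2 + 2 * (G m x \<bullet> G n x) + (norm (G n x))\<^sup>2"
      "(u m x - u n x)\<^sup>2 = (u m x)\<^sup>2 - 2 * (u m x * u n x) + (u n x)\<^sup>2"
      "(u m x + u n x)\<^sup>2 = (u m x)\<^sup>2 + 2 * (u m x * u n x) + (u n x)\<^sup>2" for x
      unfolding power2_norm_eq_inner
      by (simp_all add: inner_diff_left inner_diff_right inner_add_left inner_add_right inner_commute power2_eq_square algebra_simps)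
    have H2: "H1_on \<Omega> (\<lambda>x. u m x + u n x) (\<lambda>x. G m x + G n x)"
      using H1_on_lincomb[OF H[of m] H[of n], of 1] by simp
    have "(LINT x|nu. u m x + u n x) = 0" using i(5) mean by simp
    from min[OF H2 this] have e1: "\<Lambda> * (2 + 2 * (LINT x|nu. u m x * u n x))
      \<le> (LINT x|nu. (norm (G m x))\<^sup>2) + 2 * (LINT x|nu. G m x \<bullet> G n x) + (LINT x|nu. (norm (G n x))\<^sup>2)"
      unfolding p1 using i norm1 by simp
    have e2: "(LINT x|nu. (norm (G m x - G n x))\<^sup>2) = (LINT x|nu. (norm (G m x))\<^sup>2) - 2 * (LINT x|nu. G m x \<bullet> G n x) + (LINT x|nu. (norm (G n x))\<^sup>2)"
      unfolding p1 using i by simp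
    have e3: "(LINT x|nu. (u m x - u n x)\<^sup>2) = 2 - 2 * (LINT x|nu. u m x * u n x)"
      unfolding p1 using i norm1 by simp
    \<comment> \<open>Pure arithmetic: \<open>d\<close> is twice the sum of the energies
      \<open>a\<close> and \<open>c\<close> minus the energy of the sum, and the latter is at least
      \<open>L * (2 + 2 * p)\<close> by minimality.\<close>
    have "d \<le> 2 * x + 2 * y + L * U" if "L * (2 + 2 * p) \<le> a + 2 * b + c" "d = a - 2 * b + c" "U = 2 - 2 * p" "a < L + x" "c < L + y"
      for d x y L U p a b c :: real
      using that(1,2,4,5) unfolding that(3) by (simp add: algebra_simps)
    from this[OF e1 e2 e3 uG(2)[of m] uG(2)[of n]] show ?thesis by simp
  qed
  have CF: "\<exists>N. \<forall>m\<ge>N. \<forall>n\<ge>N. (LINT x|nu. (norm (F m x - F n x))\<^sup>2) < e" if e: "0 < e" for e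
  proof -
    obtain N1 where N1: "\<And>m n. N1 \<le> m \<Longrightarrow> N1 \<le> n \<Longrightarrow> (LINT x|M. (u (r m) x - u (r n) x)\<^sup>2) < e / (2 * (\<Lambda> + 1))"
      using rc[rule_format, of "e / (2 * (\<Lambda> + 1))"] e \<Lambda>0 by auto
    obtain N2 :: nat where N2: "8 / e < real N2" using reals_Archimedean2 by blast
    have "(LINT x|nu. (norm (F m x - F n x))\<^sup>2) < e" if mn: "max N1 N2 \<le> m" "max N1 N2 \<le> n" for m n
    proof -
      have small: "2 / (real (r k) + 1) < e / 4" if "max N1 N2 \<le> k" for k
      proof -
        have "real N2 \<le> real (r k)" using that seq_suble[OF r, of k] by simp
        then have "8 / e < real (r k) + 1" using N2 by linarith
        then show ?thesis using e by (simp add: field_simps)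
      qed
      have i: "integrable nu (\<lambda>x. (u (r m) x - u (r n) x)\<^sup>2)" "integrable nu (\<lambda>x. (norm (G (r m) x - G (r n) x))\<^sup>2)"
        using integrable_nu_sq[OF sqd(1)[of m n]] integrable_nu_sq[OF sqd(2)[of m n]] by simp_all
      have "(LINT x|nu. (norm (F m x - F n x))\<^sup>2) = (LINT x|nu. (u (r m) x - u (r n) x)\<^sup>2) + (LINT x|nu. (norm (G (r m) x - G (r n) x))\<^sup>2)"
        using i by (simp add: F_def norm_Pair)
      also have "\<dots> \<le> 2 / (real (r m) + 1) + 2 / (real (r n) + 1) + (\<Lambda> + 1) * (LINT x|nu. (u (r m) x - u (r n) x)\<^sup>2)"
        using par[of "r m" "r n"] by (simp add: algebra_simps)
      also have "(LINT x|nu. (u (r m) x - u (r n) x)\<^sup>2) \<le> e / (2 * (\<Lambda> + 1))"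
        using integral_nu_bounds(1)[OF sqd(1) s, of m n] N1[of m n] mn by simp
      also have "(\<Lambda> + 1) * (e / (2 * (\<Lambda> + 1))) = e / 2" using \<Lambda>0 by (simp add: field_simps)
      finally show ?thesis using small[OF mn(1)] small[OF mn(2)] \<Lambda>0 by (simp add: mult_left_mono)
    qed
    then show ?thesis by blast
  qed
  obtain F' where F': "L2_tendsto nu F F'" using L2_complete[of nu F, OF sqF CF] by blast
  define u' where "u' x = fst (F' x)" for x
  define G' where "G' x = snd (F' x)" for x
  have sq': "sq_integrable M u'" "sq_integrable M G'"
  proof -
    have "sq_integrable nu (\<lambda>x. (u' x, G' x))" using F' by (simp add: u'_def G'_def L2_tendsto_def)
    then show "sq_integrable M u'" "sq_integrable M G'" by (auto simp: sq_integrable_Pair sq_integrable_nu)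
  qed
  have limF: "(\<lambda>n. LINT x|nu. (norm (F n x - F' x))\<^sup>2) \<longlonglongrightarrow> 0" using F' by (simp add: L2_tendsto_def)
  have eqF: "(norm (F n x - F' x))\<^sup>2 = (norm (u (r n) x - u' x))\<^sup>2 + (norm (G (r n) x - G' x))\<^sup>2" for n x
    by (cases "F' x") (simp add: F_def u'_def G'_def norm_Pair)
  have iF: "integrable nu (\<lambda>x. (norm (F n x - F' x))\<^sup>2)" "integrable nu (\<lambda>x. (norm (u (r n) x - u' x))\<^sup>2)"
    "integrable nu (\<lambda>x. (norm (G (r n) x - G' x))\<^sup>2)" for n
    using sq_integrable_diff[OF sqF[of n] L2_tendsto_sq_integrable(2)[OF F']]
      integrable_nu_sq[OF sq_integrable_diff[OF squ(1)[of "r n"] sq'(1)]]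
      integrable_nu_sq[OF sq_integrable_diff[OF squ(2)[of "r n"] sq'(2)]]
    by (simp_all add: sq_integrable_def)
  have Lu: "L2_tendsto nu (\<lambda>n. u (r n)) u'"
    unfolding L2_tendsto_def
  proof (intro conjI allI tendsto_sandwich[OF _ _ tendsto_const limF])
    show "\<forall>\<^sub>F n in sequentially. (LINT x|nu. (norm (u (r n) x - u' x))\<^sup>2) \<le> (LINT x|nu. (norm (F n x - F' x))\<^sup>2)"
      by (intro always_eventually allI integral_mono iF) (simp add: eqF)
  qed (use squ sq' in \<open>auto simp: sq_integrable_nu\<close>)
  have LG: "L2_tendsto nu (\<lambda>n. G (r n)) G'"
    unfolding L2_tendsto_def
  proof (intro conjI allI tendsto_sandwich[OF _ _ tendsto_const limF])
    show "\<forall>\<^sub>F n in sequentially. (LINT x|nu. (norm (G (r n) x - G' x))\<^sup>2) \<le> (LINT x|nu. (norm (F n x - F' x))\<^sup>2)"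
      by (intro always_eventually allI integral_mono iF) (simp add: eqF)
  qed (use squ sq' in \<open>auto simp: sq_integrable_nu\<close>)
  have H': "H1_on \<Omega> u' G'" by (rule H1_on_limit[OF H L2_tendsto_nu[OF Lu] L2_tendsto_nu[OF LG]])
  have "(\<lambda>n. LINT x|nu. u (r n) x \<bullet> 1) \<longlonglongrightarrow> (LINT x|nu. u' x \<bullet> 1)"
    by (intro L2_tendsto_inner Lu L2_tendsto_const sq_integrable_const nu.finite_measure_axioms)
  then have m': "(LINT x|nu. u' x) = 0" by (simp add: mean LIMSEQ_const_iff)
  have "(\<lambda>n. LINT x|nu. u (r n) x \<bullet> u (r n) x) \<longlonglongrightarrow> (LINT x|nu. u' x \<bullet> u' x)"
    by (intro L2_tendsto_inner Lu)
  then have n': "(LINT x|nu. (u' x)\<^sup>2) = 1" using norm1 by (simp add: LIMSEQ_const_iff power2_eq_square)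
  have limG: "(\<lambda>n. LINT x|nu. (norm (G (r n) x))\<^sup>2) \<longlonglongrightarrow> (LINT x|nu. (norm (G' x))\<^sup>2)"
    unfolding power2_norm_eq_inner by (intro L2_tendsto_inner LG)
  have "(\<lambda>n. \<Lambda> + 1 / (real n + 1)) \<longlonglongrightarrow> \<Lambda>" by real_asymp
  then have "(LINT x|nu. (norm (G' x))\<^sup>2) \<le> \<Lambda>"
  proof (rule LIMSEQ_le[OF limG])
    have "(LINT x|nu. (norm (G (r n) x))\<^sup>2) \<le> \<Lambda> + 1 / (real n + 1)" for n
    proof -
      have "real n \<le> real (r n)" using seq_suble[OF r, of n] by simp
      then have "1 / (real (r n) + 1) \<le> 1 / (real n + 1)" by (intro divide_left_mono) auto
      then show ?thesis using uG(2)[of "r n"] by linarith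
    qed
    then show "\<exists>N. \<forall>n\<ge>N. (LINT x|nu. (norm (G (r n) x))\<^sup>2) \<le> \<Lambda> + 1 / (real n + 1)" by blast
  qed
  then have le: "(LINT x|nu. (norm (G' x))\<^sup>2) \<le> \<Lambda>" .
  have fin: "(LINT x|nu. (norm (G' x))\<^sup>2) * (LINT x|nu. (v x)\<^sup>2) \<le> (LINT x|nu. (norm (V x))\<^sup>2)"
    if "H1_on \<Omega> v V" "(LINT x|nu. v x) = 0" for v V
  proof -
    have "(LINT x|nu. (norm (G' x))\<^sup>2) * (LINT x|nu. (v x)\<^sup>2) \<le> \<Lambda> * (LINT x|nu. (v x)\<^sup>2)"
      by (rule mult_right_mono[OF le]) simp
    also have "\<dots> \<le> (LINT x|nu. (norm (V x))\<^sup>2)" by (rule min[OF that])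
    finally show ?thesis .
  qed
  show thesis by (rule that[OF H' m' n' fin])
qed

end

section \<open>The weak eigenvalue equation and the second eigenvalue\<close>

context gauss_domain
begin

lemma L2_on_\<sigma>: "L2_on \<Omega> \<sigma> u \<longleftrightarrow> sq_integrable M (u :: 'a \<Rightarrow> real)"
proof (cases "u \<in> borel_measurable M")
  case True
  then have m: "(\<lambda>x. (norm (u x))\<^sup>2) \<in> borel_measurable M" by measurable
  have "integrable nu (\<lambda>x. (norm (u x))\<^sup>2) \<longleftrightarrow> integrable M (\<lambda>x. (norm (u x))\<^sup>2 * \<sigma> x)"
    unfolding nu_def using m \<sigma>_pos by (subst integrable_density) (simp_all add: less_imp_le mult.commute)
  then show ?thesis using integrable_nu_iff[OF m] True by (simp add: L2_on_def sq_integrable_def)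
qed (simp add: L2_on_def sq_integrable_def)

lemma integral_nu_inner:
  fixes G V :: "'a \<Rightarrow> 'b::euclidean_space"
  assumes "sq_integrable M G" "sq_integrable M V"
  shows "(LINT x|nu. G x \<bullet> V x) = (LINT x|M. (G x \<bullet> V x) * \<sigma> x)"
  using assms[THEN sq_integrable_measurable] by (intro integral_nu borel_measurable_inner)

lemma integral_nu_mult:
  fixes u v :: "'a \<Rightarrow> real"
  assumes "sq_integrable M u" "sq_integrable M v"
  shows "(LINT x|nu. u x * v x) = (LINT x|M. u x * v x * \<sigma> x)"
  using integral_nu_inner[OF assms] by simp

lemma sq_integrable_inner_id:
  assumes "sq_integrable M G"
  shows "sq_integrable M (\<lambda>x. x \<bullet> G x)"
proof -
  obtain B where B: "\<And>x. x \<in> \<Omega> \<Longrightarrow> norm x \<le> B" using bounded_\<Omega> by (auto simp: bounded_iff)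
  show ?thesis
  proof (rule sq_integrable_bound)
    show "integrable M (\<lambda>x. B\<^sup>2 * (norm (G x))\<^sup>2)" using assms by (simp add: sq_integrable_def)
    show "(\<lambda>x. x \<bullet> G x) \<in> borel_measurable M"
      using sq_integrable_measurable[OF assms] measurable_lebesgue_on_continuous[OF continuous_on_id]
      by (intro borel_measurable_inner)
    fix x assume "x \<in> space M"
    then have "norm x \<le> B" using B by simp
    then have "norm x * norm (G x) \<le> B * norm (G x)" by (intro mult_right_mono) auto
    then have "\<bar>x \<bullet> G x\<bar> \<le> B * norm (G x)" using Cauchy_Schwarz_ineq2[of x "G x"] by linarith
    then have "\<bar>x \<bullet> G x\<bar>\<^sup>2 \<le> (B * norm (G x))\<^sup>2" by (intro power_mono) auto
    then show "(norm (x \<bullet> G x))\<^sup>2 \<le> B\<^sup>2 * (norm (G x))\<^sup>2" by (simp add: power_mult_distrib)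
  qed
qed

lemma grad_neg_ln_\<sigma>: "grad (\<lambda>y. - ln (\<sigma> y)) x = (2 * real j) *\<^sub>R x"
proof (rule grad_eqI)
  have "((\<lambda>y::'a. 0 + real j * (norm (y - 0))\<^sup>2) has_derivative (\<lambda>v. ((2 * real j) *\<^sub>R (x - 0)) \<bullet> v)) (at x)"
    by (rule has_derivative_square_norm)
  then show "((\<lambda>y. - ln (\<sigma> y)) has_derivative (\<lambda>v. ((2 * real j) *\<^sub>R x) \<bullet> v)) (at x)"
    by (simp add: gauss_density_def)
qed

text \<open>The weight is removed from, or put into, the weak form by testing with \<open>v / \<sigma>\<close> or \<open>v \<sigma>\<close>.\<close>

lemma weak_form_imp_neumann_L:
  assumes H: "H1_on \<Omega> u G"
    and weak: "\<And>v V. H1_on \<Omega> v V \<Longrightarrow> (LINT x|nu. G x \<bullet> V x) = \<mu> * (LINT x|nu. u x * v x)"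
  shows "neumann_L \<Omega> \<sigma> u (\<lambda>x. \<mu> * u x)"
proof -
  have u: "sq_integrable M u" and G: "sq_integrable M G" using H by (auto simp: H1_on_iff)
  \<comment> \<open>The eigenvalue equation leaves no choice:
    \<open>- D x + 2 * real j * (x \<bullet> G x)\<close> has to be
    \<open>\<mu> * u x\<close>.\<close>
  define D where "D x = 2 * real j * (x \<bullet> G x) - \<mu> * u x" for x
  have xG: "sq_integrable M (\<lambda>x. x \<bullet> G x)" by (rule sq_integrable_inner_id[OF G])
  have D: "sq_integrable M D"
    unfolding D_def using sq_integrable_diff[OF sq_integrable_cscale[OF xG, of "2 * real j"] sq_integrable_cscale[OF u, of \<mu>]] by simp
  have zero: "(LINT x|M. G x \<bullet> V x + D x * v x) = 0" if v: "H1_on \<Omega> v V" for v V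
  proof -
    note \<tau>v = H1_on_mult_smooth[OF v smooth_\<tau>]
    have sv: "sq_integrable M v" "sq_integrable M V" using v by (auto simp: H1_on_iff)
    have s\<tau>: "sq_integrable M (\<lambda>x. \<tau> x * v x)" "sq_integrable M (\<lambda>x. \<tau> x *\<^sub>R V x + v x *\<^sub>R grad \<tau> x)"
      using \<tau>v by (auto simp: H1_on_iff)
    have i: "integrable M (\<lambda>x. G x \<bullet> V x)" "integrable M (\<lambda>x. (x \<bullet> G x) * v x)" "integrable M (\<lambda>x. u x * v x)"
      by (intro sq_integrable_inner sq_integrable_mult G sv xG u)+
    have "(LINT x|M. G x \<bullet> V x) + 2 * real j * (LINT x|M. (x \<bullet> G x) * v x) = (LINT x|M. G x \<bullet> V x + 2 * real j * ((x \<bullet> G x) * v x))"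
      using i by simp
    also have "\<dots> = (LINT x|M. (G x \<bullet> (\<tau> x *\<^sub>R V x + v x *\<^sub>R grad \<tau> x)) * \<sigma> x)"
    proof (intro Bochner_Integration.integral_cong refl)
      fix x
      have "(G x \<bullet> (\<tau> x *\<^sub>R V x + v x *\<^sub>R grad \<tau> x)) * \<sigma> x = (\<sigma> x * \<tau> x) * (G x \<bullet> V x + 2 * real j * ((x \<bullet> G x) * v x))"
        by (simp add: grad_\<tau> inner_add_right inner_commute algebra_simps)
      then show "G x \<bullet> V x + 2 * real j * ((x \<bullet> G x) * v x) = (G x \<bullet> (\<tau> x *\<^sub>R V x + v x *\<^sub>R grad \<tau> x)) * \<sigma> x"
        by (simp add: \<sigma>_\<tau>)
    qed
    also have "\<dots> = \<mu> * (LINT x|nu. u x * (\<tau> x * v x))"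
      unfolding integral_nu_inner[OF G s\<tau>(2), symmetric] by (rule weak[OF \<tau>v])
    also have "(LINT x|nu. u x * (\<tau> x * v x)) = (LINT x|M. u x * v x)"
      unfolding integral_nu_mult[OF u s\<tau>(1)]
    proof (intro Bochner_Integration.integral_cong refl)
      fix x
      have "u x * (\<tau> x * v x) * \<sigma> x = (\<sigma> x * \<tau> x) * (u x * v x)" by simp
      then show "u x * (\<tau> x * v x) * \<sigma> x = u x * v x" by (simp add: \<sigma>_\<tau>)
    qed
    finally have e: "(LINT x|M. G x \<bullet> V x) + 2 * real j * (LINT x|M. (x \<bullet> G x) * v x) = \<mu> * (LINT x|M. u x * v x)" .
    have "(LINT x|M. G x \<bullet> V x + D x * v x) = (LINT x|M. G x \<bullet> V x + (2 * real j * ((x \<bullet> G x) * v x) - \<mu> * (u x * v x)))"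
      by (intro Bochner_Integration.integral_cong) (simp_all add: D_def algebra_simps)
    also have "\<dots> = (LINT x|M. G x \<bullet> V x) + (2 * real j * (LINT x|M. (x \<bullet> G x) * v x) - \<mu> * (LINT x|M. u x * v x))"
      using i by simp
    finally show ?thesis using e by simp
  qed
  have "weak_div \<Omega> G D"
    unfolding weak_div_def
  proof (intro allI impI)
    fix \<phi> assume \<phi>: "test_function \<Omega> \<phi>"
    have H\<phi>: "H1_on \<Omega> \<phi> (grad \<phi>)" by (rule H1_on_smooth[OF test_function_facts(1)[OF \<phi>]])
    then have s\<phi>: "sq_integrable M \<phi>" "sq_integrable M (grad \<phi>)" by (auto simp: H1_on_iff)
    have i: "integrable M (\<lambda>x. G x \<bullet> grad \<phi> x)" "integrable M (\<lambda>x. D x * \<phi> x)"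
      by (intro sq_integrable_inner sq_integrable_mult G D s\<phi>)+
    show "(LINT x|M. G x \<bullet> grad \<phi> x) = - (LINT x|M. \<phi> x * D x)"
      using zero[OF H\<phi>] i by (simp add: mult.commute[of "\<phi> _"])
  qed
  moreover have "zero_normal_trace \<Omega> G D" using zero by (simp add: zero_normal_trace_def)
  moreover have "AE x in M. \<mu> * u x = - D x + grad (\<lambda>y. - ln (\<sigma> y)) x \<bullet> G x"
    by (intro AE_I2) (simp add: grad_neg_ln_\<sigma> D_def)
  moreover have "sq_integrable M (\<lambda>x. \<mu> * u x)" using sq_integrable_cscale[OF u, of \<mu>] by simp
  ultimately show ?thesis
    unfolding neumann_L_def L2_on_\<sigma> L2_on_1 using H u D by blast
qed

text \<open>With \<open>\<sigma> x * v x\<close> in the trace condition, the term containing the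
  gradient of the density is exactly the drift term of the operator, so what remains is the
  symmetric form with respect to the weighted measure.\<close>

lemma neumann_L_imp_weak_form:
  assumes "neumann_L \<Omega> \<sigma> u g"
  obtains G where "H1_on \<Omega> u G" "\<And>v V. H1_on \<Omega> v V \<Longrightarrow> (LINT x|nu. G x \<bullet> V x) = (LINT x|nu. g x * v x)"
proof -
  obtain G D where H: "H1_on \<Omega> u G" and D: "sq_integrable M D" and tr: "zero_normal_trace \<Omega> G D"
    and ae: "AE x in M. g x = - D x + grad (\<lambda>y. - ln (\<sigma> y)) x \<bullet> G x" and g: "sq_integrable M g"
    using assms unfolding neumann_L_def L2_on_\<sigma> L2_on_1 by blast
  have u: "sq_integrable M u" and G: "sq_integrable M G" using H by (auto simp: H1_on_iff)
  have xG: "sq_integrable M (\<lambda>x. x \<bullet> G x)" by (rule sq_integrable_inner_id[OF G])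
  have weak: "(LINT x|nu. G x \<bullet> V x) = (LINT x|nu. g x * v x)" if v: "H1_on \<Omega> v V" for v V
  proof -
    note \<sigma>v = H1_on_mult_smooth[OF v smooth_\<sigma>]
    have sv: "sq_integrable M v" "sq_integrable M V" using v by (auto simp: H1_on_iff)
    have s\<sigma>: "sq_integrable M (\<lambda>x. \<sigma> x * v x)" "sq_integrable M (\<lambda>x. \<sigma> x *\<^sub>R V x)"
      using \<sigma>v sq_integrable_continuous_scaleR[OF smooth_on_UNIV_continuous[OF smooth_\<sigma>] sv(2)] by (auto simp: H1_on_iff)
    have i: "integrable M (\<lambda>x. G x \<bullet> (\<sigma> x *\<^sub>R V x))" "integrable M (\<lambda>x. (x \<bullet> G x) * (\<sigma> x * v x))"
      "integrable M (\<lambda>x. D x * (\<sigma> x * v x))"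
      by (intro sq_integrable_inner sq_integrable_mult G s\<sigma> xG D)+
    have "0 = (LINT x|M. G x \<bullet> (\<sigma> x *\<^sub>R V x + v x *\<^sub>R grad \<sigma> x) + D x * (\<sigma> x * v x))"
      using tr \<sigma>v by (simp add: zero_normal_trace_def)
    also have "\<dots> = (LINT x|M. G x \<bullet> (\<sigma> x *\<^sub>R V x) - 2 * real j * ((x \<bullet> G x) * (\<sigma> x * v x)) + D x * (\<sigma> x * v x))"
      by (intro Bochner_Integration.integral_cong refl) (simp add: grad_\<sigma> inner_add_right inner_commute algebra_simps)
    also have "\<dots> = (LINT x|M. G x \<bullet> (\<sigma> x *\<^sub>R V x)) - 2 * real j * (LINT x|M. (x \<bullet> G x) * (\<sigma> x * v x)) + (LINT x|M. D x * (\<sigma> x * v x))"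
      using i by simp
    finally have e: "(LINT x|M. G x \<bullet> (\<sigma> x *\<^sub>R V x)) = 2 * real j * (LINT x|M. (x \<bullet> G x) * (\<sigma> x * v x)) - (LINT x|M. D x * (\<sigma> x * v x))"
      by simp
    have "(LINT x|M. g x * v x * \<sigma> x) = (LINT x|M. 2 * real j * ((x \<bullet> G x) * (\<sigma> x * v x)) - D x * (\<sigma> x * v x))"
    proof (rule integral_cong_AE)
      show "AE x in M. g x * v x * \<sigma> x = 2 * real j * ((x \<bullet> G x) * (\<sigma> x * v x)) - D x * (\<sigma> x * v x)"
        using ae
      proof eventually_elim
        case (elim x)
        then have "g x = 2 * real j * (x \<bullet> G x) - D x" by (simp add: grad_neg_ln_\<sigma>)
        then show ?case by (simp only: left_diff_distrib) (simp add: ac_simps)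
      qed
      show "(\<lambda>x. g x * v x * \<sigma> x) \<in> borel_measurable M"
        using sq_integrable_measurable[OF g] sq_integrable_measurable[OF sv(1)] by measurable
      show "(\<lambda>x. 2 * real j * ((x \<bullet> G x) * (\<sigma> x * v x)) - D x * (\<sigma> x * v x)) \<in> borel_measurable M"
        using i(2,3) by (intro borel_measurable_diff borel_measurable_times borel_measurable_const borel_measurable_integrable) auto
    qed
    also have "\<dots> = 2 * real j * (LINT x|M. (x \<bullet> G x) * (\<sigma> x * v x)) - (LINT x|M. D x * (\<sigma> x * v x))"
      using i by simp
    also have "\<dots> = (LINT x|M. (G x \<bullet> V x) * \<sigma> x)" unfolding e[symmetric] by (simp add: mult.commute)
    finally show ?thesis by (simp add: integral_nu_inner[OF G sv(2)] integral_nu_mult[OF g sv(1)])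
  qed
  show thesis by (rule that[OF H weak])
qed

lemma poincare_nu:
  assumes H: "H1_on \<Omega> u G"
  shows "2 * real j * ((LINT x|nu. (1::real)) * (LINT x|nu. (u x)\<^sup>2) - (LINT x|nu. u x)\<^sup>2)
    \<le> (LINT x|nu. (1::real)) * (LINT x|nu. (norm (G x))\<^sup>2)"
proof -
  obtain R where R: "0 < R" "ball 0 R \<subseteq> \<Omega>" using open_\<Omega> zero_in by (auto simp: open_contains_ball)
  obtain D where D: "\<Omega> \<subseteq> cball 0 D" using bounded_\<Omega> by (auto simp: bounded_iff subset_iff)
  \<comment> \<open>The whole domain is its own convex piece, contracted to the origin, which is
    also the centre of the Gaussian weight.\<close>
  interpret P: convex_piece \<Omega> \<Omega> 0 R D
    by unfold_locales (use R D convex_\<Omega> sets_\<Omega> in auto)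
  have j0: "0 < real j" using j by simp
  have e: "exp (- (real j * (norm (x - 0))\<^sup>2)) = \<sigma> x" for x :: 'a by (simp add: gauss_density_def)
  have "sq_integrable M u" "sq_integrable M G" using H by (auto simp: H1_on_iff)
  then have m: "u \<in> borel_measurable M" "(\<lambda>x. (u x)\<^sup>2) \<in> borel_measurable M" "(\<lambda>x. (norm (G x))\<^sup>2) \<in> borel_measurable M"
    by (auto dest!: sq_integrable_measurable)
  have "(LINT x|nu. (1::real)) = (LINT x|M. \<sigma> x)" using integral_nu[of "\<lambda>_. 1"] by simp
  then show ?thesis
    using P.H1_poincare[OF H j0] unfolding e integral_nu[OF m(1)] integral_nu[OF m(2)] integral_nu[OF m(3)] by simp
qed

lemma AE_zero_of_integral_nu:
  assumes f: "sq_integrable M (f :: 'a \<Rightarrow> real)" and z: "(LINT x|nu. (f x)\<^sup>2) \<le> 0"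
  shows "AE x in M. f x = 0"
proof -
  obtain s where s: "0 < s" "\<And>x. x \<in> \<Omega> \<Longrightarrow> s \<le> \<sigma> x" using \<sigma>_lower by blast
  have "s * (LINT x|M. (norm (f x))\<^sup>2) \<le> 0" using integral_nu_bounds(2)[OF f s] z by simp
  then have "(LINT x|M. (norm (f x))\<^sup>2) \<le> 0" using s(1) by (simp add: mult_le_0_iff)
  then have "(LINT x|M. (norm (f x))\<^sup>2) = 0" by (intro antisym) auto
  moreover have "integrable M (\<lambda>x. (norm (f x))\<^sup>2)" using f by (simp add: sq_integrable_def)
  ultimately show ?thesis using integral_nonneg_eq_0_iff_AE[of M "\<lambda>x. (norm (f x))\<^sup>2"] by simp
qed

text \<open>Testing with the constant 1 shows that \<mu> times the mean is 0. If \<mu> is nonzero,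
  the mean vanishes and the Poincare inequality bounds \<mu> from below. If \<mu> is 0, the energy
  vanishes, hence so does the variance. Negative \<mu> are covered by the first case.\<close>

lemma eigenfunction_cases:
  assumes "neumann_eigenfunction \<Omega> \<sigma> \<mu> u"
  shows "2 * real j \<le> \<mu> \<or> (\<exists>c. AE x in M. u x = c)"
proof -
  have n: "neumann_L \<Omega> \<sigma> u (\<lambda>x. \<mu> * u x)" and nz: "\<not> (AE x in M. u x = 0)"
    using assms by (auto simp: neumann_eigenfunction_def)
  obtain G where H: "H1_on \<Omega> u G" and w: "\<And>v V. H1_on \<Omega> v V \<Longrightarrow> (LINT x|nu. G x \<bullet> V x) = (LINT x|nu. \<mu> * u x * v x)"
    using neumann_L_imp_weak_form[OF n] by blast
  have u: "sq_integrable M u" using H by (auto simp: H1_on_iff)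
  define Z m S E where "Z = (LINT x|nu. (1::real))" and "m = (LINT x|nu. u x)" and "S = (LINT x|nu. (u x)\<^sup>2)"
    and "E = (LINT x|nu. (norm (G x))\<^sup>2)"
  have Z: "0 < Z" unfolding Z_def by (rule nu_pos)
  have E: "E = \<mu> * S"
    using w[OF H] unfolding E_def S_def power2_norm_eq_inner by (simp add: power2_eq_square mult.assoc)
  have m: "\<mu> * m = 0" using w[OF H1_on_const[of 1]] by (simp add: m_def)
  have P: "2 * real j * (Z * S - m\<^sup>2) \<le> Z * E" using poincare_nu[OF H] by (simp add: Z_def m_def S_def E_def)
  show ?thesis
  proof (cases "\<mu> = 0")
    case False
    then have "m = 0" using m by simp
    then have "Z * (2 * real j * S) \<le> Z * (\<mu> * S)" using P E by (simp add: ac_simps)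
    then have le: "2 * real j * S \<le> \<mu> * S" using Z by simp
    have "0 < S"
    proof (rule ccontr)
      assume "\<not> 0 < S"
      then show False using AE_zero_of_integral_nu[OF u] nz by (simp add: S_def)
    qed
    then show ?thesis using le by simp
  next
    case True
    then have "2 * real j * (Z * S - m\<^sup>2) \<le> 0" using P E by simp
    then have P0: "Z * S \<le> m\<^sup>2" using j by (simp add: mult_le_0_iff)
    define c where "c = m / Z"
    have Hc: "sq_integrable M (\<lambda>x. u x - c)" using H1_on_shift[OF H, of c] by (simp add: H1_on_iff)
    have i: "integrable nu u" "integrable nu (\<lambda>x. (u x)\<^sup>2)"
      using u sq_integrable_integrable[OF nu.finite_measure_axioms, of u] integrable_nu_sq[OF u] by (simp_all add: sq_integrable_nu)
    have "(LINT x|nu. (u x - c)\<^sup>2) = (LINT x|nu. (u x)\<^sup>2 - 2 * c * u x + c\<^sup>2)"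
      by (simp add: power2_eq_square algebra_simps)
    also have "\<dots> = S - 2 * c * m + c\<^sup>2 * Z" using i by (simp add: S_def m_def Z_def)
    also have "\<dots> = (Z * S - m\<^sup>2) / Z" using Z by (simp add: c_def field_simps power2_eq_square)
    also have "\<dots> \<le> 0" using P0 Z by (simp add: divide_le_0_iff)
    finally have "AE x in M. u x - c = 0" by (rule AE_zero_of_integral_nu[OF Hc])
    then have "AE x in M. u x = c" by eventually_elim simp
    then show ?thesis by blast
  qed
qed

text \<open>If \<open>t\<close> were smaller, both eigenfunctions would be constants
  \<open>a\<close> and \<open>b\<close>, and the coefficients \<open>b\<close> and
  \<open>- a\<close> give a linear relation. Independence then makes \<open>a\<close> zero, which an
  eigenfunction cannot be.\<close>

lemma second_eigenvalue_lower:
  assumes "\<forall>i<2. \<mu> i \<le> t \<and> neumann_eigenfunction \<Omega> \<sigma> (\<mu> i) (u i)" and li: "lin_indep_ae \<Omega> 2 u"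
  shows "2 * real j \<le> t"
proof (rule ccontr)
  assume t: "\<not> 2 * real j \<le> t"
  have e: "\<mu> 0 \<le> t" "\<mu> 1 \<le> t" "neumann_eigenfunction \<Omega> \<sigma> (\<mu> 0) (u 0)" "neumann_eigenfunction \<Omega> \<sigma> (\<mu> 1) (u 1)"
    using assms(1) by auto
  obtain a b where a: "AE x in M. u 0 x = a" and b: "AE x in M. u 1 x = b"
    using eigenfunction_cases[OF e(3)] eigenfunction_cases[OF e(4)] e(1,2) t by fastforce
  define c where "c i = (if i = 0 then b else - a)" for i :: nat
  have s: "(\<Sum>i<2. f i) = f 0 + f 1" for f :: "nat \<Rightarrow> real" by (simp add: numeral_2_eq_2)
  have "AE x in M. (\<Sum>i<2. c i * u i x) = 0"
    using a b by eventually_elim (simp add: s c_def)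
  then have "\<forall>i<2. c i = 0" using li unfolding lin_indep_ae_def by blast
  then have "c 1 = 0" by simp
  then have "a = 0" by (simp add: c_def)
  then show False using e(3) a by (simp add: neumann_eigenfunction_def)
qed

text \<open>One number has both properties: it is admissible in the definition of the second
  eigenvalue and it bounds Rayleigh quotients from below. Any trial function orthogonal to the
  constants therefore bounds the eigenvalue from above.\<close>

lemma second_eigenvalue_upper:
  "\<exists>\<Lambda>. (\<exists>\<mu> u. (\<forall>i<2. \<mu> i \<le> \<Lambda> \<and> neumann_eigenfunction \<Omega> \<sigma> (\<mu> i) (u i)) \<and> lin_indep_ae \<Omega> 2 u) \<and>
    (\<forall>v V. H1_on \<Omega> v V \<longrightarrow> (LINT x|nu. v x) = 0 \<longrightarrow> \<Lambda> * (LINT x|nu. (v x)\<^sup>2) \<le> (LINT x|nu. (norm (V x))\<^sup>2))"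
proof -
  obtain w G where H: "H1_on \<Omega> w G" and w0: "(LINT x|nu. w x) = 0" and w1: "(LINT x|nu. (w x)\<^sup>2) = 1"
    and min: "\<And>v V. H1_on \<Omega> v V \<Longrightarrow> (LINT x|nu. v x) = 0 \<Longrightarrow>
      (LINT x|nu. (norm (G x))\<^sup>2) * (LINT x|nu. (v x)\<^sup>2) \<le> (LINT x|nu. (norm (V x))\<^sup>2)"
    using rayleigh_minimizer by blast
  define \<Lambda> where "\<Lambda> = (LINT x|nu. (norm (G x))\<^sup>2)"
  have \<Lambda>0: "0 \<le> \<Lambda>" by (simp add: \<Lambda>_def)
  have sw: "sq_integrable nu w" "sq_integrable nu G" using H by (auto simp: H1_on_iff sq_integrable_nu)
  have iw: "integrable nu w" by (rule sq_integrable_integrable[OF nu.finite_measure_axioms sw(1)])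
  have weak: "(LINT x|nu. G x \<bullet> V x) = \<Lambda> * (LINT x|nu. w x * v x)" if v: "H1_on \<Omega> v V" for v V
  proof -
    \<comment> \<open>The weak equation is needed for all test functions, minimality only concerns
      those of mean 0. Subtracting the mean changes neither the gradient nor the product with
      \<open>w\<close>, which is orthogonal to the constants.\<close>
    define c where "c = (LINT x|nu. v x) / (LINT x|nu. (1::real))"
    define v0 where "v0 x = v x - c" for x
    have H0: "H1_on \<Omega> v0 V" unfolding v0_def by (rule H1_on_shift[OF v])
    have mv0: "(LINT x|nu. v0 x) = 0" unfolding v0_def c_def using v by (intro mean_zero_shift) (simp add: H1_on_iff)
    have s0: "sq_integrable nu v0" "sq_integrable nu V" using H0 by (auto simp: H1_on_iff sq_integrable_nu)
    have sv: "sq_integrable nu v" using v by (auto simp: H1_on_iff sq_integrable_nu)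
    have iv0: "integrable nu v0" by (rule sq_integrable_integrable[OF nu.finite_measure_axioms s0(1)])
    \<comment> \<open>Euler-Lagrange equation: energy minus \<Lambda> times squared norm along
      \<open>w + t * v0\<close> is a nonnegative quadratic in \<open>t\<close> whose constant term
      is 0, so its linear coefficient must vanish.\<close>
    have "((LINT x|nu. G x \<bullet> V x) - \<Lambda> * (LINT x|nu. w x * v0 x))\<^sup>2 \<le> 0 * ((LINT x|nu. (norm (V x))\<^sup>2) - \<Lambda> * (LINT x|nu. (v0 x)\<^sup>2))"
    proof (rule discriminant_nonpos_real)
      show "0 \<le> (LINT x|nu. (norm (V x))\<^sup>2) - \<Lambda> * (LINT x|nu. (v0 x)\<^sup>2)"
        using min[OF H0 mv0] by (simp add: \<Lambda>_def)
      fix t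
      have "(LINT x|nu. w x + t * v0 x) = 0" using iw iv0 w0 mv0 by simp
      from min[OF H1_on_lincomb[OF H H0] this]
      have le: "\<Lambda> * (LINT x|nu. (w x + t * v0 x)\<^sup>2) \<le> (LINT x|nu. (norm (G x + t *\<^sub>R V x))\<^sup>2)"
        by (simp add: \<Lambda>_def)
      have "(LINT x|nu. (w x + t * v0 x)\<^sup>2) = 1 + 2 * t * (LINT x|nu. w x * v0 x) + t\<^sup>2 * (LINT x|nu. (v0 x)\<^sup>2)"
        using integral_norm_add_scaleR[OF sw(1) s0(1), of t] w1 by simp
      moreover have "(LINT x|nu. (norm (G x + t *\<^sub>R V x))\<^sup>2) = \<Lambda> + 2 * t * (LINT x|nu. G x \<bullet> V x) + t\<^sup>2 * (LINT x|nu. (norm (V x))\<^sup>2)"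
        using integral_norm_add_scaleR[OF sw(2) s0(2), of t] by (simp add: \<Lambda>_def)
      ultimately show "0 \<le> 0 + 2 * t * ((LINT x|nu. G x \<bullet> V x) - \<Lambda> * (LINT x|nu. w x * v0 x)) + t\<^sup>2 * ((LINT x|nu. (norm (V x))\<^sup>2) - \<Lambda> * (LINT x|nu. (v0 x)\<^sup>2))"
        using le by (simp add: algebra_simps)
    qed
    then have "(LINT x|nu. G x \<bullet> V x) = \<Lambda> * (LINT x|nu. w x * v0 x)" by simp
    also have "(LINT x|nu. w x * v0 x) = (LINT x|nu. w x * v x - c * w x)"
      by (simp add: v0_def algebra_simps)
    also have "\<dots> = (LINT x|nu. w x * v x)" using sq_integrable_mult[OF sw(1) sv] iw w0 by simp
    finally show ?thesis .
  qed
  have eig1: "neumann_eigenfunction \<Omega> \<sigma> \<Lambda> w"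
    unfolding neumann_eigenfunction_def
  proof
    show "neumann_L \<Omega> \<sigma> w (\<lambda>x. \<Lambda> * w x)" by (rule weak_form_imp_neumann_L[OF H weak])
    show "\<not> (AE x in M. w x = 0)"
    proof
      assume "AE x in M. w x = 0"
      then have "AE x in M. (w x)\<^sup>2 * \<sigma> x = 0" by eventually_elim simp
      then have "(LINT x|M. (w x)\<^sup>2 * \<sigma> x) = 0" by (rule integral_eq_zero_AE)
      moreover have "(\<lambda>x. (w x)\<^sup>2) \<in> borel_measurable M" using sw(1) by (auto simp: sq_integrable_nu dest!: sq_integrable_measurable)
      ultimately show False using w1 by (simp add: integral_nu)
    qed
  qed
  have nz: "\<not> (AE x in M. (1::real) = 0)"
  proof
    assume "AE x in M. (1::real) = 0"
    then have "AE x in M. \<sigma> x = 0" by eventually_elim simp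
    then have "(LINT x|M. \<sigma> x) = 0" by (rule integral_eq_zero_AE)
    then show False using nu_pos integral_nu[of "\<lambda>_. 1"] by simp
  qed
  have eig0: "neumann_eigenfunction \<Omega> \<sigma> 0 (\<lambda>_. 1)"
    unfolding neumann_eigenfunction_def
    using weak_form_imp_neumann_L[OF H1_on_const[of 1], of 0] nz by simp
  \<comment> \<open>Index 0 stands for the constants with eigenvalue 0, index 1 for the minimiser.
    Both eigenvalues are at most \<Lambda>, which is nonnegative; independence follows by
    integrating, since \<open>w\<close> has mean 0.\<close>
  define \<mu> where "\<mu> i = (if i = 0 then 0 else \<Lambda>)" for i :: nat
  define u where "u i = (if i = 0 then (\<lambda>_. 1) else w)" for i :: nat
  show ?thesis
  proof (rule exI[of _ \<Lambda>], rule conjI, rule exI[of _ \<mu>], rule exI[of _ u], rule conjI)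
    show "\<forall>i<2. \<mu> i \<le> \<Lambda> \<and> neumann_eigenfunction \<Omega> \<sigma> (\<mu> i) (u i)"
      using eig0 eig1 \<Lambda>0 by (auto simp: \<mu>_def u_def)
    show "lin_indep_ae \<Omega> 2 u"
      unfolding lin_indep_ae_def
    proof (intro allI impI)
      fix c i assume ae: "AE x in M. (\<Sum>i<2. c i * u i x) = 0" and i: "i < (2::nat)"
      have s: "(\<Sum>i<2. f i) = f 0 + f 1" for f :: "nat \<Rightarrow> real" by (simp add: numeral_2_eq_2)
      have ae: "AE x in M. c 0 + c 1 * w x = 0" using ae by (simp add: s u_def)
      have m: "w \<in> borel_measurable M" using sw(1) by (auto simp: sq_integrable_nu dest!: sq_integrable_measurable)
      have "AE x in M. (c 0 + c 1 * w x) * \<sigma> x = 0" using ae by eventually_elim simp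
      then have "(LINT x|M. (c 0 + c 1 * w x) * \<sigma> x) = 0" by (rule integral_eq_zero_AE)
      then have "(LINT x|nu. c 0 + c 1 * w x) = 0" using m by (simp add: integral_nu)
      then have "c 0 * (LINT x|nu. (1::real)) = 0" using iw w0 by (simp add: mult.commute)
      then have c0: "c 0 = 0" using nu_pos by simp
      have "c 1 = 0"
      proof (rule ccontr)
        assume "c 1 \<noteq> 0"
        then have "AE x in M. w x = 0" using ae c0 by simp
        then show False using eig1 by (simp add: neumann_eigenfunction_def)
      qed
      then show "c i = 0" using c0 i by (cases i) (auto simp: less_Suc_eq numeral_2_eq_2)
    qed
    show "\<forall>v V. H1_on \<Omega> v V \<longrightarrow> (LINT x|nu. v x) = 0 \<longrightarrow> \<Lambda> * (LINT x|nu. (v x)\<^sup>2) \<le> (LINT x|nu. (norm (V x))\<^sup>2)"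
      unfolding \<Lambda>_def using min by blast
  qed
qed

text \<open>The set \<open>T\<close> is known to be nonempty and bounded below, so both estimates of
  its infimum are available. The shift \<open>c\<close> is the weighted mean of the coordinate; only
  its existence is recorded, since the integral will be estimated for every shift.\<close>

theorem second_eigenvalue_bounds:
  assumes i: "i \<in> Basis"
  shows "2 * real j \<le> neumann_eigenvalue 2 \<Omega> \<sigma>"
    "\<exists>c. neumann_eigenvalue 2 \<Omega> \<sigma> * (LINT x|M. (x \<bullet> i - c)\<^sup>2 * \<sigma> x) \<le> (LINT x|M. \<sigma> x)"
proof -
  define T where "T = {t. \<exists>\<mu> u. (\<forall>i<2. \<mu> i \<le> t \<and> neumann_eigenfunction \<Omega> \<sigma> (\<mu> i) (u i)) \<and> lin_indep_ae \<Omega> 2 u}"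
  have ev: "neumann_eigenvalue 2 \<Omega> \<sigma> = Inf T" by (simp only: neumann_eigenvalue_def T_def)
  have "\<exists>\<Lambda>. \<Lambda> \<in> T \<and>
    (\<forall>v V. H1_on \<Omega> v V \<longrightarrow> (LINT x|nu. v x) = 0 \<longrightarrow> \<Lambda> * (LINT x|nu. (v x)\<^sup>2) \<le> (LINT x|nu. (norm (V x))\<^sup>2))"
    unfolding T_def mem_Collect_eq by (rule second_eigenvalue_upper)
  then obtain \<Lambda> where \<Lambda>T: "\<Lambda> \<in> T"
    and min: "\<forall>v V. H1_on \<Omega> v V \<longrightarrow> (LINT x|nu. v x) = 0 \<longrightarrow> \<Lambda> * (LINT x|nu. (v x)\<^sup>2) \<le> (LINT x|nu. (norm (V x))\<^sup>2)"
    by blast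
  have low: "2 * real j \<le> t" if "t \<in> T" for t
    using that unfolding T_def by (elim CollectE exE conjE) (rule second_eigenvalue_lower)
  show "2 * real j \<le> neumann_eigenvalue 2 \<Omega> \<sigma>"
    unfolding ev using \<Lambda>T low by (intro cInf_greatest) auto
  have le: "neumann_eigenvalue 2 \<Omega> \<sigma> \<le> \<Lambda>"
    unfolding ev by (rule cInf_lower[OF \<Lambda>T bdd_belowI[OF low]])
  define c where "c = (LINT x|nu. x \<bullet> i) / (LINT x|nu. (1::real))"
  have H: "H1_on \<Omega> (\<lambda>x. x \<bullet> i) (\<lambda>_. i)" by (rule H1_on_coordinate[OF i])
  have mean: "(LINT x|nu. x \<bullet> i - c) = 0" unfolding c_def using H by (intro mean_zero_shift) (simp add: H1_on_iff)
  have m: "(\<lambda>x. (x \<bullet> i - c)\<^sup>2) \<in> borel_measurable M"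
    by (intro measurable_lebesgue_on_continuous continuous_intros)
  have "neumann_eigenvalue 2 \<Omega> \<sigma> * (LINT x|nu. (x \<bullet> i - c)\<^sup>2) \<le> \<Lambda> * (LINT x|nu. (x \<bullet> i - c)\<^sup>2)"
    using le by (intro mult_right_mono) auto
  also have "\<dots> \<le> (LINT x|nu. (norm i)\<^sup>2)" by (rule min[rule_format, OF H1_on_shift[OF H] mean])
  also have "\<dots> = (LINT x|M. \<sigma> x)" using i integral_nu[of "\<lambda>_. 1"] by simp
  finally show "\<exists>c. neumann_eigenvalue 2 \<Omega> \<sigma> * (LINT x|M. (x \<bullet> i - c)\<^sup>2 * \<sigma> x) \<le> (LINT x|M. \<sigma> x)"
    unfolding integral_nu[OF m] by blast
qed

end

section \<open>Gaussian integrals and the comparison of norms\<close>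

lemma nn_integral_gaussian_real:
  assumes "0 < a"
  shows "(\<integral>\<^sup>+x. ennreal (exp (- (a * x\<^sup>2))) \<partial>lborel) = ennreal (sqrt (pi / a))"
proof -
  define s where "s = 1 / sqrt (2 * a)"
  have s: "0 < s" "s\<^sup>2 = 1 / (2 * a)" using assms by (auto simp: s_def power_divide)
  have "(\<integral>\<^sup>+x. ennreal (exp (- (a * x\<^sup>2))) \<partial>lborel) = (\<integral>\<^sup>+x. ennreal (sqrt (pi / a)) * ennreal (normal_density 0 s x) \<partial>lborel)"
  proof (intro nn_integral_cong)
    fix x :: real
    have e: "2 * pi * s\<^sup>2 = pi / a" "x\<^sup>2 / (2 * s\<^sup>2) = a * x\<^sup>2" using assms by (auto simp: s(2) field_simps)
    have "sqrt (pi / a) * normal_density 0 s x = exp (- (a * x\<^sup>2))"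
      using assms by (simp add: normal_density_def e minus_divide_left[symmetric])
    then show "ennreal (exp (- (a * x\<^sup>2))) = ennreal (sqrt (pi / a)) * ennreal (normal_density 0 s x)"
      using assms by (simp flip: ennreal_mult)
  qed
  also have "\<dots> = ennreal (sqrt (pi / a)) * (\<integral>\<^sup>+x. ennreal (normal_density 0 s x) \<partial>lborel)"
    by (intro nn_integral_cmult) auto
  also have "(\<integral>\<^sup>+x. ennreal (normal_density 0 s x) \<partial>lborel) = ennreal 1"
    using integrable_normal_density[OF s(1)] integral_normal_density[OF s(1)] by (subst nn_integral_eq_integral) auto
  finally show ?thesis by simp
qed

lemma nn_integral_gaussian:
  assumes a: "0 < a"
  shows "(\<integral>\<^sup>+x. ennreal (exp (- (a * (norm (x::'a::euclidean_space))\<^sup>2))) \<partial>lborel) = ennreal (sqrt (pi / a) ^ DIM('a))"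
proof -
  have "(\<integral>\<^sup>+x. ennreal (exp (- (a * (norm (x::'a))\<^sup>2))) \<partial>lborel)
    = (\<integral>\<^sup>+x. (\<Prod>b\<in>Basis. ennreal (exp (- (a * (x \<bullet> b)\<^sup>2)))) \<partial>(lborel :: 'a measure))"
  proof (intro nn_integral_cong)
    fix x :: 'a
    have "(norm x)\<^sup>2 = (\<Sum>b\<in>Basis. (x \<bullet> b)\<^sup>2)"
      unfolding power2_norm_eq_inner by (subst euclidean_inner) (simp add: power2_eq_square)
    then have "exp (- (a * (norm x)\<^sup>2)) = (\<Prod>b\<in>Basis. exp (- (a * (x \<bullet> b)\<^sup>2)))"
      by (simp add: exp_sum[symmetric] sum_distrib_left sum_negf)
    then show "ennreal (exp (- (a * (norm x)\<^sup>2))) = (\<Prod>b\<in>Basis. ennreal (exp (- (a * (x \<bullet> b)\<^sup>2))))"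
      by (simp add: prod_ennreal)
  qed
  also have "\<dots> = (\<Prod>b\<in>(Basis :: 'a set). (\<integral>\<^sup>+t. ennreal (exp (- (a * t\<^sup>2))) \<partial>lborel))"
    by (rule nn_integral_lborel_prod) auto
  also have "\<dots> = ennreal (sqrt (pi / a) ^ DIM('a))"
    using a by (simp add: nn_integral_gaussian_real ennreal_power)
  finally show ?thesis .
qed

lemma gaussian_integral:
  assumes a: "0 < a"
  shows "integrable lborel (\<lambda>x::'a::euclidean_space. exp (- (a * (norm x)\<^sup>2)))"
    "(LINT x::'a|lborel. exp (- (a * (norm x)\<^sup>2))) = sqrt (pi / a) ^ DIM('a)"
proof -
  have m: "(\<lambda>x::'a. exp (- (a * (norm x)\<^sup>2))) \<in> borel_measurable lborel" by measurable
  show "integrable lborel (\<lambda>x::'a. exp (- (a * (norm x)\<^sup>2)))"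
    using nn_integral_gaussian[OF a, where 'a='a] m by (simp add: integrable_iff_bounded)
  show "(LINT x::'a|lborel. exp (- (a * (norm x)\<^sup>2))) = sqrt (pi / a) ^ DIM('a)"
    using nn_integral_gaussian[OF a, where 'a='a] m a
    by (intro integral_eq_nn_integral[THEN trans]) (auto)
qed

lemma (in bounded_domain) integral_M_lborel:
  fixes f :: "'a \<Rightarrow> real"
  assumes "f \<in> borel_measurable borel"
  shows "(LINT x|M. f x) = (LINT x|lborel. indicator \<Omega> x * f x)"
  by (rule integral_lebesgue_on_eq_lborel[OF sets_\<Omega>(2) assms])

lemma (in bounded_domain) integral_ge_ball:
  assumes f: "f \<in> borel_measurable borel" "integrable lborel f" "\<And>x. x \<in> \<Omega> \<Longrightarrow> 0 \<le> f x"
    and b: "ball p r \<subseteq> \<Omega>" "\<And>x. x \<in> ball p r \<Longrightarrow> c \<le> f x" and r: "0 \<le> r"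
  shows "c * (unit_ball_vol (real DIM('a)) * r ^ DIM('a)) \<le> (LINT x|M. f x)"
proof -
  have "c * (unit_ball_vol (real DIM('a)) * r ^ DIM('a)) = (LINT x|lborel. indicator (ball p r) x * c)"
    using content_ball[OF r, of p] by (simp add: emeasure_lborel_ball_finite)
  also have "\<dots> \<le> (LINT x|lborel. indicator \<Omega> x * f x)"
  proof (rule integral_mono)
    show "integrable lborel (\<lambda>x. indicator (ball p r) x * c)"
      using emeasure_bounded_finite[OF bounded_ball, of p r]
      by (intro integrable_mult_left integrable_real_indicator) auto
    show "integrable lborel (\<lambda>x. indicator \<Omega> x * f x)"
      using integrable_mult_indicator[OF _ f(2), of \<Omega>] sets_\<Omega> by simp
    show "indicator (ball p r) x * c \<le> indicator \<Omega> x * f x" for x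
      using b f(3)[of x] by (auto simp: indicator_def)
  qed
  also have "\<dots> = (LINT x|M. f x)" by (rule integral_M_lborel[OF f(1), symmetric])
  finally show ?thesis .
qed

section \<open>Estimates of the norms and of their quotient\<close>

context gauss_domain
begin

definition Z :: real where "Z = (LINT x|M. \<sigma> x)"
text \<open>The length scale of the Gaussian: within this distance of the origin the density is at
  least exp(-1), and its integral over the whole space is
  \<open>(sqrt pi * \<rho>) ^ DIM('a)\<close>. All later estimates are powers of it.\<close>

definition \<rho> :: real where "\<rho> = 1 / sqrt (real j)"

lemma \<rho>: "0 < \<rho>" "\<rho>\<^sup>2 = 1 / real j" "sqrt (pi / real j) = sqrt pi * \<rho>" "real j = 1 / \<rho>\<^sup>2"
  using j by (auto simp: \<rho>_def real_sqrt_divide power_divide)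

lemma \<sigma>_borel[measurable]: "\<sigma> \<in> borel_measurable borel"
  unfolding gauss_density_def by measurable

lemma integrable_\<sigma>: "integrable lborel \<sigma>"
  using gaussian_integral(1)[of "real j", where 'a='a] j by (simp add: gauss_density_def[abs_def])

lemma Lp_norm_1: "Lp_norm \<Omega> 1 \<sigma> = Z"
proof -
  have "0 \<le> (LINT x|M. \<sigma> x)" using \<sigma>_pos by (simp add: less_imp_le)
  then show ?thesis using \<sigma>_pos by (simp add: Lp_norm_def Z_def less_imp_le)
qed

text \<open>The same bound serves for all exponents: the power \<open>q\<close> only narrows the
  Gaussian, and the resulting gain is discarded.\<close>

lemma power_integral_le:
  assumes q: "1 \<le> q"
  shows "(LINT x|M. \<sigma> x powr q) \<le> (sqrt pi * \<rho>) ^ DIM('a)"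
proof -
  have e: "\<sigma> x powr q = exp (- (real j * q * (norm x)\<^sup>2))" for x :: 'a
    by (simp add: gauss_density_def powr_def)
  have jq: "0 < real j * q" using j q by simp
  note g = gaussian_integral[OF jq, where 'a='a]
  have "(LINT x|M. \<sigma> x powr q) = (LINT x|lborel. indicator \<Omega> x * \<sigma> x powr q)"
    by (rule integral_M_lborel) measurable
  also have "\<dots> \<le> (LINT x|lborel. \<sigma> x powr q)"
    using integrable_mult_indicator[OF _ g(1), of \<Omega>] sets_\<Omega> g(1)
    by (intro integral_mono) (auto simp: e indicator_def)
  also have "\<dots> = sqrt (pi / (real j * q)) ^ DIM('a)" using g(2) by (simp add: e)
  also have "\<dots> \<le> sqrt (pi / real j) ^ DIM('a)"
    using q j by (intro power_mono real_sqrt_le_mono divide_left_mono) auto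
  finally show ?thesis by (simp only: \<rho>(3))
qed

lemma Z_upper: "Z \<le> (sqrt pi * \<rho>) ^ DIM('a)"
  using power_integral_le[of 1] \<sigma>_pos by (simp add: Z_def less_imp_le)

text \<open>Outside \<Omega> the norm is at least \<open>R\<close>. Half of the exponent there
  supplies the small factor \<open>E\<close>, the other half stays behind as an integrable Gaussian,
  whose integral is larger by \<open>sqrt 2 ^ DIM('a)\<close>. The threshold for \<open>j\<close>
  makes the lost mass at most one half.\<close>

lemma Z_lower:
  assumes R: "ball 0 R \<subseteq> \<Omega>" "0 < R" and large: "2 * ln (2 * sqrt 2 ^ DIM('a)) / R\<^sup>2 \<le> real j"
  shows "(sqrt pi * \<rho>) ^ DIM('a) / 2 \<le> Z"
proof -
  define J where "J = real j"
  have J: "0 < J" using j by (simp add: J_def)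
  define E where "E = exp (- (J * R\<^sup>2 / 2))"
  have g: "integrable lborel (\<lambda>x::'a. exp (- (J * (norm x)\<^sup>2)))" "(LINT x::'a|lborel. exp (- (J * (norm x)\<^sup>2))) = sqrt (pi / J) ^ DIM('a)"
    using gaussian_integral[OF J, where 'a='a] by auto
  have J2: "0 < J / 2" using J by simp
  have g2: "integrable lborel (\<lambda>x::'a. exp (- (J / 2 * (norm x)\<^sup>2)))" "(LINT x::'a|lborel. exp (- (J / 2 * (norm x)\<^sup>2))) = sqrt (pi / (J / 2)) ^ DIM('a)"
    using gaussian_integral[OF J2, where 'a='a] by auto
  have s: "\<sigma> x = exp (- (J * (norm x)\<^sup>2))" for x :: 'a by (simp add: gauss_density_def J_def)
  have i\<Omega>: "integrable lborel (\<lambda>x. indicator \<Omega> x * \<sigma> x)"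
    using integrable_mult_indicator[OF _ integrable_\<sigma>, of \<Omega>] sets_\<Omega> by simp
  have "sqrt (pi / J) ^ DIM('a) = (LINT x|lborel. \<sigma> x)" using g by (simp add: s)
  also have "\<dots> \<le> (LINT x|lborel. indicator \<Omega> x * \<sigma> x + E * exp (- (J / 2 * (norm x)\<^sup>2)))"
  proof (rule integral_mono)
    fix x :: 'a
    show "\<sigma> x \<le> indicator \<Omega> x * \<sigma> x + E * exp (- (J / 2 * (norm x)\<^sup>2))"
    proof (cases "x \<in> \<Omega>")
      case False
      then have "R \<le> norm x" using R by (force simp: not_less)
      then have "R\<^sup>2 \<le> (norm x)\<^sup>2" using R(2) by (intro power_mono) auto
      then have "J * R\<^sup>2 \<le> J * (norm x)\<^sup>2" using J by simp
      then have "- (J * (norm x)\<^sup>2) \<le> - (J * R\<^sup>2 / 2) + - (J / 2 * (norm x)\<^sup>2)" by simp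
      then have "exp (- (J * (norm x)\<^sup>2)) \<le> exp (- (J * R\<^sup>2 / 2) + - (J / 2 * (norm x)\<^sup>2))"
        by (simp only: exp_le_cancel_iff)
      then show ?thesis using False by (simp only: s E_def exp_add) simp
    qed (simp add: E_def)
  qed (use integrable_\<sigma> i\<Omega> g2 in auto)
  also have "\<dots> = Z + E * sqrt (pi / (J / 2)) ^ DIM('a)"
    using i\<Omega> g2 integral_M_lborel[of \<sigma>] by (simp add: Z_def)
  also have "sqrt (pi / (J / 2)) ^ DIM('a) = sqrt 2 ^ DIM('a) * sqrt (pi / J) ^ DIM('a)"
    by (simp add: power_mult_distrib[symmetric] real_sqrt_mult[symmetric] mult.commute)
  finally have le: "sqrt (pi / J) ^ DIM('a) \<le> Z + (E * sqrt 2 ^ DIM('a)) * sqrt (pi / J) ^ DIM('a)" by (simp add: mult.assoc)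
  have "2 * ln (2 * sqrt 2 ^ DIM('a)) \<le> J * R\<^sup>2" using large R(2) by (simp add: J_def pos_divide_le_eq)
  then have "ln (2 * sqrt 2 ^ DIM('a)) \<le> J * R\<^sup>2 / 2" by simp
  then have "exp (ln (2 * sqrt 2 ^ DIM('a))) \<le> exp (J * R\<^sup>2 / 2)" by (simp only: exp_le_cancel_iff)
  then have "2 * sqrt 2 ^ DIM('a) \<le> exp (J * R\<^sup>2 / 2)" by simp
  then have "E * sqrt 2 ^ DIM('a) \<le> 1 / 2" by (simp add: E_def exp_minus field_simps)
  then have "(E * sqrt 2 ^ DIM('a)) * sqrt (pi / J) ^ DIM('a) \<le> 1 / 2 * sqrt (pi / J) ^ DIM('a)"
    using J by (intro mult_right_mono) auto
  then have "sqrt (pi / J) ^ DIM('a) / 2 \<le> Z" using le by linarith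
  then show ?thesis by (simp only: J_def \<rho>(3))
qed

lemma \<sigma>_ge: "norm x \<le> \<rho> \<Longrightarrow> exp (- 1) \<le> \<sigma> x"
proof -
  assume "norm x \<le> \<rho>"
  then have "(norm x)\<^sup>2 \<le> \<rho>\<^sup>2" by (intro power_mono) auto
  then have "real j * (norm x)\<^sup>2 \<le> real j * (1 / real j)" unfolding \<rho>(2) by (intro mult_left_mono) auto
  then show ?thesis using j by (simp add: gauss_density_def)
qed

text \<open>The mass \<open>Z\<close> is at most of order \<rho> to the power n, while the integral
  of the squared coordinate is at least of order n + 2, so their quotient is of order j. The factor
  \<open>4 ^ (DIM('a) + 2)\<close> reflects the ball of radius \<open>\<rho> / 4\<close> on which
  that integral is estimated.\<close>

lemma second_eigenvalue_linear:
  assumes \<rho>\<Omega>: "ball 0 \<rho> \<subseteq> \<Omega>"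
  shows "neumann_eigenvalue 2 \<Omega> \<sigma> \<le> (sqrt pi ^ DIM('a) * exp 1 * 4 ^ (DIM('a) + 2) / unit_ball_vol (real DIM('a))) * real j"
proof -
  obtain i :: 'a where i: "i \<in> Basis" using nonempty_Basis by blast
  obtain c where c: "neumann_eigenvalue 2 \<Omega> \<sigma> * (LINT x|M. (x \<bullet> i - c)\<^sup>2 * \<sigma> x) \<le> Z"
    using second_eigenvalue_bounds(2)[OF i] unfolding Z_def by blast
  \<comment> \<open>The value of \<open>c\<close> is unknown, only its sign can be used: the ball is
    centred at distance \<open>\<rho> / 2\<close> from the origin on the side away from
    \<open>c\<close>, so that the coordinate differs from \<open>c\<close> by at least
    \<open>\<rho> / 4\<close> on it.\<close>
  define s where "s = (if c \<le> 0 then 1 else - 1 :: real)"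
  define p where "p = (s * (\<rho> / 2)) *\<^sub>R i"
  have ni: "norm i = 1" using i by simp
  have np: "norm p = \<rho> / 2" using \<rho>(1) by (simp add: p_def s_def ni)
  have sub: "norm x \<le> \<rho>" if "x \<in> ball p (\<rho> / 4)" for x
  proof -
    have "norm x \<le> norm p + dist p x" using norm_triangle_ineq2[of x p] by (simp add: dist_norm norm_minus_commute)
    then show ?thesis using that np \<rho>(1) by simp
  qed
  have sub\<Omega>: "ball p (\<rho> / 4) \<subseteq> \<Omega>"
  proof
    fix x assume x: "x \<in> ball p (\<rho> / 4)"
    have "norm x \<le> norm p + dist p x" using norm_triangle_ineq2[of x p] by (simp add: dist_norm norm_minus_commute)
    then have "norm x < \<rho>" using x np \<rho>(1) by simp
    then show "x \<in> \<Omega>" using \<rho>\<Omega> by auto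
  qed
  have lower: "(\<rho> / 4)\<^sup>2 * exp (- 1) \<le> (x \<bullet> i - c)\<^sup>2 * \<sigma> x" if x: "x \<in> ball p (\<rho> / 4)" for x
  proof -
    have "\<bar>(x - p) \<bullet> i\<bar> \<le> norm (x - p) * norm i" by (rule Cauchy_Schwarz_ineq2)
    also have "\<dots> < \<rho> / 4" using x by (simp add: ni dist_norm norm_minus_commute)
    finally have "\<bar>x \<bullet> i - s * (\<rho> / 2)\<bar> < \<rho> / 4" using i by (simp add: p_def inner_diff_left)
    then have h: "\<bar>x \<bullet> i - s * (\<rho> / 2)\<bar> < \<rho> / 4" .
    have "\<rho> / 4 \<le> \<bar>x \<bullet> i - c\<bar>"
    proof (cases "c \<le> 0")
      case True
      with h have "\<bar>x \<bullet> i - \<rho> / 2\<bar> < \<rho> / 4" by (simp add: s_def)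
      with True show ?thesis by linarith
    next
      case False
      with h have "\<bar>x \<bullet> i + \<rho> / 2\<bar> < \<rho> / 4" by (simp add: s_def)
      with False show ?thesis by linarith
    qed
    then have "(\<rho> / 4)\<^sup>2 \<le> \<bar>x \<bullet> i - c\<bar>\<^sup>2" using \<rho>(1) by (intro power_mono) auto
    then have "(\<rho> / 4)\<^sup>2 \<le> (x \<bullet> i - c)\<^sup>2" by simp
    then show ?thesis using \<sigma>_ge[OF sub[OF x]] by (intro mult_mono) auto
  qed
  define f where "f x = indicator \<Omega> x * ((x \<bullet> i - c)\<^sup>2 * \<sigma> x)" for x
  have m: "(\<lambda>x. (x \<bullet> i - c)\<^sup>2 * \<sigma> x) \<in> borel_measurable borel" by measurable
  have fm: "f \<in> borel_measurable borel" unfolding f_def using sets_\<Omega> m by measurable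
  have fM: "(LINT x|M. f x) = (LINT x|M. (x \<bullet> i - c)\<^sup>2 * \<sigma> x)"
    by (intro Bochner_Integration.integral_cong) (auto simp: f_def)
  have fi: "integrable lborel f"
  proof -
    have "continuous_on UNIV (\<lambda>x. (x \<bullet> i - c)\<^sup>2 * \<sigma> x)"
      by (intro continuous_intros smooth_on_UNIV_continuous smooth_\<sigma>)
    then obtain B where B: "\<And>x. x \<in> \<Omega> \<Longrightarrow> norm ((x \<bullet> i - c)\<^sup>2 * \<sigma> x) \<le> B"
      using smooth_bounded_on[OF _ bounded_\<Omega>] by blast
    show ?thesis
    proof (rule Bochner_Integration.integrable_bound)
      show "integrable lborel (\<lambda>x. \<bar>B\<bar> * indicator \<Omega> x)"
        using emeasure_bounded_finite[OF bounded_\<Omega>] sets_\<Omega> by (intro integrable_mult_right integrable_real_indicator) auto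
      show "AE x in lborel. norm (f x) \<le> norm (\<bar>B\<bar> * indicator \<Omega> x)"
        using B by (intro AE_I2) (force simp: f_def indicator_def)
    qed (use fm in simp)
  qed
  have "((\<rho> / 4)\<^sup>2 * exp (- 1)) * (unit_ball_vol (real DIM('a)) * (\<rho> / 4) ^ DIM('a)) \<le> (LINT x|M. f x)"
    using lower sub\<Omega> \<rho>(1) \<sigma>_pos
    by (intro integral_ge_ball[OF fm fi _ sub\<Omega>]) (auto simp: f_def less_imp_le)
  moreover have "0 \<le> neumann_eigenvalue 2 \<Omega> \<sigma>" using second_eigenvalue_bounds(1)[OF i] j by linarith
  ultimately have "neumann_eigenvalue 2 \<Omega> \<sigma> * (((\<rho> / 4)\<^sup>2 * exp (- 1)) * (unit_ball_vol (real DIM('a)) * (\<rho> / 4) ^ DIM('a))) \<le> Z"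
    using c unfolding fM by (meson mult_left_mono order_trans)
  also have "Z \<le> (sqrt pi * \<rho>) ^ DIM('a)" by (rule Z_upper)
  finally have "neumann_eigenvalue 2 \<Omega> \<sigma> \<le> (sqrt pi * \<rho>) ^ DIM('a) / (((\<rho> / 4)\<^sup>2 * exp (- 1)) * (unit_ball_vol (real DIM('a)) * (\<rho> / 4) ^ DIM('a)))"
    using \<rho>(1) unit_ball_vol_pos[of "real DIM('a)"] by (simp add: pos_le_divide_eq)
  also have "\<dots> = (sqrt pi ^ DIM('a) * exp 1 * 4 ^ (DIM('a) + 2) / unit_ball_vol (real DIM('a))) * (1 / \<rho>\<^sup>2)"
    using \<rho>(1) unit_ball_vol_pos[of "real DIM('a)"] by (simp add: power_mult_distrib power_divide exp_minus field_simps power_add)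
  finally show ?thesis by (simp only: \<rho>(4))
qed

text \<open>The integral of the power q is of order \<rho> to the n, and n / q is n - 2. In
  dimension two this exponent is 0 and the bounds place the supremum between exp(-1) and 1, so one
  pair of formulas covers both readings of the norm.\<close>

lemma critical_norm_bounds:
  assumes n2: "2 \<le> DIM('a)"
  shows "critical_norm \<Omega> \<sigma> \<le> (sqrt pi * \<rho>) ^ (DIM('a) - 2)"
    and "ball 0 \<rho> \<subseteq> \<Omega> \<Longrightarrow> exp (- 1) * unit_ball_vol (real DIM('a)) powr ((DIM('a) - 2) / DIM('a)) * \<rho> ^ (DIM('a) - 2) \<le> critical_norm \<Omega> \<sigma>"
proof -
  show "critical_norm \<Omega> \<sigma> \<le> (sqrt pi * \<rho>) ^ (DIM('a) - 2)"
  proof (cases "DIM('a) = 2")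
    case True
    let ?e = "esssup M (\<lambda>x. ereal \<bar>\<sigma> x\<bar>)"
    have "?e \<le> ereal 1"
      using \<sigma>_le_1 \<sigma>_pos by (intro esssup_I) (auto simp: less_imp_le)
    then have "real_of_ereal ?e \<le> 1" by (cases ?e) auto
    then show ?thesis using True by (simp add: critical_norm_def Linf_norm_def)
  next
    case False
    with n2 have n3: "2 < DIM('a)" by simp
    define q where "q = real DIM('a) / (real DIM('a) - 2)"
    have q: "1 \<le> q" "0 < q" "1 / q = real (DIM('a) - 2) / real DIM('a)" using n3 by (auto simp: q_def of_nat_diff)
    have p0: "0 < sqrt pi * \<rho>" using \<rho>(1) by simp
    have "(LINT x|M. \<bar>\<sigma> x\<bar> powr q) powr (1 / q) \<le> ((sqrt pi * \<rho>) ^ DIM('a)) powr (1 / q)"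
      using power_integral_le[OF q(1)] \<sigma>_pos q(2) by (intro powr_mono2) (auto simp: less_imp_le)
    also have "\<dots> = (sqrt pi * \<rho>) powr (real DIM('a) * (1 / q))"
      using p0 by (simp add: powr_realpow[symmetric] powr_powr)
    also have "\<dots> = (sqrt pi * \<rho>) ^ (DIM('a) - 2)"
      using p0 n3 by (simp add: q(3) powr_realpow[symmetric])
    finally show ?thesis using False by (simp add: critical_norm_def Lp_norm_def q_def)
  qed
next
  assume \<rho>\<Omega>: "ball 0 \<rho> \<subseteq> \<Omega>"
  show "exp (- 1) * unit_ball_vol (real DIM('a)) powr ((DIM('a) - 2) / DIM('a)) * \<rho> ^ (DIM('a) - 2) \<le> critical_norm \<Omega> \<sigma>"
  proof (cases "DIM('a) = 2")
    case True
    let ?e = "esssup M (\<lambda>x. ereal \<bar>\<sigma> x\<bar>)"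
    have up: "?e \<le> ereal 1"
      using \<sigma>_le_1 \<sigma>_pos by (intro esssup_I) (auto simp: less_imp_le)
    \<comment> \<open>A smaller essential supremum would make the ball of radius \<rho> a null
      set.\<close>
    have "ereal (exp (- 1)) \<le> ?e"
    proof (rule ccontr)
      assume "\<not> ereal (exp (- 1)) \<le> ?e"
      then have lt: "?e < ereal (exp (- 1))" by simp
      have "AE x in M. ereal \<bar>\<sigma> x\<bar> \<le> ?e" by (rule esssup_AE)
      then have "AE x in M. x \<notin> ball 0 \<rho>"
      proof eventually_elim
        case (elim x)
        show ?case
        proof
          assume "x \<in> ball 0 \<rho>"
          then have "exp (- 1) \<le> \<sigma> x" by (intro \<sigma>_ge) simp
          then have "ereal (exp (- 1)) \<le> ereal \<bar>\<sigma> x\<bar>" by simp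
          then show False using elim lt by order
        qed
      qed
      then have "AE x in lebesgue. x \<in> \<Omega> \<longrightarrow> x \<notin> ball 0 \<rho>" by (simp add: AE_restrict_space_iff sets_\<Omega>)
      then have "AE x in lebesgue. x \<notin> ball (0::'a) \<rho>" by (rule eventually_mono) (use \<rho>\<Omega> in blast)
      then have "ball (0::'a) \<rho> \<in> null_sets lebesgue" by (subst (asm) AE_iff_null) (auto simp: ball_def)
      then have "negligible (ball (0::'a) \<rho>)" by (simp add: negligible_iff_null_sets)
      then show False using open_not_negligible[of "ball (0::'a) \<rho>"] \<rho>(1) by simp
    qed
    then have "exp (- 1) \<le> real_of_ereal ?e" using up by (cases ?e) auto
    then show ?thesis using True by (simp add: critical_norm_def Linf_norm_def unit_ball_vol_2)
  next
    case False
    with n2 have n3: "2 < DIM('a)" by simp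
    define q where "q = real DIM('a) / (real DIM('a) - 2)"
    have q: "1 \<le> q" "0 < q" "1 / q = real (DIM('a) - 2) / real DIM('a)" using n3 by (auto simp: q_def of_nat_diff)
    have e: "\<sigma> x powr q = exp (- (real j * q * (norm x)\<^sup>2))" for x :: 'a
      by (simp add: gauss_density_def powr_def)
    have jq: "0 < real j * q" using j q by simp
    have "exp (- 1) powr q * (unit_ball_vol (real DIM('a)) * \<rho> ^ DIM('a)) \<le> (LINT x|M. \<sigma> x powr q)"
    proof (rule integral_ge_ball[OF _ _ _ \<rho>\<Omega>])
      show "integrable lborel (\<lambda>x. \<sigma> x powr q)" using gaussian_integral(1)[OF jq, where 'a='a] by (simp add: e)
      show "exp (- 1) powr q \<le> \<sigma> x powr q" if "x \<in> ball 0 \<rho>" for x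
        using \<sigma>_ge[of x] that q by (intro powr_mono2) auto
    qed (use \<rho>(1) in auto)
    then have "(exp (- 1) powr q * (unit_ball_vol (real DIM('a)) * \<rho> ^ DIM('a))) powr (1 / q) \<le> (LINT x|M. \<sigma> x powr q) powr (1 / q)"
      using q(2) \<rho>(1) unit_ball_vol_pos[of "real DIM('a)"] by (intro powr_mono2) (auto simp: less_imp_le)
    also have "(exp (- 1) powr q * (unit_ball_vol (real DIM('a)) * \<rho> ^ DIM('a))) powr (1 / q) = exp (- 1) * (unit_ball_vol (real DIM('a)) powr (1 / q) * (\<rho> ^ DIM('a)) powr (1 / q))"
      using q(2) \<rho>(1) unit_ball_vol_pos[of "real DIM('a)"] by (simp add: powr_mult powr_powr)
    also have "(\<rho> ^ DIM('a)) powr (1 / q) = \<rho> powr (real DIM('a) * (1 / q))"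
      using \<rho>(1) by (simp add: powr_realpow[symmetric] powr_powr)
    also have "\<dots> = \<rho> ^ (DIM('a) - 2)"
      using \<rho>(1) n3 by (simp add: q(3) powr_realpow[symmetric])
    finally show ?thesis using False \<sigma>_pos n2 by (simp add: critical_norm_def Lp_norm_def q_def[symmetric] q(3) less_imp_le mult.assoc of_nat_diff[symmetric])
  qed
qed

definition ratio :: real where "ratio = critical_norm \<Omega> \<sigma> / Lp_norm \<Omega> 1 \<sigma>"

lemma Z_pos: "0 < Z"
  using nu_pos integral_nu[of "\<lambda>_. 1"] by (simp add: Z_def)

lemma \<rho>_power: "2 \<le> DIM('a) \<Longrightarrow> \<rho> ^ (DIM('a) - 2) / \<rho> ^ DIM('a) = real j"
proof -
  assume "2 \<le> DIM('a)"
  then have "\<rho> ^ DIM('a) = \<rho> ^ (DIM('a) - 2) * \<rho>\<^sup>2" by (metis le_add_diff_inverse2 power_add)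
  then show ?thesis using \<rho>(1) by (simp add: \<rho>(4))
qed

lemma ratio_le_eigenvalue:
  assumes n2: "2 \<le> DIM('a)" and R: "ball 0 R \<subseteq> \<Omega>" "0 < R" and large: "2 * ln (2 * sqrt 2 ^ DIM('a)) / R\<^sup>2 \<le> real j"
  shows "ratio \<le> neumann_eigenvalue 2 \<Omega> \<sigma>"
proof -
  obtain i :: 'a where i: "i \<in> Basis" using nonempty_Basis by blast
  have p0: "0 < sqrt pi * \<rho>" using \<rho>(1) by simp
  have "ratio \<le> (sqrt pi * \<rho>) ^ (DIM('a) - 2) / ((sqrt pi * \<rho>) ^ DIM('a) / 2)"
    unfolding ratio_def Lp_norm_1 using critical_norm_bounds(1)[OF n2] Z_lower[OF R large] p0 by (intro frac_le) auto
  also have "(sqrt pi * \<rho>) ^ DIM('a) = (sqrt pi * \<rho>) ^ (DIM('a) - 2) * (sqrt pi * \<rho>)\<^sup>2" using n2 by (metis le_add_diff_inverse2 power_add)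
  also have "(sqrt pi * \<rho>) ^ (DIM('a) - 2) / ((sqrt pi * \<rho>) ^ (DIM('a) - 2) * (sqrt pi * \<rho>)\<^sup>2 / 2) = 2 / (pi * \<rho>\<^sup>2)"
    using p0 by (simp add: power_mult_distrib)
  \<comment> \<open>Half of the Gaussian mass costs a factor 2, which is the 2 of the Poincare
    constant; what is needed beyond this is that pi is at least 1.\<close>
  also have "\<dots> \<le> 2 / (1 * \<rho>\<^sup>2)"
    using pi_gt3 \<rho>(1) by (intro divide_left_mono mult_right_mono) auto
  also have "\<dots> = 2 * real j" by (simp add: \<rho>(4))
  also have "\<dots> \<le> neumann_eigenvalue 2 \<Omega> \<sigma>" by (rule second_eigenvalue_bounds(1)[OF i])
  finally show ?thesis .
qed

lemma ratio_lower:
  assumes n2: "2 \<le> DIM('a)" and \<rho>\<Omega>: "ball 0 \<rho> \<subseteq> \<Omega>"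
  shows "exp (- 1) * unit_ball_vol (real DIM('a)) powr ((DIM('a) - 2) / DIM('a)) / sqrt pi ^ DIM('a) * real j \<le> ratio"
proof -
  have "exp (- 1) * unit_ball_vol (real DIM('a)) powr ((DIM('a) - 2) / DIM('a)) / sqrt pi ^ DIM('a) * real j
    = exp (- 1) * unit_ball_vol (real DIM('a)) powr ((DIM('a) - 2) / DIM('a)) * \<rho> ^ (DIM('a) - 2) / (sqrt pi * \<rho>) ^ DIM('a)"
    unfolding \<rho>_power[OF n2, symmetric] by (simp add: power_mult_distrib)
  also have "\<dots> \<le> ratio"
    unfolding ratio_def Lp_norm_1 using critical_norm_bounds(2)[OF n2 \<rho>\<Omega>] Z_upper Z_pos \<rho>(1)
    by (intro frac_le) (auto intro: order_trans[rotated])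
  finally show ?thesis .
qed

end

text \<open>A ball that meets \<Omega> and its complement is connected, hence meets the frontier.
  The frontier is nonempty because \<Omega> is bounded; for an empty set \<open>infdist\<close>
  would be 0 by convention.\<close>

lemma ball_infdist_frontier_subset:
  fixes \<Omega> :: "'a::euclidean_space set"
  assumes "open \<Omega>" "bounded \<Omega>" "0 \<in> \<Omega>"
  shows "0 < infdist 0 (frontier \<Omega>)" "ball 0 (infdist 0 (frontier \<Omega>)) \<subseteq> \<Omega>"
proof -
  have "\<Omega> \<noteq> UNIV" using assms(2) by auto
  then have ne: "frontier \<Omega> \<noteq> {}" using assms by (simp add: frontier_eq_empty) blast
  have "0 \<notin> frontier \<Omega>" using assms by (simp add: frontier_def interior_open)
  then show "0 < infdist 0 (frontier \<Omega>)" using ne infdist_pos_not_in_closed[OF frontier_closed] by metis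
  show "ball 0 (infdist 0 (frontier \<Omega>)) \<subseteq> \<Omega>"
  proof (rule ccontr)
    assume a: "\<not> ball 0 (infdist 0 (frontier \<Omega>)) \<subseteq> \<Omega>"
    have "0 \<in> ball (0::'a) (infdist 0 (frontier \<Omega>)) \<inter> \<Omega>" using \<open>0 < infdist 0 (frontier \<Omega>)\<close> assms(3) by simp
    then have "ball 0 (infdist 0 (frontier \<Omega>)) \<inter> frontier \<Omega> \<noteq> {}"
      using a by (intro connected_Int_frontier connected_ball) blast+
    then obtain y where "y \<in> frontier \<Omega>" "dist 0 y < infdist 0 (frontier \<Omega>)" by auto
    then show False using infdist_le[of y "frontier \<Omega>" 0] by simp
  qed
qed

theorem theorem5p1:
  assumes "CARD('n::finite) \<ge> 2"
  shows "\<exists>(K :: real \<Rightarrow> real) (B :: real).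
    \<forall>\<Omega> :: (real ^ 'n) set.
      open \<Omega> \<and> bounded \<Omega> \<and> convex \<Omega> \<and> smooth_boundary \<Omega> \<and> 0 \<in> \<Omega> \<longrightarrow>
      (\<forall>j::nat. j \<ge> 1 \<and> real j \<ge> K (infdist 0 (frontier \<Omega>)) \<longrightarrow>
         critical_norm \<Omega> (gauss_density j) / Lp_norm \<Omega> 1 (gauss_density j)
           \<le> neumann_eigenvalue 2 \<Omega> (gauss_density j) \<and>
         neumann_eigenvalue 2 \<Omega> (gauss_density j)
           \<le> B * (critical_norm \<Omega> (gauss_density j) / Lp_norm \<Omega> 1 (gauss_density j))) \<and>
      filterlim (\<lambda>j. neumann_eigenvalue 2 \<Omega> (gauss_density j)) at_top sequentially \<and>
      (\<exists>a>0. \<exists>b>0. \<forall>\<^sub>F j in sequentially.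
         a * real j \<le> neumann_eigenvalue 2 \<Omega> (gauss_density j) \<and>
         neumann_eigenvalue 2 \<Omega> (gauss_density j) \<le> b * real j)"
proof -
  define d where "d = DIM(real ^ 'n)"
  have d2: "2 \<le> d" using assms by (simp add: d_def)
  define w where "w = unit_ball_vol (real d)"
  have w: "0 < w" by (simp add: w_def)
  define b where "b = sqrt pi ^ d * exp 1 * 4 ^ (d + 2) / w"
  define a where "a = exp (- 1) * w powr (real (d - 2) / real d) / sqrt pi ^ d"
  have ab: "0 < a" "0 < b" using w by (auto simp: a_def b_def)
  \<comment> \<open>The first entry gives \<open>\<rho> \<le> R\<close>, so that the ball of radius
    \<rho> lies in \<Omega>; the second is the threshold at which the ball of radius
    \<open>R\<close> carries half of the Gaussian mass.\<close>
  define K where "K R = max (1 / R\<^sup>2) (2 * ln (2 * sqrt 2 ^ d) / R\<^sup>2)" for R :: real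
  show ?thesis
  \<comment> \<open>The eigenvalue is at most \<open>b * real j\<close> and the quotient of norms at
    least \<open>a * real j\<close>; both constants are fixed before \<Omega> is.\<close>
  proof (rule exI[of _ K], rule exI[of _ "b / a"], intro allI impI)
    fix \<Omega> :: "(real ^ 'n) set"
    assume \<Omega>: "open \<Omega> \<and> bounded \<Omega> \<and> convex \<Omega> \<and> smooth_boundary \<Omega> \<and> 0 \<in> \<Omega>"
    define R where "R = infdist 0 (frontier \<Omega>)"
    have R: "0 < R" "ball 0 R \<subseteq> \<Omega>" using ball_infdist_frontier_subset[of \<Omega>] \<Omega> by (auto simp: R_def)
    let ?ev = "\<lambda>j. neumann_eigenvalue 2 \<Omega> (gauss_density j)"
    let ?r = "\<lambda>j. critical_norm \<Omega> (gauss_density j) / Lp_norm \<Omega> 1 (gauss_density j)"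
    have gd: "gauss_domain \<Omega> j" if "1 \<le> j" for j
      using \<Omega> that by unfold_locales auto
    obtain i :: "real ^ 'n" where i: "i \<in> Basis" using nonempty_Basis by blast
    have low: "2 * real j \<le> ?ev j" if "1 \<le> j" for j
      by (rule gauss_domain.second_eigenvalue_bounds(1)[OF gd[OF that] i])
    have rho_sub: "ball 0 (gauss_domain.\<rho> j) \<subseteq> \<Omega>" if "1 \<le> j" "1 / R\<^sup>2 \<le> real j" for j
    proof -
      interpret gauss_domain \<Omega> j by (rule gd[OF that(1)])
      have "1 \<le> real j * R\<^sup>2" using that(2) R(1) by (simp add: pos_divide_le_eq)
      then have "\<rho>\<^sup>2 \<le> R\<^sup>2" unfolding \<rho>(2) using that(1) by (simp add: pos_divide_le_eq mult.commute)
      then have "\<rho> \<le> R" by (rule power2_le_imp_le) (use R(1) in simp)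
      then show ?thesis using R(2) by (meson order_trans subset_ball)
    qed
    have up: "?ev j \<le> b * real j" if "1 \<le> j" "1 / R\<^sup>2 \<le> real j" for j
      using gauss_domain.second_eigenvalue_linear[OF gd[OF that(1)] rho_sub[OF that]] by (simp add: b_def w_def d_def)
    have "?r j \<le> ?ev j \<and> ?ev j \<le> b / a * ?r j" if jK: "1 \<le> j \<and> K (infdist 0 (frontier \<Omega>)) \<le> real j" for j
    proof
      interpret gauss_domain \<Omega> j by (rule gd) (use jK in simp)
      have J: "1 \<le> j" "1 / R\<^sup>2 \<le> real j" "2 * ln (2 * sqrt 2 ^ d) / R\<^sup>2 \<le> real j"
      proof -
        have "K R \<le> real j" using jK unfolding R_def by blast
        then show "1 \<le> j" "1 / R\<^sup>2 \<le> real j" "2 * ln (2 * sqrt 2 ^ d) / R\<^sup>2 \<le> real j"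
          using jK by (simp_all add: K_def)
      qed
      show "?r j \<le> ?ev j"
        using ratio_le_eigenvalue[OF _ R(2,1)] J(3) d2 by (simp add: ratio_def d_def)
      have "a * real j \<le> ?r j"
        using ratio_lower[OF _ rho_sub[OF J(1,2)]] d2 by (simp add: ratio_def a_def w_def d_def)
      then have "b / a * (a * real j) \<le> b / a * ?r j" using ab by (intro mult_left_mono) auto
      then show "?ev j \<le> b / a * ?r j" using up[OF J(1,2)] ab by simp
    qed
    moreover have "filterlim ?ev at_top sequentially"
    proof (rule filterlim_at_top_mono)
      show "filterlim (\<lambda>j. 2 * real j) at_top sequentially" by real_asymp
      show "\<forall>\<^sub>F j in sequentially. 2 * real j \<le> ?ev j"
        using low by (auto simp: eventually_sequentially)
    qed
    moreover have "\<exists>a>0. \<exists>b>0. \<forall>\<^sub>F j in sequentially. a * real j \<le> ?ev j \<and> ?ev j \<le> b * real j"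
    proof (rule exI[of _ 2], rule conjI, simp, rule exI[of _ b], rule conjI, fact ab(2))
      obtain N :: nat where N: "1 / R\<^sup>2 \<le> real N" using real_arch_simple by blast
      have "2 * real j \<le> ?ev j \<and> ?ev j \<le> b * real j" if "max 1 N \<le> j" for j
      proof -
        have "1 \<le> j" "1 / R\<^sup>2 \<le> real j" using that N by auto
        then show ?thesis using low up by blast
      qed
      then show "\<forall>\<^sub>F j in sequentially. 2 * real j \<le> ?ev j \<and> ?ev j \<le> b * real j"
        unfolding eventually_sequentially by blast
    qed
    ultimately show "(\<forall>j. 1 \<le> j \<and> K (infdist 0 (frontier \<Omega>)) \<le> real j \<longrightarrow> ?r j \<le> ?ev j \<and> ?ev j \<le> b / a * ?r j) \<and>
      filterlim ?ev at_top sequentially \<and>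
      (\<exists>a>0. \<exists>b>0. \<forall>\<^sub>F j in sequentially. a * real j \<le> ?ev j \<and> ?ev j \<le> b * real j)"
      by blast
  qed
qed

end
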